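(* Let $N \ge 2$, let $\Omega \subset \mathbb{R}^N$ be an open bounded set with Lipschitz boundary, let $\phi: \overline{\Omega} \times \mathbb{R}^N \to [0,\infty)$ be a metric integrand, and let $1 \leq p < \infty$. Let $u \in BV(\Omega)$ be a function of $\phi$-least gradient in $\Omega$ whose trace satisfies $Tu = f \in L^p(\partial\Omega)$, where $L^p(\partial\Omega)$ is taken with respect to $\mathcal{H}^{N-1}$. Then $u \in L^{\frac{Np}{N-1}}(\Omega)$.
   Context: A continuous function $\phi: \overline{\Omega} \times \mathbb{R}^N \to [0,\infty)$ is a metric integrand if: (1) $\phi(x,\cdot)$ is convex for a.e. $x \in \overline{\Omega}$; (2) $\phi(x,t\xi) = |t|\phi(x,\xi)$ for all $x \in \overline{\Omega}$, $\xi \in \mathbb{R}^N$, $t \in \mathbb{R}$; (3) there exist $\lambda, \Lambda > 0$ such that $\lambda|\xi| \leq \phi(x,\xi) \leq \Lambda|\xi|$ for all $x \in \overline{\Omega}$, $\xi \in \mathbb{R}^N$. The polar function of $\phi$ is $\phi^0(x,\xi^* ) = \sup\{\langle \xi^*,\xi\rangle : \xi \in \mathbb{R}^N,\ \phi(x,\xi) \leq 1\}$. For $u \in L^1(\Omega)$ the $\phi$-total variation is $$\int_\Omega |Du|_\phi = \sup\Big\{\int_\Omega u\, \mathrm{div}\,\mathbf{z}\, dx : \mathbf{z} \in C_c^1(\Omega;\mathbb{R}^N),\ \phi^0(x,\mathbf{z}(x)) \leq 1 \text{ a.e.}\Big\},$$ and $BV_\phi(\Omega)$ is the set of $u \in L^1(\Omega)$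 with finite $\phi$-total variation; by (3), $BV_\phi(\Omega) = BV(\Omega)$ as sets. A function $u \in BV_\phi(\Omega)$ is of $\phi$-least gradient in $\Omega$ if $\int_\Omega |Du|_\phi \leq \int_\Omega |D(u+v)|_\phi$ for every $v \in BV_\phi(\Omega)$ compactly supported in $\Omega$. $Tu$ denotes the trace of $u \in BV(\Omega)$ on $\partial\Omega$; $Tu = f$ means that for $\mathcal{H}^{N-1}$-a.e. $x \in \partial\Omega$, $\lim_{r \to 0^+} \frac{1}{|B(x,r)\cap\Omega|}\int_{B(x,r)\cap\Omega} |f(x) - u(y)|\,dy = 0$. *)

theory Defs
  imports "HOL-Analysis.Analysis"
begin

section \<open>Hausdorff measure\<close>

text \<open>The weight is normalised so that the \<open>N\<close>-dimensional measure on \<open>N\<close>-space is Lebesgue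
  measure. The empty set needs a separate clause only because \<open>0 ^ 0 = 1\<close>; boundedness is required
  because \<^const>\<open>diameter\<close> carries no information for unbounded sets.\<close>

definition hausdorff_weight :: "nat \<Rightarrow> 'a::metric_space set \<Rightarrow> ennreal" where
  "hausdorff_weight s C =
     (if C = {} then 0 else ennreal (unit_ball_vol (real s) * (diameter C / 2) ^ s))"

definition hausdorff_covers :: "real \<Rightarrow> 'a::metric_space set \<Rightarrow> (nat \<Rightarrow> 'a set) set" where
  "hausdorff_covers \<delta> A =
     {C. A \<subseteq> (\<Union>i. C i) \<and> (\<forall>i. bounded (C i) \<and> diameter (C i) \<le> \<delta>)}"

definition hausdorff_pre :: "nat \<Rightarrow> real \<Rightarrow> 'a::metric_space set \<Rightarrow> ennreal" where
  "hausdorff_pre s \<delta> A = (INF C \<in> hausdorff_covers \<delta> A. \<Sum>i. hausdorff_weight s (C i))"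

definition hausdorff_outer :: "nat \<Rightarrow> 'a::metric_space set \<Rightarrow> ennreal" where
  "hausdorff_outer s A = (SUP \<delta> \<in> {0<..}. hausdorff_pre s \<delta> A)"

definition hausdorff_measure :: "nat \<Rightarrow> 'a::metric_space measure" where
  "hausdorff_measure s =
     measure_of UNIV (lambda_system UNIV UNIV (hausdorff_outer s)) (hausdorff_outer s)"

text \<open>\<^const>\<open>measure_of\<close> yields the zero measure when its argument is not a measure, so we check
  that this does not happen here.\<close>

lemma hausdorff_pre_subadditive:
  fixes A :: "nat \<Rightarrow> 'a::metric_space set"
  shows "hausdorff_pre s \<delta> (\<Union>i. A i) \<le> (\<Sum>i. hausdorff_pre s \<delta> (A i))"
proof (rule ennreal_le_epsilon)
  fix e :: real
  assume fin: "(\<Sum>i. hausdorff_pre s \<delta> (A i)) < top" and e: "0 < e"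
  let ?e = "\<lambda>i::nat. ennreal (e * (1/2) ^ Suc i)"
  have "\<exists>C \<in> hausdorff_covers \<delta> (A i).
      (\<Sum>j. hausdorff_weight s (C j)) \<le> hausdorff_pre s \<delta> (A i) + ?e i" for i
  proof -
    have "hausdorff_pre s \<delta> (A i) \<noteq> top"
      using ennreal_suminf_lessD[OF fin, of i] by simp
    moreover have "?e i > 0"
      using e by (simp add: ennreal_zero_less_mult_iff)
    ultimately have "hausdorff_pre s \<delta> (A i) < hausdorff_pre s \<delta> (A i) + ?e i"
      by (simp add: ennreal_add_left_cancel_less top.not_eq_extremum)
    then show ?thesis
      unfolding hausdorff_pre_def INF_less_iff by (meson less_imp_le)
  qed
  then obtain C where C: "\<And>i. C i \<in> hausdorff_covers \<delta> (A i)"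
    and le: "\<And>i. (\<Sum>j. hausdorff_weight s (C i j)) \<le> hausdorff_pre s \<delta> (A i) + ?e i"
    by metis
  define D where "D = (\<lambda>n. case prod_decode n of (i, j) \<Rightarrow> C i j)"
  have "(\<Union>i. A i) \<subseteq> (\<Union>n. D n)"
  proof
    fix x assume "x \<in> (\<Union>i. A i)"
    then obtain i j where "x \<in> C i j"
      using C unfolding hausdorff_covers_def by blast
    then have "x \<in> D (prod_encode (i, j))"
      by (simp add: D_def)
    then show "x \<in> (\<Union>n. D n)"
      by blast
  qed
  then have "D \<in> hausdorff_covers \<delta> (\<Union>i. A i)"
    using C by (auto simp: hausdorff_covers_def D_def split: prod.split)
  then have "hausdorff_pre s \<delta> (\<Union>i. A i) \<le> (\<Sum>n. hausdorff_weight s (D n))"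
    unfolding hausdorff_pre_def by (rule INF_lower)
  also have "\<dots> = (\<Sum>n. (\<lambda>(i, j). hausdorff_weight s (C i j)) (prod_decode n))"
    by (simp add: D_def split_beta)
  also have "\<dots> = (\<Sum>i. \<Sum>j. hausdorff_weight s (C i j))"
    by (rule suminf_ennreal_2dimen) simp
  also have "\<dots> \<le> (\<Sum>i. hausdorff_pre s \<delta> (A i) + ?e i)"
    by (intro suminf_le le) auto
  also have "\<dots> = (\<Sum>i. hausdorff_pre s \<delta> (A i)) + (\<Sum>i. ?e i)"
    by (rule suminf_add[symmetric]) auto
  also have "(\<Sum>i. ?e i) = ennreal e"
    using sums_mult[OF power_half_series, of e] e
    by (intro suminf_ennreal_eq) auto
  finally show "hausdorff_pre s \<delta> (\<Union>i. A i) \<le> (\<Sum>i. hausdorff_pre s \<delta> (A i)) + ennreal e" .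
qed

lemma outer_measure_space_hausdorff_outer:
  "outer_measure_space UNIV (hausdorff_outer s :: 'a::metric_space set \<Rightarrow> ennreal)"
  unfolding outer_measure_space_def
proof (intro conjI)
  have "(\<lambda>_. {} :: 'a set) \<in> hausdorff_covers \<delta> {}" if "\<delta> > 0" for \<delta>
    using that by (simp add: hausdorff_covers_def)
  then have "hausdorff_pre s \<delta> ({} :: 'a set) \<le> (\<Sum>i::nat. hausdorff_weight s ({} :: 'a set))"
    if "\<delta> > 0" for \<delta>
    using that unfolding hausdorff_pre_def
    by (intro INF_lower2[where i = "\<lambda>_. {}"]) simp_all
  then show "positive UNIV (hausdorff_outer s :: 'a set \<Rightarrow> ennreal)"
    by (auto simp: positive_def hausdorff_outer_def hausdorff_weight_def)
  have "hausdorff_pre s \<delta> A \<le> hausdorff_pre s \<delta> B" if "A \<subseteq> B" for \<delta> and A B :: "'a set"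
    unfolding hausdorff_pre_def
    by (rule INF_superset_mono) (use that in \<open>auto simp: hausdorff_covers_def\<close>)
  then show "increasing UNIV (hausdorff_outer s :: 'a set \<Rightarrow> ennreal)"
    by (auto simp: increasing_def hausdorff_outer_def intro!: SUP_mono)
  show "countably_subadditive UNIV (hausdorff_outer s :: 'a set \<Rightarrow> ennreal)"
    unfolding countably_subadditive_def hausdorff_outer_def
    by (auto intro!: SUP_least order_trans[OF hausdorff_pre_subadditive] suminf_le SUP_upper)
qed

lemma
  fixes A :: "'a::metric_space set"
  shows sets_hausdorff_measure:
      "sets (hausdorff_measure s :: 'a measure) = lambda_system UNIV UNIV (hausdorff_outer s)"
    and emeasure_hausdorff_measure:
      "A \<in> sets (hausdorff_measure s) \<Longrightarrow> emeasure (hausdorff_measure s) A = hausdorff_outer s A"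
proof -
  let ?L = "lambda_system UNIV UNIV (hausdorff_outer s :: 'a set \<Rightarrow> ennreal)"
  have ms: "measure_space UNIV ?L (hausdorff_outer s)"
    using sigma_algebra.caratheodory_lemma[OF _ outer_measure_space_hausdorff_outer]
    by (metis sigma_algebra_Pow Pow_UNIV)
  then interpret sigma_algebra UNIV ?L
    by (simp add: measure_space_def)
  show sets: "sets (hausdorff_measure s) = ?L"
    by (simp add: hausdorff_measure_def sets_measure_of_eq)
  show "A \<in> sets (hausdorff_measure s) \<Longrightarrow> emeasure (hausdorff_measure s) A = hausdorff_outer s A"
    using ms unfolding sets hausdorff_measure_def measure_space_def
    by (intro emeasure_measure_of_sigma) auto
qed


section \<open>Domains and function spaces\<close>

text \<open>Near each boundary point the set is the strict epigraph, in some unit direction \<open>e\<close>, of a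
  Lipschitz function \<open>\<gamma>\<close> on the hyperplane orthogonal to \<open>e\<close>.\<close>

definition lipschitz_boundary :: "'a::euclidean_space set \<Rightarrow> bool" where
  "lipschitz_boundary \<Omega> \<longleftrightarrow>
     (\<forall>x \<in> frontier \<Omega>. \<exists>e \<gamma> L r. norm e = 1 \<and> r > 0 \<and> L-lipschitz_on {y. y \<bullet> e = 0} \<gamma> \<and>
        \<Omega> \<inter> ball x r = {y \<in> ball x r. \<gamma> (y - (y \<bullet> e) *\<^sub>R e) < y \<bullet> e})"

definition Lp_on :: "'a measure \<Rightarrow> 'a set \<Rightarrow> real \<Rightarrow> ('a \<Rightarrow> real) set" where
  "Lp_on M A p =
     {f. set_borel_measurable M A f \<and> set_integrable M A (\<lambda>x. \<bar>f x\<bar> powr p)}"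

text \<open>Elements of \<open>C\<^sub>c\<^sup>1(\<Omega>;\<real>\<^sup>N)\<close> are represented by their extension by zero to the whole space.\<close>

definition C1c :: "'a::euclidean_space set \<Rightarrow> ('a \<Rightarrow> 'a) set" where
  "C1c \<Omega> =
     {z. (\<exists>z'. (\<forall>x. (z has_derivative blinfun_apply (z' x)) (at x)) \<and> continuous_on UNIV z') \<and>
         compact (closure {x. z x \<noteq> 0}) \<and> closure {x. z x \<noteq> 0} \<subseteq> \<Omega>}"

definition divergence :: "('a::euclidean_space \<Rightarrow> 'a) \<Rightarrow> 'a \<Rightarrow> real" where
  "divergence z x = (\<Sum>b\<in>Basis. frechet_derivative z (at x) b \<bullet> b)"

definition total_variation :: "'a::euclidean_space set \<Rightarrow> ('a \<Rightarrow> real) \<Rightarrow> ereal" where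
  "total_variation \<Omega> u =
     (SUP z \<in> {z \<in> C1c \<Omega>. \<forall>x\<in>\<Omega>. norm (z x) \<le> 1}.
        ereal (LINT x:\<Omega>|lebesgue. u x * divergence z x))"

definition BV :: "'a::euclidean_space set \<Rightarrow> ('a \<Rightarrow> real) set" where
  "BV \<Omega> = {u. set_integrable lebesgue \<Omega> u \<and> total_variation \<Omega> u < \<infinity>}"


section \<open>Metric integrands and functions of least gradient\<close>

definition metric_integrand :: "'a::euclidean_space set \<Rightarrow> ('a \<Rightarrow> 'a \<Rightarrow> real) \<Rightarrow> bool" where
  "metric_integrand \<Omega> \<phi> \<longleftrightarrow>
     continuous_on (closure \<Omega> \<times> UNIV) (\<lambda>(x, \<xi>). \<phi> x \<xi>) \<and>
     (\<forall>x \<in> closure \<Omega>. \<forall>\<xi>. 0 \<le> \<phi> x \<xi>) \<and>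
     (AE x in lebesgue. x \<in> closure \<Omega> \<longrightarrow> convex_on UNIV (\<phi> x)) \<and>
     (\<forall>x \<in> closure \<Omega>. \<forall>\<xi> t. \<phi> x (t *\<^sub>R \<xi>) = \<bar>t\<bar> * \<phi> x \<xi>) \<and>
     (\<exists>l>0. \<exists>L>0. \<forall>x \<in> closure \<Omega>. \<forall>\<xi>. l * norm \<xi> \<le> \<phi> x \<xi> \<and> \<phi> x \<xi> \<le> L * norm \<xi>)"

text \<open>For a metric integrand and \<open>x \<in> closure \<Omega>\<close> the supremum is over a nonempty bounded set.\<close>

definition polar_integrand :: "('a::euclidean_space \<Rightarrow> 'a \<Rightarrow> real) \<Rightarrow> 'a \<Rightarrow> 'a \<Rightarrow> real" where
  "polar_integrand \<phi> x \<xi>' = Sup {\<xi>' \<bullet> \<xi> |\<xi>. \<phi> x \<xi> \<le> 1}"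

definition phi_variation ::
    "('a::euclidean_space \<Rightarrow> 'a \<Rightarrow> real) \<Rightarrow> 'a set \<Rightarrow> ('a \<Rightarrow> real) \<Rightarrow> ereal" where
  "phi_variation \<phi> \<Omega> u =
     (SUP z \<in> {z \<in> C1c \<Omega>. AE x in lebesgue. x \<in> \<Omega> \<longrightarrow> polar_integrand \<phi> x (z x) \<le> 1}.
        ereal (LINT x:\<Omega>|lebesgue. u x * divergence z x))"

definition BV_phi ::
    "('a::euclidean_space \<Rightarrow> 'a \<Rightarrow> real) \<Rightarrow> 'a set \<Rightarrow> ('a \<Rightarrow> real) set" where
  "BV_phi \<phi> \<Omega> = {u. set_integrable lebesgue \<Omega> u \<and> phi_variation \<phi> \<Omega> u < \<infinity>}"

text \<open>Functions are identified when they agree almost everywhere in \<open>\<Omega>\<close>, so support is meant in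
  the essential sense.\<close>

definition compactly_supported_in :: "'a::euclidean_space set \<Rightarrow> ('a \<Rightarrow> real) \<Rightarrow> bool" where
  "compactly_supported_in \<Omega> v \<longleftrightarrow>
     (\<exists>K. compact K \<and> K \<subseteq> \<Omega> \<and> (AE x in lebesgue. x \<in> \<Omega> - K \<longrightarrow> v x = 0))"

definition phi_least_gradient ::
    "('a::euclidean_space \<Rightarrow> 'a \<Rightarrow> real) \<Rightarrow> 'a set \<Rightarrow> ('a \<Rightarrow> real) \<Rightarrow> bool" where
  "phi_least_gradient \<phi> \<Omega> u \<longleftrightarrow> u \<in> BV_phi \<phi> \<Omega> \<and>
     (\<forall>v \<in> BV_phi \<phi> \<Omega>. compactly_supported_in \<Omega> v \<longrightarrow>
        phi_variation \<phi> \<Omega> u \<le> phi_variation \<phi> \<Omega> (\<lambda>x. u x + v x))"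

definition has_trace ::
    "'a::euclidean_space set \<Rightarrow> ('a \<Rightarrow> real) \<Rightarrow> ('a \<Rightarrow> real) \<Rightarrow> bool" where
  "has_trace \<Omega> u f \<longleftrightarrow>
     (AE x in hausdorff_measure (DIM('a) - 1). x \<in> frontier \<Omega> \<longrightarrow>
        ((\<lambda>r. (LINT y:ball x r \<inter> \<Omega>|lebesgue. \<bar>f x - u y\<bar>) / measure lebesgue (ball x r \<inter> \<Omega>))
           \<longlongrightarrow> 0) (at_right 0))"

end

theory Submission
  imports Defs
begin

text \<open>Write \<open>N\<close> for the dimension. Let \<open>G\<close> be nondecreasing and \<open>C\<^sup>1\<close> with \<open>G' \<le> 1\<close> and let \<open>\<eta>\<close> be a
  cutoff function. Mollifying \<open>u\<close> and testing with the convex combination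
  \<open>(1 - \<eta> G'(u)) z\<^sub>1 + \<eta> G'(u) z\<^sub>2\<close> of two admissible fields shows that the variations of
  \<open>u - \<eta> G(u)\<close> and \<open>\<eta> G(u)\<close> add up to at most that of \<open>u\<close> plus a multiple of
  \<open>\<integral> |\<nabla>\<eta>| |G(u)|\<close>. As \<open>u\<close> is of least gradient and \<open>\<eta> G(u)\<close> has compact support, the variation
  of \<open>\<eta> G(u)\<close> is controlled by the boundary layer term alone. For \<open>G\<close> vanishing on \<open>[-t, t]\<close>, a
  covering of the boundary by small balls adapted to the trace bounds that term by a multiple of
  \<open>H {|f| > t}\<close>, where \<open>H\<close> is the Hausdorff measure of dimension \<open>N - 1\<close>. Comparing \<open>\<eta> G(u)\<close> with
  its translates then gives \<open>|{|u| \<ge> 2 t}| \<le> C |{|u| > t}| ^ (1 / N) H {|f| > t}\<close>, which replaces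
  the isoperimetric inequality. Summing over the dyadic levels \<open>t = 2 ^ j\<close> with weights
  \<open>t ^ (N p / (N - 1))\<close> yields the claim.\<close>

section \<open>Continuity of translations\<close>

text \<open>Competitors may change \<open>u\<close> only on a compact part of \<Omega>, so the
  boundary values never enter through an integration by parts. The cutoff \<eta> has to come
  arbitrarily close to the boundary, and its gradient is the whole price. On a ball of radius
  \<open>r\<close> that gradient is of order \<open>1 / r\<close> and the volume of order
  \<open>r ^ N\<close>, which leaves \<open>r ^ (N - 1)\<close>, the scale of \<open>H\<close>.
  Where \<open>|f| > t\<close>, this and \<open>|G| \<le> 1\<close> are all that is used; where
  \<open>|f| \<le> t\<close>, \<open>G\<close> vanishes at the trace value, so the averages of
  \<open>|G(u)|\<close> tend to 0 and the cost disappears in the limit. The chain rule needs a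
  mollification, because \<open>u\<close> has no pointwise gradient. The mixed field contains
  \<open>G'(u)\<close> and is only continuous, so it must be mollified too before it can serve as a
  test field; using the same kernel for both makes the two operations adjoint. The exponent
  \<open>q = N p / (N - 1)\<close> solves \<open>q / N + p = q\<close>: multiplying the level
  estimate by \<open>t ^ q\<close> splits the weight into \<open>(t ^ q) ^ (1 / N)\<close> for the
  level set of \<open>u\<close> and \<open>t ^ p\<close> for that of \<open>f\<close>.\<close>

lemma lborel_translate_reflect:
  fixes f :: "'a::euclidean_space \<Rightarrow> 'b::{banach, second_countable_topology}"
  assumes "f \<in> borel_measurable borel" and "\<bar>t\<bar> = (1::real)"
  shows lborel_integral_shift: "(LBINT x. f (a + t *\<^sub>R x)) = integral\<^sup>L lborel f"
    and lborel_integrable_shift: "integrable lborel (\<lambda>x. f (a + t *\<^sub>R x)) = integrable lborel f"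
proof -
  have d: "lborel = distr lborel borel (\<lambda>x::'a. a + t *\<^sub>R x)"
    using lborel_affine[of t a] assms(2) by (auto simp: density_1)
  show "(LBINT x. f (a + t *\<^sub>R x)) = integral\<^sup>L lborel f"
    by (subst (2) d, subst integral_distr) (use assms in auto)
  show "integrable lborel (\<lambda>x. f (a + t *\<^sub>R x)) = integrable lborel f"
    by (subst (2) d, subst integrable_distr_eq) (use assms in auto)
qed

lemma lborel_plus:
  fixes f :: "'a::euclidean_space \<Rightarrow> 'b::{banach, second_countable_topology}"
  assumes "f \<in> borel_measurable borel"
  shows lborel_integral_plus: "(LBINT x. f (x + a)) = integral\<^sup>L lborel f"
    and lborel_integrable_plus: "integrable lborel (\<lambda>x. f (x + a)) = integrable lborel f"
  using lborel_translate_reflect[OF assms, of 1 a] by (simp_all add: add.commute)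

lemma lborel_minus:
  fixes f :: "'a::euclidean_space \<Rightarrow> 'b::{banach, second_countable_topology}"
  assumes "f \<in> borel_measurable borel"
  shows lborel_integral_minus: "(LBINT x. f (a - x)) = integral\<^sup>L lborel f"
    and lborel_integrable_minus: "integrable lborel (\<lambda>x. f (a - x)) = integrable lborel f"
  using lborel_translate_reflect[OF assms, of "-1" a] by simp_all

lemma integrable_lborel_borel:
  assumes "integrable lborel f" shows "f \<in> borel_measurable borel"
  using borel_measurable_integrable[OF assms] by simp

lemma integrable_mult_bounded:
  fixes f g :: "'a \<Rightarrow> real"
  assumes "integrable M f" "g \<in> borel_measurable M" "\<And>x. \<bar>g x\<bar> \<le> B"
  shows "integrable M (\<lambda>x. f x * g x)"
proof (rule Bochner_Integration.integrable_bound[of M "\<lambda>x. B * f x"])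
  show "integrable M (\<lambda>x. B * f x)" using assms(1) by simp
  show "(\<lambda>x. f x * g x) \<in> borel_measurable M"
    using assms by (auto intro!: borel_measurable_times)
  show "AE x in M. norm (f x * g x) \<le> norm (B * f x)"
  proof (rule AE_I2)
    fix x have "\<bar>g x\<bar> \<le> \<bar>B\<bar>" using assms(3)[of x] by linarith
    then show "norm (f x * g x) \<le> norm (B * f x)"
      using mult_right_mono[of "\<bar>g x\<bar>" "\<bar>B\<bar>" "\<bar>f x\<bar>"] by (simp add: abs_mult mult.commute)
  qed
qed

lemma integrable_scaleR_bounded:
  fixes f :: "'a \<Rightarrow> real" and g :: "'a \<Rightarrow> 'b::euclidean_space"
  assumes "integrable M f" "g \<in> borel_measurable M" "\<And>x. norm (g x) \<le> B"
  shows "integrable M (\<lambda>x. f x *\<^sub>R g x)"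
proof (rule Bochner_Integration.integrable_bound[of M "\<lambda>x. B * f x"])
  show "integrable M (\<lambda>x. B * f x)" using assms(1) by simp
  show "(\<lambda>x. f x *\<^sub>R g x) \<in> borel_measurable M"
    using assms by (auto intro!: borel_measurable_scaleR)
  show "AE x in M. norm (f x *\<^sub>R g x) \<le> norm (B * f x)"
  proof (rule AE_I2)
    fix x have "norm (g x) \<le> \<bar>B\<bar>" using assms(3)[of x] by linarith
    then show "norm (f x *\<^sub>R g x) \<le> norm (B * f x)"
      using mult_right_mono[of "norm (g x)" "\<bar>B\<bar>" "\<bar>f x\<bar>"] by (simp add: abs_mult mult.commute)
  qed
qed

text \<open>Phrased with sequences so that dominated convergence applies directly;
  \<open>L1_translation_small\<close> turns it into a radius.\<close>

definition L1_translation_continuous :: "('a::euclidean_space \<Rightarrow> real) \<Rightarrow> bool" where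
  "L1_translation_continuous f \<longleftrightarrow>
     (\<forall>h. h \<longlonglongrightarrow> 0 \<longrightarrow> (\<lambda>n. \<integral>x. \<bar>f (x + h n) - f x\<bar> \<partial>lborel) \<longlonglongrightarrow> 0)"

lemma integrable_translation_diff:
  fixes f :: "'a::euclidean_space \<Rightarrow> real"
  assumes "integrable lborel f"
  shows "integrable lborel (\<lambda>x. \<bar>f (x + h) - f x\<bar>)"
  using assms lborel_integrable_plus[OF integrable_lborel_borel[OF assms], of h] by auto

text \<open>The approximation error enters twice, at \<open>x + h\<close> and at \<open>x\<close>,
  and by translation invariance both contributions are the same.\<close>

lemma translation_diff_approx:
  fixes f g :: "'a::euclidean_space \<Rightarrow> real"
  assumes f: "integrable lborel f" and g: "integrable lborel g"
  shows "(LBINT x. \<bar>f (x + h) - f x\<bar>)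
    \<le> (LBINT x. \<bar>g (x + h) - g x\<bar>) + 2 * (LBINT x. \<bar>f x - g x\<bar>)"
proof -
  note [simp] = integrable_translation_diff[OF f] integrable_translation_diff[OF g]
  have d: "integrable lborel (\<lambda>x. \<bar>f x - g x\<bar>)" using f g by auto
  note dm = integrable_lborel_borel[OF d]
  have dh: "integrable lborel (\<lambda>x. \<bar>f (x + h) - g (x + h)\<bar>)"
    using lborel_integrable_plus[OF dm, of h] d by simp
  have "(LBINT x. \<bar>f (x + h) - f x\<bar>)
      \<le> (LBINT x. \<bar>g (x + h) - g x\<bar> + (\<bar>f (x + h) - g (x + h)\<bar> + \<bar>f x - g x\<bar>))"
    using d dh by (intro integral_mono) auto
  also have "\<dots> = (LBINT x. \<bar>g (x + h) - g x\<bar>) + ((LBINT x. \<bar>f (x + h) - g (x + h)\<bar>) + (LBINT x. \<bar>f x - g x\<bar>))"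
    using d dh by simp
  also have "(LBINT x. \<bar>f (x + h) - g (x + h)\<bar>) = (LBINT x. \<bar>f x - g x\<bar>)"
    using lborel_integral_plus[OF dm, of h] by simp
  finally show ?thesis by simp
qed

lemma L1_translation_continuous_approx:
  fixes f :: "'a::euclidean_space \<Rightarrow> real"
  assumes f: "integrable lborel f"
    and ap: "\<And>e. e > 0 \<Longrightarrow> \<exists>g. integrable lborel g \<and> L1_translation_continuous g \<and> (LBINT x. \<bar>f x - g x\<bar>) < e"
  shows "L1_translation_continuous f"
  unfolding L1_translation_continuous_def
proof (intro allI impI)
  fix h :: "nat \<Rightarrow> 'a" assume h: "h \<longlonglongrightarrow> 0"
  show "(\<lambda>n. \<integral>x. \<bar>f (x + h n) - f x\<bar> \<partial>lborel) \<longlonglongrightarrow> 0"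
  proof (rule LIMSEQ_I)
    fix e :: real assume e: "e > 0"
    then obtain g where g: "integrable lborel g" "L1_translation_continuous g" "(LBINT x. \<bar>f x - g x\<bar>) < e / 4"
      using ap[of "e/4"] by auto
    then have "(\<lambda>n. \<integral>x. \<bar>g (x + h n) - g x\<bar> \<partial>lborel) \<longlonglongrightarrow> 0"
      using h by (simp add: L1_translation_continuous_def)
    then obtain n0 where n0: "\<And>n. n \<ge> n0 \<Longrightarrow> norm ((LBINT x. \<bar>g (x + h n) - g x\<bar>) - 0) < e / 2"
      using LIMSEQ_D[of _ 0 "e/2"] e half_gt_zero by blast
    have "norm ((LBINT x. \<bar>f (x + h n) - f x\<bar>) - 0) < e" if "n \<ge> n0" for n
    proof -
      have "0 \<le> (LBINT x. \<bar>f (x + h n) - f x\<bar>)" by simp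
      then show ?thesis
        using translation_diff_approx[OF f g(1), of "h n"] n0[OF that] g(3) by auto
    qed
    then show "\<exists>no. \<forall>n\<ge>no. norm ((LBINT x. \<bar>f (x + h n) - f x\<bar>) - 0) < e" by blast
  qed
qed

text \<open>For 0-1 values \<open>|a - b| = a + b - 2 a b\<close>, so everything reduces to the
  overlap of \<open>U\<close> with its translate. Openness makes the overlap integrand converge at
  each point of \<open>U\<close>; elsewhere it is 0.\<close>

lemma L1_translation_continuous_open:
  fixes U :: "'a::euclidean_space set"
  assumes U: "open U" "emeasure lborel U < \<infinity>"
  shows "L1_translation_continuous (indicator U)"
  unfolding L1_translation_continuous_def
proof (intro allI impI)
  fix h :: "nat \<Rightarrow> 'a" assume h: "h \<longlonglongrightarrow> 0"
  have iU: "integrable lborel (indicator U :: 'a \<Rightarrow> real)" using U by (auto intro: integrable_real_indicator)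
  have bU: "(indicator U :: 'a \<Rightarrow> real) \<in> borel_measurable borel" using U by simp
  have iUh: "integrable lborel (\<lambda>x. indicator U (x + a) :: real)" for a
    using lborel_integrable_plus[OF bU] iU by simp
  have ip: "integrable lborel (\<lambda>x. indicator U x * indicator U (x + a) :: real)" for a
    by (intro integrable_mult_bounded[OF iU, where B = 1] borel_measurable_integrable[OF iUh]) (auto simp: indicator_def)
  have eq: "(\<integral>x. \<bar>indicator U (x + a) - indicator U x :: real\<bar> \<partial>lborel)
      = 2 * (LBINT x. indicator U x) - 2 * (LBINT x. indicator U x * indicator U (x + a))" for a
  proof -
    have "(\<integral>x. \<bar>indicator U (x + a) - indicator U x :: real\<bar> \<partial>lborel)
       = (LBINT x. (indicator U (x + a) + indicator U x :: real) - 2 * (indicator U x * indicator U (x + a)))"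
      by (intro Bochner_Integration.integral_cong) (auto simp: indicator_def)
    also have "\<dots> = ((LBINT x. indicator U (x + a)) + (LBINT x. indicator U x)) - 2 * (LBINT x. indicator U x * indicator U (x + a))"
      using iU iUh ip by simp
    finally show ?thesis using lborel_integral_plus[OF bU, of a] by simp
  qed
  have "(\<lambda>n. \<integral>x. (indicator U x * indicator U (x + h n) :: real) \<partial>lborel) \<longlonglongrightarrow> (LBINT x. indicator U x)"
  proof (rule integral_dominated_convergence[where w = "indicator U"])
    show "AE x in lborel. (\<lambda>n. indicator U x * indicator U (x + h n) :: real) \<longlonglongrightarrow> indicator U x"
    proof (rule AE_I2)
      fix x
      show "(\<lambda>n. indicator U x * indicator U (x + h n) :: real) \<longlonglongrightarrow> indicator U x"
      proof (cases "x \<in> U")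
        case True
        have "(\<lambda>n. x + h n) \<longlonglongrightarrow> x" using tendsto_add[OF tendsto_const h, of x] by simp
        then have "eventually (\<lambda>n. x + h n \<in> U) sequentially"
          using U True by (simp add: topological_tendstoD)
        then have "eventually (\<lambda>n. indicator U x * indicator U (x + h n) = (1::real)) sequentially"
          by eventually_elim (use True in auto)
        then show ?thesis using True by (simp add: tendsto_eventually)
      qed auto
    qed
  qed (use iU ip borel_measurable_integrable in \<open>auto intro!: always_eventually simp: indicator_simps split: split_indicator\<close>)
  from tendsto_diff[OF tendsto_const tendsto_mult[OF tendsto_const this, of 2], of "2 * (LBINT x. indicator U x)"]
  show "(\<lambda>n. \<integral>x. \<bar>indicator U (x + h n) - indicator U x :: real\<bar> \<partial>lborel) \<longlonglongrightarrow> 0"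
    unfolding eq by simp
qed

lemma L1_translation_continuous_scale:
  assumes "L1_translation_continuous f"
  shows "L1_translation_continuous (\<lambda>x. f x * c)"
  unfolding L1_translation_continuous_def
proof (intro allI impI)
  fix h :: "nat \<Rightarrow> 'a" assume h: "h \<longlonglongrightarrow> 0"
  have "(LBINT x. \<bar>f (x + a) * c - f x * c\<bar>) = \<bar>c\<bar> * (LBINT x. \<bar>f (x + a) - f x\<bar>)" for a
    by (simp only: left_diff_distrib[symmetric] abs_mult mult.commute[of _ "\<bar>c\<bar>"] Bochner_Integration.integral_mult_right_zero)
  then show "(\<lambda>n. \<integral>x. \<bar>f (x + h n) * c - f x * c\<bar> \<partial>lborel) \<longlonglongrightarrow> 0"
    using assms h tendsto_mult_right_zero[of _ sequentially "\<bar>c\<bar>"]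
    by (simp add: L1_translation_continuous_def)
qed

lemma L1_translation_continuous_integrable:
  fixes f :: "'a::euclidean_space \<Rightarrow> real"
  assumes "integrable lborel f"
  shows "L1_translation_continuous f"
  using assms
proof (induction rule: integrable_induct)
  case (base A c)
  have bA: "A \<in> sets borel" using base by simp
  have "L1_translation_continuous (\<lambda>x. indicator A x :: real)"
  proof (rule L1_translation_continuous_approx)
    show "integrable lborel (\<lambda>x. indicator A x :: real)"
      using base by (auto intro: integrable_real_indicator)
    fix e :: real assume e: "e > 0"
    \<comment> \<open>Outer regularity replaces a Borel set by an open one at small cost in
      measure.\<close>
    obtain U where U: "open U" "A \<subseteq> U" "emeasure lborel (U - A) < ennreal e"
      using outer_regular_lborel[OF bA, of e] e by (metis)
    have "emeasure lborel U \<le> emeasure lborel (U - A) + emeasure lborel A"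
      using U bA by (metis Un_Diff_cancel2 emeasure_subadditive sets.Diff sets_lborel borel_open sup.absorb_iff1)
    also have "\<dots> < \<infinity>" using U(3) base by (auto simp: ennreal_add_eq_top less_top[symmetric])
    finally have fU: "emeasure lborel U < \<infinity>" .
    have fD: "emeasure lborel (U - A) < \<infinity>" using U(3) by (auto intro: order.strict_trans)
    have "(\<integral>x. \<bar>indicator A x - indicator U x :: real\<bar> \<partial>lborel) = (LBINT x. indicator (U - A) x)"
      using U by (intro Bochner_Integration.integral_cong) (auto simp: indicator_def)
    also have "\<dots> = measure lborel (U - A)" by simp
    also have "\<dots> < e"
      using U(3) e fD by (metis emeasure_eq_ennreal_measure ennreal_less_iff less_top measure_nonneg infinity_ennreal_def less_irrefl)
    finally show "\<exists>g. integrable lborel g \<and> L1_translation_continuous g \<and> (LBINT x. \<bar>indicator A x - g x\<bar>) < e"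
      using L1_translation_continuous_open[OF U(1) fU] U fU by (intro exI[of _ "indicator U"]) (auto intro: integrable_real_indicator)
  qed
  then show ?case using L1_translation_continuous_scale by simp
next
  case (add f g)
  show ?case unfolding L1_translation_continuous_def
  proof (intro allI impI)
    fix h :: "nat \<Rightarrow> 'a" assume h: "h \<longlonglongrightarrow> 0"
    note i = integrable_translation_diff[OF add(1)] integrable_translation_diff[OF add(2)]
    have fg: "integrable lborel (\<lambda>x. f x + g x)" using add by auto
    have bd: "(LBINT x. \<bar>(f (x + a) + g (x + a)) - (f x + g x)\<bar>)
      \<le> (LBINT x. \<bar>f (x + a) - f x\<bar>) + (LBINT x. \<bar>g (x + a) - g x\<bar>)" for a
    proof -
      have "(LBINT x. \<bar>(f (x + a) + g (x + a)) - (f x + g x)\<bar>)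
        \<le> (LBINT x. \<bar>f (x + a) - f x\<bar> + \<bar>g (x + a) - g x\<bar>)"
        using i[of a] integrable_translation_diff[OF fg, of a] by (intro integral_mono) auto
      then show ?thesis using i[of a] by simp
    qed
    have lm: "(\<lambda>n. (LBINT x. \<bar>f (x + h n) - f x\<bar>) + (LBINT x. \<bar>g (x + h n) - g x\<bar>)) \<longlonglongrightarrow> 0"
      using add h by (intro tendsto_add_zero) (auto simp: L1_translation_continuous_def)
    show "(\<lambda>n. \<integral>x. \<bar>(f (x + h n) + g (x + h n)) - (f x + g x)\<bar> \<partial>lborel) \<longlonglongrightarrow> 0"
    proof (rule tendsto_sandwich[OF _ _ tendsto_const lm])
      show "\<forall>\<^sub>F n in sequentially. 0 \<le> (LBINT x. \<bar>(f (x + h n) + g (x + h n)) - (f x + g x)\<bar>)" by simp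
      show "\<forall>\<^sub>F n in sequentially. (LBINT x. \<bar>(f (x + h n) + g (x + h n)) - (f x + g x)\<bar>)
        \<le> (LBINT x. \<bar>f (x + h n) - f x\<bar>) + (LBINT x. \<bar>g (x + h n) - g x\<bar>)"
        by (rule always_eventually, rule allI, rule bd)
    qed
  qed
next
  case (lim f s)
  show ?case
  proof (rule L1_translation_continuous_approx[OF lim.hyps(4)])
    fix e :: real assume e: "e > 0"
    have "(\<lambda>n. \<integral>x. \<bar>f x - s n x\<bar> \<partial>lborel) \<longlonglongrightarrow> integral\<^sup>L (lborel :: 'a measure) (\<lambda>x. 0)"
    \<comment> \<open>The induction principle supplies \<open>|s n x| \<le> 2 |f x|\<close>, whence
      the dominating function \<open>3 |f|\<close>.\<close>
    proof (rule integral_dominated_convergence[where w = "\<lambda>x. 3 * \<bar>f x\<bar>"])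
      show "AE x in lborel. (\<lambda>n. \<bar>f x - s n x\<bar>) \<longlonglongrightarrow> 0"
      proof (rule AE_I2)
        fix x
        have "(\<lambda>n. f x - s n x) \<longlonglongrightarrow> f x - f x" using lim.hyps(2)[of x] by (intro tendsto_intros) auto
        then show "(\<lambda>n. \<bar>f x - s n x\<bar>) \<longlonglongrightarrow> 0" using tendsto_rabs_zero by force
      qed
      show "AE x in lborel. norm \<bar>f x - s n x\<bar> \<le> 3 * \<bar>f x\<bar>" for n
      proof (rule AE_I2)
        fix x show "norm \<bar>f x - s n x\<bar> \<le> 3 * \<bar>f x\<bar>" using lim.hyps(3)[of x n] by auto
      qed
    qed (use lim.hyps(1,4) in auto)
    then have "eventually (\<lambda>n. (LBINT x. \<bar>f x - s n x\<bar>) < e) sequentially"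
      using e by (simp add: order_tendstoD)
    then obtain n where "(LBINT x. \<bar>f x - s n x\<bar>) < e"
      by (auto simp: eventually_sequentially)
    then show "\<exists>g. integrable lborel g \<and> L1_translation_continuous g \<and> (LBINT x. \<bar>f x - g x\<bar>) < e"
      using lim.hyps(1) lim.IH by blast
  qed
qed

lemma L1_translation_small:
  fixes f :: "'a::euclidean_space \<Rightarrow> real"
  assumes f: "integrable lborel f" and e: "e > 0"
  obtains d where "d > 0" "\<And>h. norm h < d \<Longrightarrow> (LBINT x. \<bar>f (x + h) - f x\<bar>) < e"
proof (rule ccontr)
  assume "\<not> thesis"
  then have "\<forall>d>0. \<exists>h. norm h < d \<and> \<not> (LBINT x. \<bar>f (x + h) - f x\<bar>) < e"
    using that by blast
  then have "\<forall>n. \<exists>h. norm h < inverse (real (Suc n)) \<and> \<not> (LBINT x. \<bar>f (x + h) - f x\<bar>) < e"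
    by simp
  then obtain h where h: "\<And>n. norm (h n) < inverse (real (Suc n))" "\<And>n. \<not> (LBINT x. \<bar>f (x + h n) - f x\<bar>) < e"
    by metis
  have "h \<longlonglongrightarrow> 0"
    by (rule Lim_null_comparison[OF _ LIMSEQ_inverse_real_of_nat]) (use h(1) in \<open>simp add: less_imp_le always_eventually\<close>)
  then have "(\<lambda>n. \<integral>x. \<bar>f (x + h n) - f x\<bar> \<partial>lborel) \<longlonglongrightarrow> 0"
    using L1_translation_continuous_integrable[OF f] by (simp add: L1_translation_continuous_def)
  then have "eventually (\<lambda>n. (LBINT x. \<bar>f (x + h n) - f x\<bar>) < e) sequentially"
    using e by (simp add: order_tendstoD)
  then show False using h(2) by (auto simp: eventually_sequentially)
qed

section \<open>Smooth functions and vector fields\<close>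

lemma compact_support_uniformly_continuous:
  fixes g :: "'a::euclidean_space \<Rightarrow> 'b::real_normed_vector"
  assumes g: "continuous_on UNIV g" and R: "\<And>x. R < norm x \<Longrightarrow> g x = 0"
  shows "uniformly_continuous_on UNIV g"
  unfolding uniformly_continuous_on_def
proof (intro allI impI)
  fix e :: real assume e: "e > 0"
  \<comment> \<open>With a margin of 1, two points at distance below 1 either both lie in this ball
    or both lie where \<open>g\<close> vanishes.\<close>
  have "uniformly_continuous_on (cball 0 (R + 1)) g"
    by (rule compact_uniformly_continuous) (use g in \<open>auto intro: continuous_on_subset\<close>)
  then obtain d where d: "d > 0" "\<And>x x'. x \<in> cball 0 (R+1) \<Longrightarrow> x' \<in> cball 0 (R+1) \<Longrightarrow> dist x' x < d \<Longrightarrow> dist (g x') (g x) < e"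
    using e unfolding uniformly_continuous_on_def by metis
  have "dist (g x') (g x) < e" if "dist x' x < min d 1" for x x'
  proof -
    have t: "norm x' \<le> norm x + dist x' x" "norm x \<le> norm x' + dist x' x"
      by (simp_all add: dist_norm) norm+
    show ?thesis
    proof (cases "norm x \<le> R \<or> norm x' \<le> R")
      case True
      then show ?thesis using t that d(2)[of x x'] by (auto simp: dist_norm)
    next
      case False
      then show ?thesis using R[of x] R[of x'] e by simp
    qed
  qed
  then show "\<exists>d>0. \<forall>x\<in>UNIV. \<forall>x'\<in>UNIV. dist x' x < d \<longrightarrow> dist (g x') (g x) < e"
    using d(1) by (intro exI[of _ "min d 1"]) auto
qed

lemma compact_support_bounded:
  fixes g :: "'a::euclidean_space \<Rightarrow> 'b::real_normed_vector"
  assumes g: "continuous_on UNIV g" and K: "compact K" "\<And>x. x \<notin> K \<Longrightarrow> g x = 0"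
  obtains B where "B > 0" "\<And>x. norm (g x) \<le> B"
proof -
  have "compact (g ` K)"
    by (rule compact_continuous_image) (use g K in \<open>auto intro: continuous_on_subset\<close>)
  then obtain B where B: "B > 0" "\<And>x. x \<in> K \<Longrightarrow> norm (g x) \<le> B"
    using compact_imp_bounded bounded_pos by (metis imageI)
  have "norm (g x) \<le> B" for x using B K by (cases "x \<in> K") (auto intro: less_imp_le)
  then show ?thesis using that B by blast
qed

lemma compact_support_integrable:
  fixes g :: "'a::euclidean_space \<Rightarrow> 'b::{banach, second_countable_topology}"
  assumes g: "continuous_on UNIV g" and K: "compact K" "\<And>x. x \<notin> K \<Longrightarrow> g x = 0"
  shows "integrable lborel g"
proof -
  have "integrable lborel (\<lambda>x. indicator K x *\<^sub>R g x)"
    by (rule borel_integrable_compact) (use g K in \<open>auto intro: continuous_on_subset\<close>)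
  moreover have "(\<lambda>x. indicator K x *\<^sub>R g x) = g"
    using K by (auto simp: indicator_def)
  ultimately show ?thesis by simp
qed

lemma borel_measurable_continuous_UNIV:
  "continuous_on UNIV g \<Longrightarrow> g \<in> borel_measurable borel"
  by (rule borel_measurable_continuous_onI)

text \<open>Carrying the gradient as a function gives products, compositions and convolutions
  explicit formulas; vector fields are then treated one component at a time.\<close>

definition has_C1_gradient :: "('a::euclidean_space \<Rightarrow> real) \<Rightarrow> ('a \<Rightarrow> 'a) \<Rightarrow> bool" where
  "has_C1_gradient f g \<longleftrightarrow>
     (\<forall>x. (f has_derivative (\<lambda>h. g x \<bullet> h)) (at x)) \<and> continuous_on UNIV g"

lemma has_C1_gradientI:
  "(\<And>x. (f has_derivative (\<lambda>h. g x \<bullet> h)) (at x)) \<Longrightarrow> continuous_on UNIV g \<Longrightarrow> has_C1_gradient f g"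
  by (simp add: has_C1_gradient_def)

lemma has_C1_gradientD:
  assumes "has_C1_gradient f g"
  shows "(f has_derivative (\<lambda>h. g x \<bullet> h)) (at x)" "continuous_on UNIV g" "continuous_on UNIV f"
    "f \<in> borel_measurable borel" "g \<in> borel_measurable borel"
proof -
  show d: "(f has_derivative (\<lambda>h. g x \<bullet> h)) (at x)" "continuous_on UNIV g" for x
    using assms by (auto simp: has_C1_gradient_def)
  show c: "continuous_on UNIV f"
    using d(1) has_derivative_continuous by (metis continuous_at_imp_continuous_on)
  show "f \<in> borel_measurable borel" "g \<in> borel_measurable borel"
    using c d(2) borel_measurable_continuous_UNIV by auto
qed

lemma has_C1_gradient_mult:
  assumes "has_C1_gradient f f'" "has_C1_gradient g g'"
  shows "has_C1_gradient (\<lambda>x. f x * g x) (\<lambda>x. f x *\<^sub>R g' x + g x *\<^sub>R f' x)"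
proof (rule has_C1_gradientI)
  fix x
  show "((\<lambda>x. f x * g x) has_derivative (\<lambda>h. (f x *\<^sub>R g' x + g x *\<^sub>R f' x) \<bullet> h)) (at x)"
    by (rule derivative_eq_intros has_C1_gradientD assms | simp add: algebra_simps inner_simps)+
  show "continuous_on UNIV (\<lambda>x. f x *\<^sub>R g' x + g x *\<^sub>R f' x)"
    using has_C1_gradientD[OF assms(1)] has_C1_gradientD[OF assms(2)] by (intro continuous_intros) auto
qed

lemma has_C1_gradient_diff:
  assumes "has_C1_gradient f f'" "has_C1_gradient g g'"
  shows "has_C1_gradient (\<lambda>x. f x - g x) (\<lambda>x. f' x - g' x)"
proof (rule has_C1_gradientI)
  fix x
  show "((\<lambda>x. f x - g x) has_derivative (\<lambda>h. (f' x - g' x) \<bullet> h)) (at x)"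
    by (rule derivative_eq_intros has_C1_gradientD assms | simp add: algebra_simps inner_simps)+
  show "continuous_on UNIV (\<lambda>x. f' x - g' x)"
    using has_C1_gradientD[OF assms(1)] has_C1_gradientD[OF assms(2)] by (intro continuous_intros) auto
qed

lemma has_C1_gradient_sum:
  assumes "\<And>i. i \<in> I \<Longrightarrow> has_C1_gradient (f i) (f' i)"
  shows "has_C1_gradient (\<lambda>x. \<Sum>i\<in>I. f i x) (\<lambda>x. \<Sum>i\<in>I. f' i x)"
proof (rule has_C1_gradientI)
  fix x
  show "((\<lambda>x. \<Sum>i\<in>I. f i x) has_derivative (\<lambda>h. (\<Sum>i\<in>I. f' i x) \<bullet> h)) (at x)"
    unfolding inner_sum_left
    by (rule has_derivative_sum) (use has_C1_gradientD(1)[OF assms] in auto)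
  show "continuous_on UNIV (\<lambda>x. \<Sum>i\<in>I. f' i x)"
    using has_C1_gradientD[OF assms] by (intro continuous_intros) auto
qed

lemma has_C1_gradient_compose:
  assumes f: "has_C1_gradient f f'" and G: "\<And>t. (G has_real_derivative G' t) (at t)" "continuous_on UNIV G'"
  shows "has_C1_gradient (\<lambda>x. G (f x)) (\<lambda>x. G' (f x) *\<^sub>R f' x)"
proof (rule has_C1_gradientI)
  fix x
  show "((\<lambda>x. G (f x)) has_derivative (\<lambda>h. (G' (f x) *\<^sub>R f' x) \<bullet> h)) (at x)"
    using has_derivative_compose[OF has_C1_gradientD(1)[OF f] G(1)[unfolded has_field_derivative_def]]
    by (simp add: mult.commute)
  show "continuous_on UNIV (\<lambda>x. G' (f x) *\<^sub>R f' x)"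
    using has_C1_gradientD[OF f] G(2)
    by (intro continuous_intros continuous_on_compose2[OF G(2)]) auto
qed

text \<open>The mean value inequality on \<open>ball x d\<close>, with the derivative at
  \<open>x\<close> subtracted. The radius \<open>d\<close> does not depend on \<open>x\<close>, as
  needed to differentiate under an integral over all translates of \<open>k\<close>.\<close>

lemma uniform_gradient_remainder:
  fixes k :: "'a::euclidean_space \<Rightarrow> real"
  assumes k: "has_C1_gradient k k'" and uc: "uniformly_continuous_on UNIV k'" and e: "e > 0"
  obtains d where "d > 0" "\<And>x h. norm h < d \<Longrightarrow> \<bar>k (x + h) - k x - k' x \<bullet> h\<bar> \<le> e * norm h"
    "\<And>x h. norm h < d \<Longrightarrow> norm (k' (x + h) - k' x) \<le> e"
proof -
  obtain d where d: "d > 0" "\<And>x x'. dist x' x < d \<Longrightarrow> dist (k' x') (k' x) < e"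
    using uc e unfolding uniformly_continuous_on_def by (metis UNIV_I)
  have "\<bar>k (x + h) - k x - k' x \<bullet> h\<bar> \<le> e * norm h" if h: "norm h < d" for x h
  proof -
    have "norm (k (x + h) - k x - k' x \<bullet> ((x + h) - x)) \<le> norm ((x + h) - x) * e"
    proof (rule differentiable_bound_linearization[where S = "ball x d" and f = k and f' = "\<lambda>x h. k' x \<bullet> h"])
      fix t :: real assume t: "t \<in> {0..1}"
      have "norm (t *\<^sub>R h) \<le> norm h" using t mult_right_mono[of t 1 "norm h"] by auto
      then show "x + t *\<^sub>R (x + h - x) \<in> ball x d" using h by (simp add: dist_norm)
    next
      fix y assume "y \<in> ball x d"
      then have *: "dist (k' y) (k' x) < e" using d by (simp add: dist_commute)
      show "(k has_derivative (\<lambda>h. k' y \<bullet> h)) (at y within ball x d)"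
        using has_C1_gradientD(1)[OF k] has_derivative_at_withinI by blast
      show "onorm ((\<lambda>h. k' y \<bullet> h) - (\<lambda>h. k' x \<bullet> h)) \<le> e"
      proof (rule onorm_le)
        fix h
        have "norm ((k' y - k' x) \<bullet> h) \<le> norm (k' y - k' x) * norm h"
          using Cauchy_Schwarz_ineq2 by simp
        also have "\<dots> \<le> e * norm h" using * by (intro mult_right_mono) (auto simp: dist_norm)
        finally show "norm (((\<lambda>h. k' y \<bullet> h) - (\<lambda>h. k' x \<bullet> h)) h) \<le> e * norm h"
          by (simp add: inner_diff_left)
      qed
    next
      show "x \<in> ball x d" using d by simp
    qed
    then show ?thesis by (simp add: mult.commute)
  qed
  moreover have "norm (k' (x + h) - k' x) \<le> e" if "norm h < d" for x h
    using d(2)[of "x + h" x] that by (simp add: dist_norm)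
  ultimately show ?thesis using that d(1) by blast
qed

text \<open>As \<open>f\<close> is merely integrable, the derivative falls on \<open>k\<close>,
  whose first-order remainder is uniformly small; integrating it against \<open>f\<close> costs only
  the L1 norm of \<open>f\<close>.\<close>

lemma convolution_has_C1_gradient:
  fixes f :: "'a::euclidean_space \<Rightarrow> real"
  assumes f: "integrable lborel f" and k: "has_C1_gradient k k'"
    and uc: "uniformly_continuous_on UNIV k'"
    and B: "\<And>x. \<bar>k x\<bar> \<le> B" "\<And>x. norm (k' x) \<le> B"
  shows "has_C1_gradient (\<lambda>x. \<integral>y. f y * k (x - y) \<partial>lborel) (\<lambda>x. \<integral>y. f y *\<^sub>R k' (x - y) \<partial>lborel)"
    (is "has_C1_gradient ?F ?F'")
proof (rule has_C1_gradientI)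
  note kD = has_C1_gradientD[OF k]
  have ik: "integrable lborel (\<lambda>y. f y * k (x - y))" for x
    by (rule integrable_mult_bounded[OF f _ B(1)])
       (use kD in \<open>auto intro!: borel_measurable_continuous_UNIV continuous_intros continuous_on_compose2[OF kD(3)]\<close>)
  have ik': "integrable lborel (\<lambda>y. f y *\<^sub>R k' (x - y))" for x
    by (rule integrable_scaleR_bounded[OF f _ B(2)])
       (use kD in \<open>auto intro!: borel_measurable_continuous_UNIV continuous_intros continuous_on_compose2[OF kD(2)]\<close>)
  \<comment> \<open>The added 1 keeps the divisor positive when \<open>f\<close> is 0 almost
    everywhere.\<close>
  define A where "A = (LBINT y. \<bar>f y\<bar>) + 1"
  have A: "A > 0" unfolding A_def by (smt (verit) integral_nonneg_AE AE_I2 abs_ge_zero)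
  have small: "\<exists>d>0. \<forall>h. norm h < d \<longrightarrow> \<bar>?F (x + h) - ?F x - ?F' x \<bullet> h\<bar> \<le> e * norm h \<and> norm (?F' (x + h) - ?F' x) \<le> e"
    if e: "e > 0" for e x
  proof -
    obtain d where d: "d > 0" "\<And>x h. norm h < d \<Longrightarrow> \<bar>k (x + h) - k x - k' x \<bullet> h\<bar> \<le> e / A * norm h"
      "\<And>x h. norm h < d \<Longrightarrow> norm (k' (x + h) - k' x) \<le> e / A"
      using uniform_gradient_remainder[OF k uc, of "e / A"] e A by (metis divide_pos_pos)
    have "\<bar>?F (x + h) - ?F x - ?F' x \<bullet> h\<bar> \<le> e * norm h \<and> norm (?F' (x + h) - ?F' x) \<le> e" if h: "norm h < d" for h
    proof
      have "?F' x \<bullet> h = (LBINT y. (f y *\<^sub>R k' (x - y)) \<bullet> h)"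
        using ik'[of x] by (rule integral_inner_left[symmetric])
      then have "?F (x + h) - ?F x - ?F' x \<bullet> h = (LBINT y. f y * k (x + h - y) - f y * k (x - y) - (f y *\<^sub>R k' (x - y)) \<bullet> h)"
        using ik ik' by (simp del: inner_scaleR_left)
      also have "\<bar>\<dots>\<bar> \<le> (LBINT y. \<bar>f y\<bar> * (e / A * norm h))"
      proof (rule order_trans[OF integral_abs_bound], rule integral_mono)
        show "integrable lborel (\<lambda>y. \<bar>f y * k (x + h - y) - f y * k (x - y) - (f y *\<^sub>R k' (x - y)) \<bullet> h\<bar>)"
          using ik ik' by (simp del: inner_scaleR_left)
        show "integrable lborel (\<lambda>y. \<bar>f y\<bar> * (e / A * norm h))" using f by simp
        fix y
        have "\<bar>f y * k (x + h - y) - f y * k (x - y) - (f y *\<^sub>R k' (x - y)) \<bullet> h\<bar>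
          = \<bar>f y\<bar> * \<bar>k ((x - y) + h) - k (x - y) - k' (x - y) \<bullet> h\<bar>"
          unfolding abs_mult[symmetric] by (simp add: algebra_simps)
        also have "\<dots> \<le> \<bar>f y\<bar> * (e / A * norm h)" using d(2)[OF h] by (intro mult_left_mono) auto
        finally show "\<bar>f y * k (x + h - y) - f y * k (x - y) - (f y *\<^sub>R k' (x - y)) \<bullet> h\<bar> \<le> \<bar>f y\<bar> * (e / A * norm h)" .
      qed
      also have "\<dots> = (A - 1) * (e / A * norm h)" by (simp add: A_def)
      also have "\<dots> \<le> A * (e / A * norm h)" using e A by (intro mult_right_mono) auto
      also have "\<dots> = e * norm h" using A by simp
      finally show "\<bar>?F (x + h) - ?F x - ?F' x \<bullet> h\<bar> \<le> e * norm h" .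
    next
      have "?F' (x + h) - ?F' x = (LBINT y. f y *\<^sub>R k' (x + h - y) - f y *\<^sub>R k' (x - y))"
        using ik' by simp
      also have "norm \<dots> \<le> (LBINT y. \<bar>f y\<bar> * (e / A))"
      proof (rule order_trans[OF integral_norm_bound], rule integral_mono)
        show "integrable lborel (\<lambda>y. norm (f y *\<^sub>R k' (x + h - y) - f y *\<^sub>R k' (x - y)))"
          using ik' by simp
        show "integrable lborel (\<lambda>y. \<bar>f y\<bar> * (e / A))" using f by simp
        fix y
        have "norm (f y *\<^sub>R k' (x + h - y) - f y *\<^sub>R k' (x - y))
          = \<bar>f y\<bar> * norm (k' ((x - y) + h) - k' (x - y))"
          unfolding norm_scaleR[symmetric] by (simp add: algebra_simps)
        also have "\<dots> \<le> \<bar>f y\<bar> * (e / A)" using d(3)[OF h] by (intro mult_left_mono) auto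
        finally show "norm (f y *\<^sub>R k' (x + h - y) - f y *\<^sub>R k' (x - y)) \<le> \<bar>f y\<bar> * (e / A)" .
      qed
      also have "\<dots> = (A - 1) * (e / A)" by (simp add: A_def)
      also have "\<dots> \<le> A * (e / A)" using e A by (intro mult_right_mono) auto
      also have "\<dots> = e" using A by simp
      finally show "norm (?F' (x + h) - ?F' x) \<le> e" .
    qed
    then show ?thesis using d(1) by blast
  qed
  show "(?F has_derivative (\<lambda>h. ?F' x \<bullet> h)) (at x)" for x
    unfolding has_derivative_within_alt
  proof (intro conjI allI impI)
    show "bounded_linear (\<lambda>h. ?F' x \<bullet> h)" by (rule bounded_linear_inner_right)
    fix e :: real assume "e > 0"
    from small[OF this, of x] obtain d where d: "d > 0"
      "\<And>h. norm h < d \<Longrightarrow> \<bar>?F (x + h) - ?F x - ?F' x \<bullet> h\<bar> \<le> e * norm h" by blast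
    show "\<exists>d>0. \<forall>y\<in>UNIV. norm (y - x) < d \<longrightarrow> norm (?F y - ?F x - ?F' x \<bullet> (y - x)) \<le> e * norm (y - x)"
    proof (intro exI[of _ d] conjI ballI impI d(1))
      fix y assume "norm (y - x) < d"
      from d(2)[OF this] show "norm (?F y - ?F x - ?F' x \<bullet> (y - x)) \<le> e * norm (y - x)" by simp
    qed
  qed
  show "continuous_on UNIV ?F'"
    unfolding continuous_on_iff
  proof (intro ballI allI impI)
    fix x :: 'a and e :: real assume "e > 0"
    then obtain d where d: "d > 0" "\<And>h. norm h < d \<Longrightarrow> norm (?F' (x + h) - ?F' x) \<le> e / 2"
      using small[of "e/2" x] by auto
    show "\<exists>d>0. \<forall>x'\<in>UNIV. dist x' x < d \<longrightarrow> dist (?F' x') (?F' x) < e"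
    proof (intro exI[of _ d] conjI ballI impI d(1))
      fix x' assume "dist x' x < d"
      then have "norm (?F' (x + (x' - x)) - ?F' x) \<le> e / 2" using d(2)[of "x' - x"] by (simp add: dist_norm)
      then show "dist (?F' x') (?F' x) < e" using \<open>e > 0\<close> by (simp add: dist_norm)
    qed
  qed
qed

lemma gradient_eq_0_outside:
  assumes k: "has_C1_gradient k k'" and K: "closed K" "\<And>x. x \<notin> K \<Longrightarrow> k x = 0" and x: "x \<notin> K"
  shows "k' x = 0"
proof -
  have "(k has_derivative (\<lambda>h. 0)) (at x)"
  proof (rule has_derivative_transform_within_open[where f = "\<lambda>x. 0" and s = "- K"])
    show "open (- K)" using K by auto
  qed (use K x in auto)
  then have "(\<lambda>h. k' x \<bullet> h) = (\<lambda>h. 0)"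
    using has_derivative_unique has_C1_gradientD(1)[OF k] by blast
  then show ?thesis by (metis inner_eq_zero_iff)
qed

text \<open>Convolve \<open>k\<close> with the indicator of a ball so large that, for
  \<open>|x| < 1\<close>, it contains the whole support of \<open>k (x - y)\<close> as a function of
  \<open>y\<close>. The result is constant near 0, so its gradient there vanishes; differentiating
  the kernel instead gives the integral of \<open>k'\<close>.\<close>

lemma integral_gradient_eq_0:
  fixes k :: "'a::euclidean_space \<Rightarrow> real"
  assumes k: "has_C1_gradient k k'" and K: "compact K" "\<And>x. x \<notin> K \<Longrightarrow> k x = 0"
  shows "(LBINT x. k' x \<bullet> h) = 0"
proof -
  note kD = has_C1_gradientD[OF k]
  have k'0: "\<And>x. x \<notin> K \<Longrightarrow> k' x = 0"
    using gradient_eq_0_outside[OF k compact_imp_closed[OF K(1)] K(2)] by blast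
  obtain R where R: "\<And>x. x \<in> K \<Longrightarrow> norm x \<le> R" "R > 0"
    using compact_imp_bounded[OF K(1)] bounded_pos by metis
  have uc: "uniformly_continuous_on UNIV k'"
    by (rule compact_support_uniformly_continuous[where R = R]) (use kD k'0 R in \<open>auto simp: not_le[symmetric]\<close>)
  obtain B1 where B1: "\<And>x. norm (k x) \<le> B1" using compact_support_bounded[OF kD(3) K] by metis
  obtain B2 where B2: "\<And>x. norm (k' x) \<le> B2" using compact_support_bounded[OF kD(2) K(1) k'0] by metis
  define b where "b = (indicator (cball 0 (R + 1)) :: 'a \<Rightarrow> real)"
  have ib: "integrable lborel b"
    unfolding b_def by (rule integrable_real_indicator) (simp_all only: sets_lborel borel_closed closed_cball emeasure_lborel_cball_finite)
  let ?F = "\<lambda>x. \<integral>y. b y * k (x - y) \<partial>lborel"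
  have F: "has_C1_gradient ?F (\<lambda>x. \<integral>y. b y *\<^sub>R k' (x - y) \<partial>lborel)"
  proof (rule convolution_has_C1_gradient[OF ib k uc, where B = "max B1 B2"])
    fix x show "\<bar>k x\<bar> \<le> max B1 B2" using B1[of x] by simp
    show "norm (k' x) \<le> max B1 B2" using B2[of x] by simp
  qed
  have cut: "x - y \<notin> K \<or> b y = 1" if "norm x < 1" for x y
  proof (cases "x - y \<in> K")
    case True
    then have "norm (x - y) \<le> R" using R by auto
    moreover have "norm y \<le> norm (x - y) + norm x" by norm
    ultimately have "norm y \<le> R + 1" using that by linarith
    then show ?thesis by (simp add: b_def)
  next
    case False then show ?thesis by simp
  qed
  have Fc: "?F x = (LBINT y. k y)" if "x \<in> ball 0 1" for x
  proof -
    have "?F x = (LBINT y. k (x - y))"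
      using cut[of x] that K by (intro Bochner_Integration.integral_cong) auto
    also have "\<dots> = (LBINT y. k y)" using lborel_integral_minus[OF kD(4)] .
    finally show ?thesis .
  qed
  have "(?F has_derivative (\<lambda>h. 0)) (at 0)"
    by (rule has_derivative_transform_within_open[where f = "\<lambda>x. \<integral>y. k y \<partial>lborel" and s = "ball 0 1"])
       (use Fc in auto)
  then have "(\<lambda>h. (LBINT y. b y *\<^sub>R k' (0 - y)) \<bullet> h) = (\<lambda>h. 0)"
    using has_derivative_unique has_C1_gradientD(1)[OF F] by blast
  then have "0 = (LBINT y. b y *\<^sub>R k' (0 - y)) \<bullet> h" by metis
  also have "(LBINT y. b y *\<^sub>R k' (0 - y)) = (LBINT y. k' (0 - y))"
  proof (rule Bochner_Integration.integral_cong[OF refl])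
    fix y show "b y *\<^sub>R k' (0 - y) = k' (0 - y)"
      using cut[of 0 y] k'0[of "0 - y"] by auto
  qed
  also have "\<dots> = (LBINT y. k' y)" using lborel_integral_minus[OF kD(5)] .
  also have "\<dots> \<bullet> h = (LBINT x. k' x \<bullet> h)"
    using compact_support_integrable[OF kD(2) K(1) k'0] by simp
  finally show ?thesis by simp
qed

section \<open>Compactly supported vector fields and their divergence, by components\<close>

lemma C1c_I:
  fixes F :: "'a::euclidean_space \<Rightarrow> 'a \<Rightarrow> real"
  assumes F: "\<And>b. b \<in> Basis \<Longrightarrow> has_C1_gradient (F b) (g b)"
    and K: "compact K" "K \<subseteq> \<Omega>" "\<And>x b. b \<in> Basis \<Longrightarrow> x \<notin> K \<Longrightarrow> F b x = 0"
  shows "(\<lambda>x. \<Sum>b\<in>Basis. F b x *\<^sub>R b) \<in> C1c \<Omega>"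
    and "divergence (\<lambda>x. \<Sum>b\<in>Basis. F b x *\<^sub>R b) x = (\<Sum>b\<in>Basis. g b x \<bullet> b)"
proof -
  let ?z = "\<lambda>x. \<Sum>b\<in>Basis. F b x *\<^sub>R b"
  let ?z' = "\<lambda>x. \<Sum>b\<in>Basis. blinfun_scaleR_left b o\<^sub>L blinfun_inner_right (g b x) :: 'a \<Rightarrow>\<^sub>L 'a"
  have ap: "blinfun_apply (?z' x) = (\<lambda>h. \<Sum>b\<in>Basis. (g b x \<bullet> h) *\<^sub>R b)" for x
    by (auto simp: blinfun.sum_left)
  have d: "(?z has_derivative (\<lambda>h. \<Sum>b\<in>Basis. (g b x \<bullet> h) *\<^sub>R b)) (at x)" for x
    by (rule has_derivative_sum) (auto intro!: derivative_eq_intros has_C1_gradientD(1)[OF F])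
  have c: "continuous_on UNIV ?z'"
    using has_C1_gradientD(2)[OF F]
    by (intro continuous_intros bounded_linear.continuous_on[OF bounded_linear_blinfun_inner_right]) auto
  have "{x. ?z x \<noteq> 0} \<subseteq> K" using K(3) by (auto intro: sum.neutral)
  then have "closure {x. ?z x \<noteq> 0} \<subseteq> K" using K(1) by (simp add: closure_minimal compact_imp_closed)
  moreover from this have "compact (closure {x. ?z x \<noteq> 0})"
    using K(1) by (meson bounded_subset closure_subset compact_closure compact_imp_bounded order_trans)
  ultimately show "?z \<in> C1c \<Omega>"
    unfolding C1c_def using d c K(2) ap by (auto intro!: exI[of _ ?z'])
  show "divergence ?z x = (\<Sum>b\<in>Basis. g b x \<bullet> b)"
    unfolding divergence_def frechet_derivative_at[OF d, symmetric]
    by (intro sum.cong) auto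
qed

lemma C1c_D:
  fixes z :: "'a::euclidean_space \<Rightarrow> 'a"
  assumes z: "z \<in> C1c \<Omega>"
  obtains K g where "compact K" "K \<subseteq> \<Omega>" "\<And>x. x \<notin> K \<Longrightarrow> z x = 0"
    "\<And>b. b \<in> Basis \<Longrightarrow> has_C1_gradient (\<lambda>x. z x \<bullet> b) (g b)"
    "\<And>x. divergence z x = (\<Sum>b\<in>Basis. g b x \<bullet> b)"
    "\<And>b x. b \<in> Basis \<Longrightarrow> x \<notin> K \<Longrightarrow> g b x = 0"
proof -
  obtain z' where z': "\<And>x. (z has_derivative blinfun_apply (z' x)) (at x)" "continuous_on UNIV z'"
    using z unfolding C1c_def by blast
  define K where "K = closure {x. z x \<noteq> 0}"
  \<comment> \<open>Row \<open>b\<close> of the Jacobian, that is, the gradient of the component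
    \<open>z x \<bullet> b\<close>.\<close>
  define g where "g = (\<lambda>b x. \<Sum>c\<in>Basis. (blinfun_apply (z' x) c \<bullet> b) *\<^sub>R c)"
  have K: "compact K" "K \<subseteq> \<Omega>" using z by (auto simp: C1c_def K_def)
  have z0: "z x = 0" if "x \<notin> K" for x using that closure_subset[of "{x. z x \<noteq> 0}"] by (auto simp: K_def)
  have gr: "has_C1_gradient (\<lambda>x. z x \<bullet> b) (g b)" for b
  proof (rule has_C1_gradientI)
    fix x
    have "blinfun_apply (z' x) h \<bullet> b = g b x \<bullet> h" for h
    proof -
      have "blinfun_apply (z' x) h = blinfun_apply (z' x) (\<Sum>c\<in>Basis. (h \<bullet> c) *\<^sub>R c)"
        by (simp add: euclidean_representation)
      also have "\<dots> = (\<Sum>c\<in>Basis. (h \<bullet> c) *\<^sub>R blinfun_apply (z' x) c)"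
        by (simp add: blinfun.sum_right blinfun.scaleR_right)
      finally show ?thesis
        by (simp add: g_def inner_sum_left inner_sum_right mult.commute inner_commute)
    qed
    then show "((\<lambda>x. z x \<bullet> b) has_derivative (\<lambda>h. g b x \<bullet> h)) (at x)"
      using has_derivative_inner_left[OF z'(1)[of x], of b] by simp
    show "continuous_on UNIV (g b)"
      unfolding g_def using z'(2) by (intro continuous_intros) auto
  qed
  have dv: "divergence z x = (\<Sum>b\<in>Basis. g b x \<bullet> b)" for x
    unfolding divergence_def frechet_derivative_at[OF z'(1), symmetric]
  proof (intro sum.cong refl)
    fix b :: 'a assume "b \<in> Basis"
    then show "blinfun_apply (z' x) b \<bullet> b = g b x \<bullet> b"
      by (simp add: g_def inner_sum_left inner_Basis if_distrib cong: if_cong)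
  qed
  have "g b x = 0" if "x \<notin> K" for b x
    by (rule gradient_eq_0_outside[OF gr compact_imp_closed[OF K(1)]]) (use z0 that in auto)
  then show ?thesis using that[OF K z0 gr dv] by blast
qed

lemma C1c_bounded_support:
  assumes z: "z \<in> C1c \<Omega>"
  shows "continuous_on UNIV z" "continuous_on UNIV (divergence z)"
    "\<exists>K. compact K \<and> K \<subseteq> \<Omega> \<and> (\<forall>x. x \<notin> K \<longrightarrow> z x = 0 \<and> divergence z x = 0)"
    "\<exists>B>0. \<forall>x. norm (z x) \<le> B \<and> \<bar>divergence z x\<bar> \<le> B"
proof -
  obtain K g where *: "compact K" "K \<subseteq> \<Omega>" "\<And>x. x \<notin> K \<Longrightarrow> z x = 0"
    "\<And>b. b \<in> Basis \<Longrightarrow> has_C1_gradient (\<lambda>x. z x \<bullet> b) (g b)"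
    "\<And>x. divergence z x = (\<Sum>b\<in>Basis. g b x \<bullet> b)"
    "\<And>b x. b \<in> Basis \<Longrightarrow> x \<notin> K \<Longrightarrow> g b x = 0"
    by (rule C1c_D[OF z]) blast
  have "continuous_on UNIV (\<lambda>x. \<Sum>b\<in>Basis. (z x \<bullet> b) *\<^sub>R b)"
    using has_C1_gradientD(3)[OF *(4)]
    by (intro continuous_on_sum continuous_on_scaleR continuous_on_const) auto
  then show c1: "continuous_on UNIV z" by (simp add: euclidean_representation)
  show c2: "continuous_on UNIV (divergence z)"
    unfolding *(5)[abs_def] using has_C1_gradientD(2)[OF *(4)] by (intro continuous_intros) auto
  have d0: "\<And>x. x \<notin> K \<Longrightarrow> divergence z x = 0" using * by simp
  then show "\<exists>K. compact K \<and> K \<subseteq> \<Omega> \<and> (\<forall>x. x \<notin> K \<longrightarrow> z x = 0 \<and> divergence z x = 0)"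
    using * by blast
  obtain B1 where "\<And>x. norm (z x) \<le> B1" "B1 > 0" using compact_support_bounded[OF c1 *(1,3)] by metis
  moreover obtain B2 where "\<And>x. norm (divergence z x) \<le> B2" "B2 > 0" using compact_support_bounded[OF c2 *(1) d0] by metis
  ultimately show "\<exists>B>0. \<forall>x. norm (z x) \<le> B \<and> \<bar>divergence z x\<bar> \<le> B"
    by (intro exI[of _ "max B1 B2"]) (auto simp: le_max_iff_disj)
qed

text \<open>The product rule writes \<open>a * divergence z + a' \<bullet> z\<close> as a sum of
  partial derivatives of the compactly supported functions \<open>a * (z \<bullet> b)\<close>, and
  each of these integrates to 0.\<close>

lemma integration_by_parts:
  assumes a: "has_C1_gradient a a'" and z: "z \<in> C1c \<Omega>"
  shows "(LBINT x. a x * divergence z x) = - (LBINT x. a' x \<bullet> z x)"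
proof -
  obtain K g where *: "compact K" "K \<subseteq> \<Omega>" "\<And>x. x \<notin> K \<Longrightarrow> z x = 0"
    "\<And>b. b \<in> Basis \<Longrightarrow> has_C1_gradient (\<lambda>x. z x \<bullet> b) (g b)"
    "\<And>x. divergence z x = (\<Sum>b\<in>Basis. g b x \<bullet> b)"
    "\<And>b x. b \<in> Basis \<Longrightarrow> x \<notin> K \<Longrightarrow> g b x = 0"
    by (rule C1c_D[OF z]) blast
  note aD = has_C1_gradientD[OF a]
  have i: "integrable lborel (\<lambda>x. (a x *\<^sub>R g b x + (z x \<bullet> b) *\<^sub>R a' x) \<bullet> b)" if b: "b \<in> Basis" for b
    by (rule compact_support_integrable[OF _ *(1)])
       (use aD has_C1_gradientD[OF *(4)[OF b]] *(3,6) b in \<open>auto intro!: continuous_intros\<close>)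
  have pt: "a x * divergence z x + a' x \<bullet> z x = (\<Sum>b\<in>Basis. (a x *\<^sub>R g b x + (z x \<bullet> b) *\<^sub>R a' x) \<bullet> b)" for x
  proof -
    have "a' x \<bullet> z x = (\<Sum>b\<in>Basis. (z x \<bullet> b) * (a' x \<bullet> b))"
      by (subst euclidean_inner) (simp only: mult.commute)
    then show ?thesis
      by (simp add: *(5) inner_add_left sum.distrib sum_distrib_left)
  qed
  have d0: "divergence z x = 0" if "x \<notin> K" for x using *(5,6) that by simp
  have i1: "integrable lborel (\<lambda>x. a x * divergence z x)"
    by (rule compact_support_integrable[OF _ *(1)])
       (use d0 in \<open>auto intro!: continuous_on_mult aD C1c_bounded_support[OF z]\<close>)
  have i2: "integrable lborel (\<lambda>x. a' x \<bullet> z x)"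
    by (rule compact_support_integrable[OF _ *(1)])
       (use *(3) in \<open>auto intro!: continuous_on_inner aD C1c_bounded_support[OF z]\<close>)
  have "(LBINT x. a x * divergence z x) + (LBINT x. a' x \<bullet> z x) = (LBINT x. a x * divergence z x + a' x \<bullet> z x)"
    using i1 i2 by simp
  also have "\<dots> = (LBINT x. (\<Sum>b\<in>Basis. (a x *\<^sub>R g b x + (z x \<bullet> b) *\<^sub>R a' x) \<bullet> b))"
    unfolding pt ..
  also have "\<dots> = (\<Sum>b\<in>Basis. (LBINT x. (a x *\<^sub>R g b x + (z x \<bullet> b) *\<^sub>R a' x) \<bullet> b))"
    by (rule Bochner_Integration.integral_sum) (use i in auto)
  also have "\<dots> = 0"
  proof (intro sum.neutral ballI)
    fix b :: 'a assume b: "b \<in> Basis"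
    show "(LBINT x. (a x *\<^sub>R g b x + (z x \<bullet> b) *\<^sub>R a' x) \<bullet> b) = 0"
      by (rule integral_gradient_eq_0[OF has_C1_gradient_mult[OF a *(4)[OF b]] *(1)]) (simp add: *(3))
  qed
  finally show ?thesis by simp
qed

section \<open>Mollification\<close>

text \<open>Squaring the positive part glues to 0 with a continuous derivative. Kernels, thresholds
  and cutoffs are all built from it, since only one derivative is ever taken.\<close>

definition pos_sq :: "real \<Rightarrow> real" where "pos_sq t = (max 0 t)\<^sup>2"

lemma pos_sq_has_real_derivative: "(pos_sq has_real_derivative 2 * max 0 t) (at t)"
proof (cases "t = 0")
  case True
  have "(pos_sq has_derivative (\<lambda>h. 0)) (at 0)"
    unfolding has_derivative_within_alt
  proof (intro conjI allI impI)
    fix e :: real assume e: "e > 0"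
    have "norm (pos_sq y - pos_sq 0 - 0) \<le> e * norm (y - 0)" if "norm (y - 0) < e" for y
    proof -
      have "pos_sq y \<le> \<bar>y\<bar> * \<bar>y\<bar>" by (auto simp: pos_sq_def max_def power2_eq_square)
      also have "\<dots> \<le> e * \<bar>y\<bar>" using that by (intro mult_right_mono) auto
      finally show ?thesis by (simp add: pos_sq_def)
    qed
    then show "\<exists>d>0. \<forall>y\<in>UNIV. norm (y - 0) < d \<longrightarrow> norm (pos_sq y - pos_sq 0 - 0) \<le> e * norm (y - 0)"
      using e by blast
  qed simp
  then show ?thesis using True by (simp add: has_field_derivative_def mult_zero_left[abs_def])
next
  case False
  show ?thesis
  proof (cases "t > 0")
    case True
    have "((\<lambda>t. t\<^sup>2) has_real_derivative 2 * max 0 t) (at t)"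
      using True by (auto intro!: derivative_eq_intros)
    then show ?thesis
      by (rule has_field_derivative_transform_within_open[where S = "{0<..}"]) (use True in \<open>auto simp: pos_sq_def max_def\<close>)
  next
    case n: False
    have "((\<lambda>t. 0) has_real_derivative 2 * max 0 t) (at t)"
      using n by (auto intro!: derivative_eq_intros)
    then show ?thesis
      by (rule has_field_derivative_transform_within_open[where S = "{..<0}"]) (use n False in \<open>auto simp: pos_sq_def max_def\<close>)
  qed
qed

lemma pos_sq_nonneg [simp]: "0 \<le> pos_sq t" by (simp add: pos_sq_def)

lemma continuous_on_pos_sq [continuous_intros]:
  "continuous_on S f \<Longrightarrow> continuous_on S (\<lambda>x. pos_sq (f x))"
  unfolding pos_sq_def by (intro continuous_intros)

lemma has_C1_gradient_sq_dist: "has_C1_gradient (\<lambda>x. c - (x - a) \<bullet> (x - a) * k) (\<lambda>x. (- 2 * k) *\<^sub>R (x - a))"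
  by (rule has_C1_gradientI) (auto intro!: derivative_eq_intros continuous_intros simp: inner_commute algebra_simps)

lemma has_C1_gradient_pos_sq_dist:
  "has_C1_gradient (\<lambda>x. pos_sq (c - (x - a) \<bullet> (x - a) * k))
     (\<lambda>x. (- 4 * k * max 0 (c - (x - a) \<bullet> (x - a) * k)) *\<^sub>R (x - a))"
proof -
  have "has_C1_gradient (\<lambda>x. pos_sq (c - (x - a) \<bullet> (x - a) * k))
     (\<lambda>x. (2 * max 0 (c - (x - a) \<bullet> (x - a) * k)) *\<^sub>R ((- 2 * k) *\<^sub>R (x - a)))"
    by (rule has_C1_gradient_compose[OF has_C1_gradient_sq_dist pos_sq_has_real_derivative])
       (intro continuous_intros)
  then show ?thesis by (simp add: algebra_simps)
qed

lemma has_C1_gradient_cmult: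
  assumes "has_C1_gradient f f'"
  shows "has_C1_gradient (\<lambda>x. c * f x) (\<lambda>x. c *\<^sub>R f' x)"
  using has_C1_gradient_compose[OF assms, of "\<lambda>t. c * t" "\<lambda>_. c"]
  by (auto intro!: derivative_eq_intros continuous_intros)

text \<open>The type argument records the dimension, which \<open>r\<close> alone does not
  determine.\<close>

definition mollifier_mass :: "'a::euclidean_space itself \<Rightarrow> real \<Rightarrow> real" where
  "mollifier_mass _ r = (LBINT x. pos_sq (r\<^sup>2 - (x::'a) \<bullet> x))"

definition mollifier :: "real \<Rightarrow> 'a::euclidean_space \<Rightarrow> real" where
  "mollifier r x = pos_sq (r\<^sup>2 - x \<bullet> x) / mollifier_mass TYPE('a) r"

definition mollifier_grad :: "real \<Rightarrow> 'a::euclidean_space \<Rightarrow> 'a" where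
  "mollifier_grad r x = (- 4 * max 0 (r\<^sup>2 - x \<bullet> x) / mollifier_mass TYPE('a) r) *\<^sub>R x"

lemma pos_sq_eq_0_outside: "0 < r \<Longrightarrow> r \<le> norm x \<Longrightarrow> max 0 (r\<^sup>2 - x \<bullet> x) = 0"
  by (simp add: power2_norm_eq_inner[symmetric] power_mono)

context
  fixes r :: real
  assumes r: "r > 0"
begin

lemma mollifier_mass_pos: "mollifier_mass TYPE('a::euclidean_space) r > 0"
proof -
  \<comment> \<open>On the ball of radius \<open>r / 2\<close> the argument of \<open>pos_sq\<close>
    is at least \<open>r\<^sup>2 - (r / 2)\<^sup>2\<close>, that is
    \<open>3 / 4 * r\<^sup>2\<close>.\<close>
  let ?c = "(3 / 4 * r\<^sup>2)\<^sup>2"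
  have i: "integrable lborel (\<lambda>x::'a. pos_sq (r\<^sup>2 - x \<bullet> x))"
  proof (rule compact_support_integrable[of _ "cball 0 r"])
    fix x :: 'a assume "x \<notin> cball 0 r"
    then show "pos_sq (r\<^sup>2 - x \<bullet> x) = 0"
      using pos_sq_eq_0_outside[OF r, of x] by (simp add: pos_sq_def)
  qed (auto intro!: continuous_intros)
  have fin: "emeasure lborel (ball (0::'a) (r/2)) < \<infinity>"
    using emeasure_lborel_ball_finite by blast
  have "0 < ?c * measure lborel (ball (0::'a) (r/2))"
    using r content_ball_pos[of "r/2" "0::'a"] by simp
  also have "\<dots> = (LBINT x. indicator (ball (0::'a) (r/2)) x * ?c)" by simp
  also have "\<dots> \<le> mollifier_mass TYPE('a) r"
    unfolding mollifier_mass_def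
  proof (rule integral_mono[OF _ i])
    show "integrable lborel (\<lambda>x. indicator (ball (0::'a) (r/2)) x * ?c)"
      using fin by (intro integrable_mult_left integrable_real_indicator) auto
    fix x :: 'a
    show "indicator (ball 0 (r/2)) x * ?c \<le> pos_sq (r\<^sup>2 - x \<bullet> x)"
    proof (cases "x \<in> ball 0 (r/2)")
      case True
      then have "x \<bullet> x \<le> (r/2)\<^sup>2" by (simp add: power2_norm_eq_inner[symmetric] power_mono)
      then have "3 / 4 * r\<^sup>2 \<le> max 0 (r\<^sup>2 - x \<bullet> x)" by (auto simp: power2_eq_square max_def)
      then show ?thesis using True unfolding pos_sq_def by (simp add: power_mono)
    qed auto
  qed
  finally show ?thesis .
qed

lemma mollifier_nonneg: "0 \<le> mollifier r (x::'a::euclidean_space)"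
  using mollifier_mass_pos[where 'a = 'a] by (simp add: mollifier_def)

lemma mollifier_eq_0: "r \<le> norm x \<Longrightarrow> mollifier r (x::'a::euclidean_space) = 0"
  using pos_sq_eq_0_outside[OF r, of x] by (simp add: mollifier_def pos_sq_def)

lemma mollifier_grad_eq_0: "r \<le> norm x \<Longrightarrow> mollifier_grad r (x::'a::euclidean_space) = 0"
  using pos_sq_eq_0_outside[OF r, of x] by (simp add: mollifier_grad_def)

lemma mollifier_grad_minus: "mollifier_grad r (- x) = - mollifier_grad r x"
  by (simp add: mollifier_grad_def)

lemma has_C1_gradient_mollifier:
  "has_C1_gradient (mollifier r :: 'a::euclidean_space \<Rightarrow> real) (mollifier_grad r)"
proof -
  have "has_C1_gradient (\<lambda>x::'a. (1 / mollifier_mass TYPE('a) r) * pos_sq (r\<^sup>2 - (x - 0) \<bullet> (x - 0) * 1))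
     (\<lambda>x. (1 / mollifier_mass TYPE('a) r) *\<^sub>R ((- 4 * 1 * max 0 (r\<^sup>2 - (x - 0) \<bullet> (x - 0) * 1)) *\<^sub>R (x - 0)))"
    by (intro has_C1_gradient_cmult has_C1_gradient_pos_sq_dist)
  then show ?thesis unfolding mollifier_def[abs_def] mollifier_grad_def[abs_def] by simp
qed

lemma integrable_mollifier: "integrable lborel (mollifier r :: 'a::euclidean_space \<Rightarrow> real)"
  by (rule compact_support_integrable[of _ "cball 0 r"])
     (auto intro!: has_C1_gradientD[OF has_C1_gradient_mollifier] mollifier_eq_0)

lemma integral_mollifier: "(LBINT x. mollifier r (x::'a::euclidean_space)) = 1"
  using mollifier_mass_pos[where 'a = 'a] by (simp add: mollifier_def mollifier_mass_def)

lemma mollifier_regular: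
  shows "uniformly_continuous_on UNIV (mollifier_grad r :: 'a::euclidean_space \<Rightarrow> 'a)"
    and "\<exists>B>0. \<forall>x::'a. \<bar>mollifier r x\<bar> \<le> B \<and> norm (mollifier_grad r x) \<le> B"
proof -
  note D = has_C1_gradientD[OF has_C1_gradient_mollifier[where 'a = 'a]]
  show "uniformly_continuous_on UNIV (mollifier_grad r :: 'a \<Rightarrow> 'a)"
    by (rule compact_support_uniformly_continuous[OF D(2), of r]) (simp add: mollifier_grad_eq_0)
  obtain B1 where 1: "\<And>x::'a. norm (mollifier r x) \<le> B1" "B1 > 0"
    by (rule compact_support_bounded[OF D(3), of "cball 0 r"]) (auto simp: mollifier_eq_0)
  obtain B2 where 2: "\<And>x::'a. norm (mollifier_grad r x) \<le> B2" "B2 > 0"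
    by (rule compact_support_bounded[OF D(2), of "cball 0 r"]) (auto simp: mollifier_grad_eq_0)
  show "\<exists>B>0. \<forall>x::'a. \<bar>mollifier r x\<bar> \<le> B \<and> norm (mollifier_grad r x) \<le> B"
    using 1 2 by (intro exI[of _ "max B1 B2"]) (auto simp: le_max_iff_disj)
qed

end

section \<open>Convolution with the kernel\<close>

definition mollify :: "real \<Rightarrow> ('a::euclidean_space \<Rightarrow> real) \<Rightarrow> 'a \<Rightarrow> real" where
  "mollify r f x = (LBINT y. f y * mollifier r (x - y))"

definition mollify_grad :: "real \<Rightarrow> ('a::euclidean_space \<Rightarrow> real) \<Rightarrow> 'a \<Rightarrow> 'a" where
  "mollify_grad r f x = (LBINT y. f y *\<^sub>R mollifier_grad r (x - y))"

context
  fixes r :: real and f :: "'a::euclidean_space \<Rightarrow> real"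
  assumes r: "r > 0" and f: "integrable lborel f"
begin

lemma has_C1_gradient_mollify: "has_C1_gradient (mollify r f) (mollify_grad r f)"
proof -
  obtain B where "\<forall>x::'a. \<bar>mollifier r x\<bar> \<le> B \<and> norm (mollifier_grad r x) \<le> B"
    using mollifier_regular(2)[OF r, where 'a = 'a] by blast
  then show ?thesis
    unfolding mollify_def[abs_def] mollify_grad_def[abs_def]
    by (intro convolution_has_C1_gradient[OF f has_C1_gradient_mollifier[OF r] mollifier_regular(1)[OF r]]) auto
qed

lemma borel_measurable_mollifier: "(mollifier r :: 'a \<Rightarrow> real) \<in> borel_measurable borel"
  using has_C1_gradientD[OF has_C1_gradient_mollifier[OF r]] by auto

lemma mollify_integrand_integrable:
  "integrable lborel (\<lambda>y. f (x - y) * mollifier r y)"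
proof -
  obtain B where "\<forall>x::'a. \<bar>mollifier r x\<bar> \<le> B \<and> norm (mollifier_grad r x) \<le> B"
    using mollifier_regular(2)[OF r, where 'a = 'a] by blast
  then show ?thesis
    using lborel_integrable_minus[OF integrable_lborel_borel[OF f], of x] f borel_measurable_mollifier
    by (intro integrable_mult_bounded[where B = B]) auto
qed

lemma mollify_eq: "mollify r f x = (LBINT y. f (x - y) * mollifier r y)"
proof -
  note [measurable] = borel_measurable_mollifier integrable_lborel_borel[OF f]
  have "mollify r f x = (LBINT y. (\<lambda>y. f (x - y) * mollifier r y) (x - y))"
    by (simp add: mollify_def)
  also have "\<dots> = (LBINT y. f (x - y) * mollifier r y)"
    by (rule lborel_integral_minus) measurable
  finally show ?thesis .
qed

text \<open>A mollification is a weighted average of the values within distance \<open>r\<close>.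
  This one-sided bound, applied to \<open>f\<close> and to \<open>- f\<close>, also controls lower
  bounds and supports, and it carries pointwise constraints over to mollified fields.\<close>

lemma mollify_le:
  assumes "\<And>y. norm y < r \<Longrightarrow> f (x - y) \<le> C"
  shows "mollify r f x \<le> C"
proof -
  have "mollify r f x \<le> (\<integral>y. C * mollifier r y \<partial>(lborel :: 'a measure))"
    unfolding mollify_eq
  proof (rule integral_mono[OF mollify_integrand_integrable])
    show "integrable lborel (\<lambda>y::'a. C * mollifier r y)" using integrable_mollifier[OF r, where 'a = 'a] by simp
    fix y :: 'a
    show "f (x - y) * mollifier r y \<le> C * mollifier r y"
      using assms[of y] mollifier_eq_0[OF r, of y] mollifier_nonneg[OF r, of y]
      by (cases "norm y < r") (auto intro: mult_right_mono)
  qed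
  then show ?thesis using integral_mollifier[OF r, where 'a = 'a] by simp
qed

lemma mollify_minus: "mollify r (\<lambda>x. - f x) x = - mollify r f x"
  by (simp add: mollify_def)

text \<open>By Fubini, the L1 distance between \<open>f\<close> and its mollification is at most an
  average of the distances between \<open>f\<close> and its translates by less than
  \<open>r\<close>.\<close>

lemma integrable_mollify_diff:
  assumes sm: "\<And>h. norm h < r \<Longrightarrow> (LBINT x. \<bar>f (x + h) - f x\<bar>) \<le> e" and e: "e \<ge> 0"
  shows "integrable lborel (\<lambda>x. mollify r f x - f x)" "(LBINT x. \<bar>mollify r f x - f x\<bar>) \<le> e"
proof -
  note [measurable] = borel_measurable_mollifier integrable_lborel_borel[OF f]
  have [measurable]: "mollify r f \<in> borel_measurable borel"
    using has_C1_gradientD[OF has_C1_gradient_mollify] by auto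
  have pt: "ennreal \<bar>mollify r f x - f x\<bar> \<le> (\<integral>\<^sup>+y. ennreal (\<bar>f (x - y) - f x\<bar> * mollifier r y) \<partial>lborel)" for x
  proof -
    have i2: "integrable lborel (\<lambda>y::'a. f x * mollifier r y)" using integrable_mollifier[OF r, where 'a = 'a] by simp
    have "mollify r f x - f x = (LBINT y. f (x - y) * mollifier r y - f x * mollifier r y)"
      using mollify_integrand_integrable[of x] i2 integral_mollifier[OF r, where 'a = 'a]
      by (simp add: mollify_eq)
    also have "\<dots> = (LBINT y. (f (x - y) - f x) * mollifier r y)"
      by (simp add: algebra_simps)
    finally have "ennreal \<bar>mollify r f x - f x\<bar> = ennreal (norm (LBINT y. (f (x - y) - f x) * mollifier r y))"
      by simp
    also have "\<dots> \<le> (\<integral>\<^sup>+y. ennreal (norm ((f (x - y) - f x) * mollifier r y)) \<partial>lborel)"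
      by (rule integral_norm_bound_ennreal) (use mollify_integrand_integrable[of x] i2 in \<open>simp add: algebra_simps\<close>)
    finally show ?thesis using mollifier_nonneg[OF r, where 'a = 'a] by (simp add: abs_mult)
  qed
  have "(\<integral>\<^sup>+x. ennreal \<bar>mollify r f x - f x\<bar> \<partial>lborel)
    \<le> (\<integral>\<^sup>+x. (\<integral>\<^sup>+y. ennreal (\<bar>f (x - y) - f x\<bar> * mollifier r y) \<partial>lborel) \<partial>lborel)"
    by (intro nn_integral_mono pt)
  also have "\<dots> = (\<integral>\<^sup>+y. (\<integral>\<^sup>+x. ennreal (\<bar>f (x - y) - f x\<bar> * mollifier r y) \<partial>lborel) \<partial>lborel)"
    by (rule lborel_pair.Fubini') measurable
  also have "\<dots> \<le> (\<integral>\<^sup>+y. ennreal (e * mollifier r (y::'a)) \<partial>lborel)"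
  proof (intro nn_integral_mono)
    fix y :: 'a
    have "(\<integral>\<^sup>+x. ennreal (\<bar>f (x - y) - f x\<bar> * mollifier r y) \<partial>lborel)
       = ennreal (mollifier r y) * (\<integral>\<^sup>+x. ennreal \<bar>f (x - y) - f x\<bar> \<partial>lborel)"
      by (subst nn_integral_cmult[symmetric]) (auto simp: ennreal_mult mult.commute mollifier_nonneg[OF r])
    also have "\<dots> = ennreal (mollifier r y) * ennreal (LBINT x. \<bar>f (x - y) - f x\<bar>)"
      using integrable_translation_diff[OF f, of "- y"] by (subst nn_integral_eq_integral) auto
    also have "\<dots> \<le> ennreal (e * mollifier r y)"
    proof (cases "norm y < r")
      case True
      then have "(LBINT x. \<bar>f (x - y) - f x\<bar>) \<le> e" using sm[of "- y"] by simp
      then have "mollifier r y * (LBINT x. \<bar>f (x - y) - f x\<bar>) \<le> e * mollifier r y"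
        using mollifier_nonneg[OF r, of y] by (metis mult.commute mult_right_mono)
      then show ?thesis using mollifier_nonneg[OF r, of y] e
        by (simp add: ennreal_mult[symmetric] ennreal_leI)
    next
      case False then show ?thesis using mollifier_eq_0[OF r, of y] by simp
    qed
    finally show "(\<integral>\<^sup>+x. ennreal (\<bar>f (x - y) - f x\<bar> * mollifier r y) \<partial>lborel) \<le> ennreal (e * mollifier r y)" .
  qed
  also have "\<dots> = ennreal (LBINT y. e * mollifier r (y::'a))"
    using e integrable_mollifier[OF r, where 'a = 'a] mollifier_nonneg[OF r, where 'a = 'a] by (intro nn_integral_eq_integral) auto
  also have "\<dots> = ennreal e" using integral_mollifier[OF r, where 'a = 'a] by simp
  finally have le: "(\<integral>\<^sup>+x. ennreal \<bar>mollify r f x - f x\<bar> \<partial>lborel) \<le> ennreal e" .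
  show i: "integrable lborel (\<lambda>x. mollify r f x - f x)"
    by (rule integrableI_bounded) (use le in \<open>auto simp: less_top[symmetric] top_unique\<close>)
  have "ennreal (LBINT x. \<bar>mollify r f x - f x\<bar>) \<le> ennreal e"
    using le i by (subst (asm) nn_integral_eq_integral) auto
  then show "(LBINT x. \<bar>mollify r f x - f x\<bar>) \<le> e" using e by (simp add: ennreal_le_iff)
qed

end

lemma mollify_ge:
  fixes f :: "'a::euclidean_space \<Rightarrow> real"
  assumes "r > 0" "integrable lborel f" "\<And>y. norm y < r \<Longrightarrow> C \<le> f (x - y)"
  shows "C \<le> mollify r f x"
  using mollify_le[of r "\<lambda>x. - f x" x "- C"] mollify_minus[of r f x] assms by simp

lemma mollify_eq_0:
  fixes f :: "'a::euclidean_space \<Rightarrow> real"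
  assumes "r > 0" "integrable lborel f" "\<And>y. norm y < r \<Longrightarrow> f (x - y) = 0"
  shows "mollify r f x = 0"
  using mollify_le[of r f x 0] mollify_ge[of r f 0 x] assms by fastforce

lemma mollify_L1_limit:
  fixes f :: "'a::euclidean_space \<Rightarrow> real"
  assumes f: "integrable lborel f" and e: "e > 0"
  obtains d where "d > 0" "\<And>r. 0 < r \<Longrightarrow> r < d \<Longrightarrow>
    integrable lborel (mollify r f) \<and> (LBINT x. \<bar>mollify r f x - f x\<bar>) \<le> e"
proof -
  obtain d where d: "d > 0" "\<And>h. norm h < d \<Longrightarrow> (LBINT x. \<bar>f (x + h) - f x\<bar>) < e"
    using L1_translation_small[OF f e] by metis
  show ?thesis
  proof (rule that[OF d(1)])
    fix r assume r: "0 < r" "r < d"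
    have *: "integrable lborel (\<lambda>x. mollify r f x - f x)" "(LBINT x. \<bar>mollify r f x - f x\<bar>) \<le> e"
      using integrable_mollify_diff[OF r(1) f, of e] d(2) r(2) e by (meson less_imp_le less_trans)+
    then show "integrable lborel (mollify r f) \<and> (LBINT x. \<bar>mollify r f x - f x\<bar>) \<le> e"
      using Bochner_Integration.integrable_add[OF *(1) f] by simp
  qed
qed

text \<open>The gradient of an even kernel is odd, so convolution with it is antisymmetric. This
  moves the derivative from a mollified test field onto the mollified function.\<close>

lemma mollify_grad_adjoint:
  fixes f g :: "'a::euclidean_space \<Rightarrow> real"
  assumes r: "r > 0" and f: "integrable lborel f" and g: "integrable lborel g"
  shows "(LBINT y. f y * (mollify_grad r g y \<bullet> b)) = - (LBINT x. g x * (mollify_grad r f x \<bullet> b))"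
proof -
  note [measurable] = integrable_lborel_borel[OF f] integrable_lborel_borel[OF g]
  have [measurable]: "(mollifier_grad r :: 'a \<Rightarrow> 'a) \<in> borel_measurable borel"
    using has_C1_gradientD[OF has_C1_gradient_mollifier[OF r]] by auto
  obtain B where B: "\<And>x::'a. norm (mollifier_grad r x) \<le> B" "B > 0"
    using mollifier_regular(2)[OF r, where 'a = 'a] by blast
  define H where "H = (\<lambda>y x. f y * (g x * (mollifier_grad r (y - x) \<bullet> b)))"
  have ii: "integrable lborel (\<lambda>x. f x *\<^sub>R mollifier_grad r (y - x))" if "integrable lborel f" for f :: "'a \<Rightarrow> real" and y
    by (rule integrable_scaleR_bounded[OF that _ B(1)]) measurable
  have in1: "f y * (mollify_grad r g y \<bullet> b) = (LBINT x. H y x)" for y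
    unfolding H_def mollify_grad_def
    using integral_inner_left[of b lborel "\<lambda>x. g x *\<^sub>R mollifier_grad r (y - x)"] ii[OF g, of y] by simp
  have in2: "g x * (mollify_grad r f x \<bullet> b) = - (LBINT y. H y x)" for x
  proof -
    have "g x * (mollify_grad r f x \<bullet> b) = (LBINT y. g x * (f y * (mollifier_grad r (x - y) \<bullet> b)))"
      unfolding mollify_grad_def
      using integral_inner_left[of b lborel "\<lambda>y. f y *\<^sub>R mollifier_grad r (x - y)"] ii[OF f, of x] by simp
    also have "\<dots> = (LBINT y. - H y x)"
    proof (rule Bochner_Integration.integral_cong[OF refl])
      fix y show "g x * (f y * (mollifier_grad r (x - y) \<bullet> b)) = - H y x"
        using mollifier_grad_minus[OF r, of "y - x"] by (simp add: H_def)
    qed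
    finally show ?thesis by simp
  qed
  have bd: "norm (H y x) \<le> \<bar>f y\<bar> * (\<bar>g x\<bar> * (B * norm b))" for y x
  proof -
    have "\<bar>mollifier_grad r (y - x) \<bullet> b\<bar> \<le> B * norm b"
      using Cauchy_Schwarz_ineq2[of "mollifier_grad r (y - x)" b] B(1)[of "y - x"] mult_right_mono[of "norm (mollifier_grad r (y - x))" B "norm b"] by auto
    then show ?thesis by (simp add: H_def abs_mult mult_left_mono)
  qed
  have iy: "integrable lborel (\<lambda>x. H y x)" for y
  proof (rule Bochner_Integration.integrable_bound[where f = "\<lambda>x. \<bar>f y\<bar> * (\<bar>g x\<bar> * (B * norm b))"])
    show "(\<lambda>x. H y x) \<in> borel_measurable lborel" unfolding H_def by measurable
    show "AE x in lborel. norm (H y x) \<le> norm (\<bar>f y\<bar> * (\<bar>g x\<bar> * (B * norm b)))"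
    proof (rule AE_I2)
      fix x show "norm (H y x) \<le> norm (\<bar>f y\<bar> * (\<bar>g x\<bar> * (B * norm b)))" using bd[of y x] by simp
    qed
  qed (use g in simp)
  have "integrable (lborel \<Otimes>\<^sub>M lborel) (\<lambda>(y, x). H y x)"
  proof (rule lborel_pair.Fubini_integrable)
    show "(\<lambda>(y, x). H y x) \<in> borel_measurable (lborel \<Otimes>\<^sub>M lborel)" unfolding H_def by measurable
    show "AE y in lborel. integrable lborel (\<lambda>x. case (y, x) of (y, x) \<Rightarrow> H y x)" using iy by simp
    show "integrable lborel (\<lambda>y. \<integral>x. norm (case (y, x) of (y, x) \<Rightarrow> H y x) \<partial>lborel)"
    proof (rule Bochner_Integration.integrable_bound[where f = "\<lambda>y. \<bar>f y\<bar> * (LBINT x. \<bar>g x\<bar> * (B * norm b))"])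
      show "integrable lborel (\<lambda>y. \<bar>f y\<bar> * (LBINT x. \<bar>g x\<bar> * (B * norm b)))" using f by simp
      show "(\<lambda>y. \<integral>x. norm (case (y, x) of (y, x) \<Rightarrow> H y x) \<partial>lborel) \<in> borel_measurable lborel"
        unfolding H_def by measurable
      show "AE y in lborel. norm (LBINT x. norm (case (y, x) of (y, x) \<Rightarrow> H y x)) \<le> norm (\<bar>f y\<bar> * (LBINT x. \<bar>g x\<bar> * (B * norm b)))"
      proof (rule AE_I2)
        fix y
        have "(LBINT x. norm (H y x)) \<le> (LBINT x. \<bar>f y\<bar> * (\<bar>g x\<bar> * (B * norm b)))"
          by (rule integral_mono) (use iy[of y] g bd in auto)
        also have "\<dots> = \<bar>f y\<bar> * (LBINT x. \<bar>g x\<bar> * (B * norm b))" by simp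
        finally show "norm (LBINT x. norm (case (y, x) of (y, x) \<Rightarrow> H y x)) \<le> norm (\<bar>f y\<bar> * (LBINT x. \<bar>g x\<bar> * (B * norm b)))"
          using B(2) by (simp add: abs_mult)
      qed
    qed
  qed
  from lborel_pair.Fubini_integral[OF this]
  show ?thesis unfolding in1 in2 by simp
qed

section \<open>Truncating a function of least gradient\<close>

lemma C1c_scaleR:
  assumes z: "z \<in> C1c \<Omega>"
  shows "(\<lambda>x. c *\<^sub>R z x) \<in> C1c \<Omega>" "divergence (\<lambda>x. c *\<^sub>R z x) x = c * divergence z x"
proof -
  obtain K g where *: "compact K" "K \<subseteq> \<Omega>" "\<And>x. x \<notin> K \<Longrightarrow> z x = 0"
    "\<And>b. b \<in> Basis \<Longrightarrow> has_C1_gradient (\<lambda>x. z x \<bullet> b) (g b)"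
    "\<And>x. divergence z x = (\<Sum>b\<in>Basis. g b x \<bullet> b)"
    "\<And>b x. b \<in> Basis \<Longrightarrow> x \<notin> K \<Longrightarrow> g b x = 0"
    by (rule C1c_D[OF z]) blast
  have eq: "(\<lambda>x. \<Sum>b\<in>Basis. (c * (z x \<bullet> b)) *\<^sub>R b) = (\<lambda>x. c *\<^sub>R z x)"
    by (simp add: scaleR_scaleR[symmetric] scaleR_sum_right[symmetric] euclidean_representation del: scaleR_scaleR)
  note C = C1c_I[where F = "\<lambda>b x. c * (z x \<bullet> b)" and g = "\<lambda>b x. c *\<^sub>R g b x", OF has_C1_gradient_cmult[OF *(4)] *(1,2), unfolded eq]
  show "(\<lambda>x. c *\<^sub>R z x) \<in> C1c \<Omega>" by (rule C) (use *(3) in auto)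
  have "divergence (\<lambda>x. c *\<^sub>R z x) x = (\<Sum>b\<in>Basis. (c *\<^sub>R g b x) \<bullet> b)"
    by (rule C) (use *(3) in auto)
  then show "divergence (\<lambda>x. c *\<^sub>R z x) x = c * divergence z x"
    by (simp add: *(5) sum_distrib_left)
qed

lemma C1c_zero: "(\<lambda>x. 0) \<in> C1c (\<Omega> :: 'a::euclidean_space set)"
  and divergence_zero: "divergence (\<lambda>x. 0 :: 'a) x = 0"
proof -
  have "has_C1_gradient (\<lambda>x::'a. 0) (\<lambda>x. 0)" by (rule has_C1_gradientI) auto
  then show "(\<lambda>x. 0) \<in> C1c \<Omega>" using C1c_I(1)[of "\<lambda>b x. 0" "\<lambda>b x. 0" "{}" \<Omega>] by simp
  have "frechet_derivative (\<lambda>x. 0 :: 'a) (at x) = (\<lambda>h. 0)"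
    using frechet_derivative_at[OF has_derivative_const[of "0::'a" "at x"]] by simp
  then show "divergence (\<lambda>x. 0 :: 'a) x = 0" by (simp add: divergence_def)
qed

text \<open>By homogeneity and continuity this is the constraint \<open>\<phi>\<^sup>0(x, z(x)) \<le> 1\<close>, now at every point.\<close>

definition admissible :: "('a::euclidean_space \<Rightarrow> 'a \<Rightarrow> real) \<Rightarrow> 'a set \<Rightarrow> ('a \<Rightarrow> 'a) set" where
  "admissible \<phi> \<Omega> = {z \<in> C1c \<Omega>. \<forall>x\<in>\<Omega>. \<forall>\<xi>. z x \<bullet> \<xi> \<le> \<phi> x \<xi>}"

lemma integrable_Lipschitz_image:
  fixes f :: "'a::euclidean_space \<Rightarrow> real" and P :: "real \<Rightarrow> 'a \<Rightarrow> real"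
  assumes "integrable lborel f" "(\<lambda>x. P (f x) x) \<in> borel_measurable borel" "\<And>v x. \<bar>P v x\<bar> \<le> C * \<bar>v\<bar>"
  shows "integrable lborel (\<lambda>x. P (f x) x)"
proof (rule Bochner_Integration.integrable_bound[of _ "\<lambda>x. C * f x"])
  show "AE x in lborel. norm (P (f x) x) \<le> norm (C * f x)"
  proof (rule AE_I2)
    fix x have "\<bar>P (f x) x\<bar> \<le> C * \<bar>f x\<bar>" using assms(3) by blast
    also have "\<dots> \<le> \<bar>C * f x\<bar>" by (simp add: abs_mult mult_right_mono)
    finally show "norm (P (f x) x) \<le> norm (C * f x)" by simp
  qed
qed (use assms in auto)

lemma nondecreasing_Lipschitz:
  assumes G: "\<And>t. (G has_real_derivative G' t) (at t)" "\<And>t. 0 \<le> G' t \<and> G' t \<le> 1"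
  shows "\<bar>G s - G t\<bar> \<le> \<bar>s - t\<bar>"
proof -
  have "norm (G s - G t) \<le> 1 * norm (s - t)"
    by (rule field_differentiable_bound[of UNIV G G'])
       (use G in \<open>auto intro: has_field_derivative_at_within\<close>)
  then show ?thesis by simp
qed

text \<open>\<open>l\<close> and \<open>L\<close> compare \<phi> with the Euclidean norm, \<eta> is
  the cutoff towards the boundary, and \<open>G\<close> extracts the high levels of a
  function.\<close>

locale truncation =
  fixes \<Omega> :: "'a::euclidean_space set" and \<phi> :: "'a \<Rightarrow> 'a \<Rightarrow> real" and l L :: real
    and \<eta> :: "'a \<Rightarrow> real" and \<eta>' :: "'a \<Rightarrow> 'a" and B\<eta> :: real and G G' :: "real \<Rightarrow> real"
  assumes open_domain: "open \<Omega>" and bounded_domain: "bounded \<Omega>"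
    and cont: "continuous_on (closure \<Omega> \<times> UNIV) (\<lambda>(x, \<xi>). \<phi> x \<xi>)"
    and homogeneous: "\<And>x \<xi> t. x \<in> closure \<Omega> \<Longrightarrow> \<phi> x (t *\<^sub>R \<xi>) = \<bar>t\<bar> * \<phi> x \<xi>"
    and l: "l > 0" and L: "L > 0"
    and bounds: "\<And>x \<xi>. x \<in> closure \<Omega> \<Longrightarrow> l * norm \<xi> \<le> \<phi> x \<xi> \<and> \<phi> x \<xi> \<le> L * norm \<xi>"
    and \<eta>: "has_C1_gradient \<eta> \<eta>'" "\<And>x. 0 \<le> \<eta> x \<and> \<eta> x \<le> 1" "\<And>x. norm (\<eta>' x) \<le> B\<eta>"
    and G: "\<And>t. (G has_real_derivative G' t) (at t)" "continuous_on UNIV G'" "\<And>t. 0 \<le> G' t \<and> G' t \<le> 1" "G 0 = 0"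
begin

lemma in_closure: "x \<in> \<Omega> \<Longrightarrow> x \<in> closure \<Omega>"
  using closure_subset by blast

lemma G_Lipschitz: "\<bar>G s - G t\<bar> \<le> \<bar>s - t\<bar>"
  using nondecreasing_Lipschitz[of G G'] G by blast

lemma G_le: "\<bar>G s\<bar> \<le> \<bar>s\<bar>"
  using G_Lipschitz[of s 0] G by simp

lemma continuous_on_G: "continuous_on UNIV G"
  using G(1) by (meson DERIV_isCont continuous_at_imp_continuous_on)

lemma measurable_G [measurable]: "G \<in> borel_measurable borel" "\<eta> \<in> borel_measurable borel" "\<eta>' \<in> borel_measurable borel"
  using continuous_on_G borel_measurable_continuous_UNIV has_C1_gradientD[OF \<eta>(1)] by auto

text \<open>Uniform continuity on the compact set of pairs \<open>(x, e)\<close> with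
  \<open>norm e = 1\<close> gives an additive error \<open>t * l\<close>. Since
  \<open>\<phi> x e \<ge> l\<close>, this is a relative error \<open>t\<close>, which homogeneity
  extends to all vectors.\<close>

lemma oscillation:
  assumes t: "t > 0"
  obtains d where "d > 0" "\<And>x y \<xi>. x \<in> \<Omega> \<Longrightarrow> y \<in> \<Omega> \<Longrightarrow> dist x y < d \<Longrightarrow> \<phi> y \<xi> \<le> (1 + t) * \<phi> x \<xi>"
proof -
  let ?S = "closure \<Omega> \<times> sphere (0::'a) 1"
  have "compact ?S" using bounded_domain by (intro compact_Times) (auto simp: compact_closure)
  moreover have "continuous_on ?S (\<lambda>(x, \<xi>). \<phi> x \<xi>)" by (rule continuous_on_subset[OF cont]) auto
  ultimately have uc: "uniformly_continuous_on ?S (\<lambda>(x, \<xi>). \<phi> x \<xi>)" by (rule compact_uniformly_continuous[rotated])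
  obtain d where d: "d > 0" "\<And>p q. p \<in> ?S \<Longrightarrow> q \<in> ?S \<Longrightarrow> dist q p < d \<Longrightarrow> dist (case q of (x, \<xi>) \<Rightarrow> \<phi> x \<xi>) (case p of (x, \<xi>) \<Rightarrow> \<phi> x \<xi>) < t * l"
    by (rule uniformly_continuous_onE[OF uc mult_pos_pos[OF t l]]) blast
  show ?thesis
  proof (rule that[OF d(1)])
    fix x y \<xi> assume x: "x \<in> \<Omega>" and y: "y \<in> \<Omega>" and xy: "dist x y < d"
    show "\<phi> y \<xi> \<le> (1 + t) * \<phi> x \<xi>"
    proof (cases "\<xi> = 0")
      case True
      then have "\<phi> y \<xi> = 0" "\<phi> x \<xi> = 0"
        using homogeneous[OF in_closure[OF y], of 0 0] homogeneous[OF in_closure[OF x], of 0 0] by simp_all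
      then show ?thesis by simp
    next
      case False
      define e where "e = \<xi> /\<^sub>R norm \<xi>"
      have e: "e \<in> sphere 0 1" "\<xi> = norm \<xi> *\<^sub>R e" using False by (auto simp: e_def)
      have "dist (\<phi> y e) (\<phi> x e) < t * l"
        using d(2)[of "(x, e)" "(y, e)"] x y xy e in_closure by (auto simp: dist_Pair_Pair dist_commute)
      then have "\<phi> y e \<le> \<phi> x e + t * l" by (simp add: dist_real_def abs_less_iff)
      also have "t * l \<le> t * \<phi> x e" using bounds[OF in_closure[OF x], of e] e t by (intro mult_left_mono) auto
      finally have "norm \<xi> * \<phi> y e \<le> norm \<xi> * ((1 + t) * \<phi> x e)" by (intro mult_left_mono) (auto simp: algebra_simps)
      moreover have "\<phi> y \<xi> = norm \<xi> * \<phi> y e" "\<phi> x \<xi> = norm \<xi> * \<phi> x e"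
        using homogeneous[OF in_closure[OF y], of "norm \<xi>" e] homogeneous[OF in_closure[OF x], of "norm \<xi>" e] e(2) by auto
      ultimately show ?thesis by (simp add: algebra_simps)
    qed
  qed
qed

text \<open>Inserting \<open>z x\<close> for \<xi> in the constraint gives \<open>(norm (z
  x))\<^sup>2 \<le> \<phi> x (z x) \<le> L * norm (z x)\<close>.\<close>

lemma admissible_norm:
  assumes z: "z \<in> admissible \<phi> \<Omega>" shows "norm (z x) \<le> L"
proof (cases "x \<in> \<Omega>")
  case True
  have "norm (z x) * norm (z x) \<le> \<phi> x (z x)"
    using z True unfolding power2_eq_square[symmetric] power2_norm_eq_inner by (auto simp: admissible_def)
  also have "\<dots> \<le> L * norm (z x)" using bounds[OF in_closure[OF True]] by blast
  finally show ?thesis using L by (cases "z x = 0") auto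
next
  case False
  then have "z x = 0" using z C1c_bounded_support(3)[of z \<Omega>] by (auto simp: admissible_def)
  then show ?thesis using L by simp
qed

text \<open>The field \<open>w\<close> in the proof is a pointwise convex combination of \<open>z1\<close> and \<open>z2\<close>, hence admissible;
  mollifying it costs only the factor \<open>1 + t\<close> since \<open>\<phi>\<close> is uniformly continuous on
  unit vectors.\<close>

lemma truncation_mollified:
  assumes V: "\<And>z. z \<in> admissible \<phi> \<Omega> \<Longrightarrow> (LBINT x. u x * divergence z x) \<le> V"
    and u: "integrable lborel u"
    and z1: "z1 \<in> admissible \<phi> \<Omega>" and z2: "z2 \<in> admissible \<phi> \<Omega>" and t: "t > 0"
  shows "\<exists>d>0. \<forall>r. 0 < r \<longrightarrow> r < d \<longrightarrow> integrable lborel (mollify r u) \<longrightarrow>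
     (LBINT x. (mollify r u x - \<eta> x * G (mollify r u x)) * divergence z1 x + \<eta> x * G (mollify r u x) * divergence z2 x
        - 2 * L * norm (\<eta>' x) * \<bar>G (mollify r u x)\<bar>) \<le> (1 + t) * V"
proof -
  have C: "z1 \<in> C1c \<Omega>" "z2 \<in> C1c \<Omega>" using z1 z2 by (auto simp: admissible_def)
  obtain K1 where K1: "compact K1" "K1 \<subseteq> \<Omega>" "\<And>x. x \<notin> K1 \<Longrightarrow> z1 x = 0 \<and> divergence z1 x = 0"
    using C1c_bounded_support(3)[OF C(1)] by blast
  obtain K2 where K2: "compact K2" "K2 \<subseteq> \<Omega>" "\<And>x. x \<notin> K2 \<Longrightarrow> z2 x = 0 \<and> divergence z2 x = 0"
    using C1c_bounded_support(3)[OF C(2)] by blast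
  define K where "K = K1 \<union> K2"
  have K: "compact K" "K \<subseteq> \<Omega>" using K1 K2 by (auto simp: K_def)
  have zK: "z1 x = 0" "z2 x = 0" "divergence z1 x = 0" "divergence z2 x = 0" if "x \<notin> K" for x
    using that K1 K2 by (auto simp: K_def)
  obtain d1 where d1: "d1 > 0" "(\<Union>x\<in>K. ball x d1) \<subseteq> \<Omega>"
    using compact_subset_open_imp_ball_epsilon_subset[OF K(1) open_domain K(2)] by metis
  obtain d2 where d2: "d2 > 0" "\<And>x y \<xi>. x \<in> \<Omega> \<Longrightarrow> y \<in> \<Omega> \<Longrightarrow> dist x y < d2 \<Longrightarrow> \<phi> y \<xi> \<le> (1 + t) * \<phi> x \<xi>"
    using oscillation[OF t] by metis
  have "(LBINT x. (mollify r u x - \<eta> x * G (mollify r u x)) * divergence z1 x + \<eta> x * G (mollify r u x) * divergence z2 x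
        - 2 * L * norm (\<eta>' x) * \<bar>G (mollify r u x)\<bar>) \<le> (1 + t) * V"
    if r: "0 < r" "r < min d1 d2" and iur: "integrable lborel (mollify r u)" for r
  proof -
    let ?ur = "mollify r u" and ?gr = "mollify_grad r u"
    note gu = has_C1_gradient_mollify[OF r(1) u]
    note guD = has_C1_gradientD[OF gu]
    note \<eta>D = has_C1_gradientD[OF \<eta>(1)]
    \<comment> \<open>The weights imitate the chain rule: pairing \<open>w\<close> with the gradient
      of \<open>mollify r u\<close> gives what \<open>z1\<close> and \<open>z2\<close> give with the
      gradients of the two parts of \<open>mollify r u\<close>, up to a term with \<eta>'. As
      \<open>G'\<close> is only continuous, so is \<open>w\<close>.\<close>
    define w where "w = (\<lambda>x. (1 - \<eta> x * G' (?ur x)) *\<^sub>R z1 x + (\<eta> x * G' (?ur x)) *\<^sub>R z2 x)"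
    have wK: "w x = 0" if "x \<notin> K" for x using zK[OF that] by (simp add: w_def)
    have wc: "continuous_on UNIV w"
      unfolding w_def
      by (intro continuous_intros \<eta>D(3) continuous_on_compose2[OF G(2) guD(3)] C1c_bounded_support(1)[OF C(1)] C1c_bounded_support(1)[OF C(2)]) auto
    have wib: "integrable lborel (\<lambda>x. w x \<bullet> \<xi>)" for \<xi>
      by (rule compact_support_integrable[OF _ K(1)]) (use wK in \<open>auto intro!: continuous_intros wc\<close>)
    have s01: "0 \<le> \<eta> x * G' s" "\<eta> x * G' s \<le> 1" for x s
      using \<eta>(2)[of x] G(3)[of s] mult_mono[of "\<eta> x" 1 "G' s" 1] by auto
    have wadm: "w x \<bullet> \<xi> \<le> \<phi> x \<xi>" if "x \<in> \<Omega>" for x \<xi>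
    proof -
      let ?s = "\<eta> x * G' (?ur x)"
      have "w x \<bullet> \<xi> = (1 - ?s) * (z1 x \<bullet> \<xi>) + ?s * (z2 x \<bullet> \<xi>)" by (simp add: w_def inner_add_left)
      also have "\<dots> \<le> (1 - ?s) * \<phi> x \<xi> + ?s * \<phi> x \<xi>"
        using z1 z2 that s01 by (intro add_mono mult_left_mono) (auto simp: admissible_def)
      finally show ?thesis by (simp add: algebra_simps)
    qed
    \<comment> \<open>Components of the mollified field; the factor \<open>1 / (1 + t)\<close>
      absorbs the change of \<phi> in \<open>x\<close> within distance \<open>r\<close>.\<close>
    define F where "F = (\<lambda>b x. (1 / (1 + t)) * mollify r (\<lambda>x. w x \<bullet> b) x)"
    define g where "g = (\<lambda>b x. (1 / (1 + t)) *\<^sub>R mollify_grad r (\<lambda>x. w x \<bullet> b) x)"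
    \<comment> \<open>Mollifying widens the support by \<open>r\<close>, and it stays inside
      \<Omega> because \<open>r < d1\<close>.\<close>
    define K' where "K' = {x + y |x y. x \<in> K \<and> y \<in> cball 0 r}"
    have K': "compact K'" unfolding K'_def by (rule compact_sums[OF K(1) compact_cball])
    have "K' \<subseteq> \<Omega>"
    proof
      fix x assume "x \<in> K'"
      then obtain k y where "k \<in> K" "x = k + y" "norm y \<le> r" by (auto simp: K'_def)
      then have "x \<in> ball k d1" using r by (simp add: dist_norm)
      then show "x \<in> \<Omega>" using d1(2) \<open>k \<in> K\<close> by blast
    qed
    have notK: "x - y \<notin> K" if "x \<notin> K'" "norm y < r" for x y
    proof
      assume "x - y \<in> K"
      then have "(x - y) + y \<in> K'" using that(2) unfolding K'_def by (intro CollectI exI[of _ "x - y"] exI[of _ y]) auto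
      then show False using that(1) by simp
    qed
    have F0: "F b x = 0" if "x \<notin> K'" for b x
      unfolding F_def using mollify_eq_0[OF r(1) wib[of b], of x] notK[OF that] wK by simp
    define Z where "Z = (\<lambda>x. \<Sum>b\<in>Basis. F b x *\<^sub>R b)"
    have grF: "has_C1_gradient (F b) (g b)" for b
      unfolding F_def g_def by (rule has_C1_gradient_cmult[OF has_C1_gradient_mollify[OF r(1) wib]])
    have ZC: "Z \<in> C1c \<Omega>" "divergence Z x = (\<Sum>b\<in>Basis. g b x \<bullet> b)" for x
      unfolding Z_def using C1c_I[OF grF K' \<open>K' \<subseteq> \<Omega>\<close> F0] by auto
    \<comment> \<open>Inner products commute with mollification, so the constraint can be checked
      for one \<xi> at a time, as a bound on an average.\<close>
    have Zin: "Z x \<bullet> \<xi> = (1 / (1 + t)) * mollify r (\<lambda>x. w x \<bullet> \<xi>) x" for x \<xi>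
    proof -
      have "(\<Sum>b\<in>Basis. (\<xi> \<bullet> b) * mollify r (\<lambda>x. w x \<bullet> b) x)
          = (LBINT y. (\<Sum>b\<in>Basis. (\<xi> \<bullet> b) * ((w (x - y) \<bullet> b) * mollifier r y)))"
        using mollify_integrand_integrable[OF r(1) wib]
        by (simp add: mollify_eq[OF r(1) wib] Bochner_Integration.integral_sum)
      also have "\<dots> = (LBINT y. (w (x - y) \<bullet> \<xi>) * mollifier r y)"
      proof (rule Bochner_Integration.integral_cong[OF refl])
        fix y
        have "w (x - y) \<bullet> \<xi> = (\<Sum>b\<in>Basis. (w (x - y) \<bullet> b) * (\<xi> \<bullet> b))" by (rule euclidean_inner)
        then show "(\<Sum>b\<in>Basis. (\<xi> \<bullet> b) * ((w (x - y) \<bullet> b) * mollifier r y)) = (w (x - y) \<bullet> \<xi>) * mollifier r y"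
          by (simp add: sum_distrib_left mult.commute mult.left_commute)
      qed
      also have "\<dots> = mollify r (\<lambda>x. w x \<bullet> \<xi>) x" by (simp add: mollify_eq[OF r(1) wib])
      finally have *: "(\<Sum>b\<in>Basis. (\<xi> \<bullet> b) * mollify r (\<lambda>x. w x \<bullet> b) x) = mollify r (\<lambda>x. w x \<bullet> \<xi>) x" .
      have "Z x \<bullet> \<xi> = (1 / (1 + t)) * (\<Sum>b\<in>Basis. (\<xi> \<bullet> b) * mollify r (\<lambda>x. w x \<bullet> b) x)"
        unfolding Z_def F_def inner_sum_left sum_distrib_left inner_scaleR_left
        by (intro sum.cong refl) (simp add: inner_commute)
      then show ?thesis by (simp only: *)
    qed
    have phi_nonneg: "0 \<le> \<phi> x \<xi>" if "x \<in> \<Omega>" for x \<xi>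
      using bounds[OF in_closure[OF that], of \<xi>] l by (meson mult_nonneg_nonneg norm_ge_zero order_trans less_imp_le)
    have "Z \<in> admissible \<phi> \<Omega>"
      unfolding admissible_def
    proof (intro CollectI conjI ballI allI ZC(1))
      fix x \<xi> assume x: "x \<in> \<Omega>"
      have "mollify r (\<lambda>x. w x \<bullet> \<xi>) x \<le> (1 + t) * \<phi> x \<xi>"
      proof (rule mollify_le[OF r(1) wib])
        fix y :: 'a assume y: "norm y < r"
        show "w (x - y) \<bullet> \<xi> \<le> (1 + t) * \<phi> x \<xi>"
        proof (cases "x - y \<in> K")
          case True
          then have "x - y \<in> \<Omega>" using K by auto
          then show ?thesis using wadm[of "x - y" \<xi>] d2(2)[OF x, of "x - y" \<xi>] y r by (simp add: dist_norm)
        next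
          case False then show ?thesis using wK phi_nonneg[OF x] t by simp
        qed
      qed
      then show "Z x \<bullet> \<xi> \<le> \<phi> x \<xi>" unfolding Zin using t by (simp add: field_simps)
    qed
    from V[OF this] have "(LBINT x. u x * (\<Sum>b\<in>Basis. g b x \<bullet> b)) \<le> V" by (simp add: ZC(2))
    also have "(LBINT x. u x * (\<Sum>b\<in>Basis. g b x \<bullet> b)) = (1 / (1 + t)) * (\<Sum>b\<in>Basis. (LBINT x. u x * (mollify_grad r (\<lambda>x. w x \<bullet> b) x \<bullet> b)))"
    proof -
      have "integrable lborel (\<lambda>x. u x * (mollify_grad r (\<lambda>x. w x \<bullet> b) x \<bullet> b))" for b
      proof -
        have "continuous_on UNIV (g b)" using has_C1_gradientD[OF grF] by auto
        moreover have "g b x = 0" if "x \<notin> K'" for x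
          by (rule gradient_eq_0_outside[OF grF compact_imp_closed[OF K'] F0 that])
        ultimately obtain B where B: "\<And>x. norm (g b x) \<le> B" using compact_support_bounded[OF _ K'] by metis
        have "integrable lborel (\<lambda>x. u x * (g b x \<bullet> b))"
        proof (rule integrable_mult_bounded[OF u, where B = "B * norm b"])
          show "(\<lambda>x. g b x \<bullet> b) \<in> borel_measurable lborel"
            using has_C1_gradientD(5)[OF grF] by measurable
          fix x show "\<bar>g b x \<bullet> b\<bar> \<le> B * norm b"
            using Cauchy_Schwarz_ineq2[of "g b x" b] B[of x] by (meson mult_right_mono norm_ge_zero order_trans)
        qed
        then have "integrable lborel (\<lambda>x. (1 + t) * (u x * (g b x \<bullet> b)))" by simp
        then show ?thesis using t by (simp add: g_def)
      qed
      note i = this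
      have "(LBINT x. u x * (\<Sum>b\<in>Basis. g b x \<bullet> b)) = (LBINT x. (1 / (1 + t)) * (\<Sum>b\<in>Basis. u x * (mollify_grad r (\<lambda>x. w x \<bullet> b) x \<bullet> b)))"
        by (simp add: g_def sum_distrib_left sum_divide_distrib)
      also have "\<dots> = (1 / (1 + t)) * (\<Sum>b\<in>Basis. (LBINT x. u x * (mollify_grad r (\<lambda>x. w x \<bullet> b) x \<bullet> b)))"
        using i by (subst Bochner_Integration.integral_sum[symmetric]) auto
      finally show ?thesis .
    qed
    finally have A: "(\<Sum>b\<in>Basis. (LBINT x. u x * (mollify_grad r (\<lambda>x. w x \<bullet> b) x \<bullet> b))) \<le> (1 + t) * V"
      using t by (simp add: field_simps)
    have iw: "integrable lborel (\<lambda>x. (w x \<bullet> b) * (?gr x \<bullet> b))" for b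
      by (rule compact_support_integrable[OF _ K(1)]) (use wK in \<open>auto intro!: continuous_intros wc guD\<close>)
    \<comment> \<open>Adjointness: testing \<open>u\<close> with the mollified field is the same as
      testing the mollified \<open>u\<close> with \<open>w\<close>, which is why both use one
      radius.\<close>
    have "(\<Sum>b\<in>Basis. (LBINT x. u x * (mollify_grad r (\<lambda>x. w x \<bullet> b) x \<bullet> b))) = (\<Sum>b\<in>Basis. - (LBINT x. (w x \<bullet> b) * (?gr x \<bullet> b)))"
      by (intro sum.cong refl mollify_grad_adjoint[OF r(1) u wib])
    also have "\<dots> = - (LBINT x. (\<Sum>b\<in>Basis. (w x \<bullet> b) * (?gr x \<bullet> b)))"
      using iw by (simp add: sum_negf Bochner_Integration.integral_sum)
    also have "\<dots> = - (LBINT x. w x \<bullet> ?gr x)"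
      by (simp only: euclidean_inner[symmetric])
    finally have B: "- (LBINT x. w x \<bullet> ?gr x) \<le> (1 + t) * V" using A by simp
    have gG: "has_C1_gradient (\<lambda>x. \<eta> x * G (?ur x)) (\<lambda>x. \<eta> x *\<^sub>R (G' (?ur x) *\<^sub>R ?gr x) + G (?ur x) *\<^sub>R \<eta>' x)"
      by (rule has_C1_gradient_mult[OF \<eta>(1) has_C1_gradient_compose[OF gu G(1,2)]])
    note gd = has_C1_gradient_diff[OF gu gG]
    let ?a = "\<lambda>x. ?ur x - \<eta> x * G (?ur x)" and ?b = "\<lambda>x. \<eta> x * G (?ur x)"
    let ?a' = "\<lambda>x. ?gr x - (\<eta> x *\<^sub>R (G' (?ur x) *\<^sub>R ?gr x) + G (?ur x) *\<^sub>R \<eta>' x)"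
    let ?b' = "\<lambda>x. \<eta> x *\<^sub>R (G' (?ur x) *\<^sub>R ?gr x) + G (?ur x) *\<^sub>R \<eta>' x"
    have i1: "integrable lborel (\<lambda>x. ?a x * divergence z1 x)"
      by (rule compact_support_integrable[OF continuous_on_mult[OF has_C1_gradientD(3)[OF gd] C1c_bounded_support(2)[OF C(1)]] K(1)]) (use zK in auto)
    have i2: "integrable lborel (\<lambda>x. ?b x * divergence z2 x)"
      by (rule compact_support_integrable[OF continuous_on_mult[OF has_C1_gradientD(3)[OF gG] C1c_bounded_support(2)[OF C(2)]] K(1)]) (use zK in auto)
    have i3: "integrable lborel (\<lambda>x. 2 * L * norm (\<eta>' x) * \<bar>G (?ur x)\<bar>)"
    proof (rule integrable_Lipschitz_image[OF iur, where C = "2 * L * B\<eta>" and P = "\<lambda>v x. 2 * L * norm (\<eta>' x) * \<bar>G v\<bar>"])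
      show "(\<lambda>x. 2 * L * norm (\<eta>' x) * \<bar>G (?ur x)\<bar>) \<in> borel_measurable borel"
        using guD(4) by measurable
      fix v x
      show "\<bar>2 * L * norm (\<eta>' x) * \<bar>G v\<bar>\<bar> \<le> 2 * L * B\<eta> * \<bar>v\<bar>"
      proof -
        have "norm (\<eta>' x) * \<bar>G v\<bar> \<le> B\<eta> * \<bar>v\<bar>"
          using \<eta>(3)[of x] G_le[of v] norm_ge_zero[of "\<eta>' x"] by (intro mult_mono) linarith+
        then have "2 * L * (norm (\<eta>' x) * \<bar>G v\<bar>) \<le> 2 * L * (B\<eta> * \<bar>v\<bar>)"
          using L by (intro mult_left_mono) auto
        then show ?thesis using L by (simp add: abs_mult mult.assoc)
      qed
    qed
    have i4: "integrable lborel (\<lambda>x. ?a' x \<bullet> z1 x)"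
      by (rule compact_support_integrable[OF continuous_on_inner[OF has_C1_gradientD(2)[OF gd] C1c_bounded_support(1)[OF C(1)]] K(1)]) (use zK in auto)
    have i5: "integrable lborel (\<lambda>x. ?b' x \<bullet> z2 x)"
      by (rule compact_support_integrable[OF continuous_on_inner[OF has_C1_gradientD(2)[OF gG] C1c_bounded_support(1)[OF C(2)]] K(1)]) (use zK in auto)
    have i6: "integrable lborel (\<lambda>x. w x \<bullet> ?gr x)"
      by (rule compact_support_integrable[OF _ K(1)]) (use wK in \<open>auto intro!: continuous_intros wc guD\<close>)
    have "(LBINT x. ?a x * divergence z1 x + ?b x * divergence z2 x - 2 * L * norm (\<eta>' x) * \<bar>G (?ur x)\<bar>)
      = (LBINT x. - (?a' x \<bullet> z1 x) - ?b' x \<bullet> z2 x - 2 * L * norm (\<eta>' x) * \<bar>G (?ur x)\<bar>)"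
    proof -
      have "(LBINT x. ?a x * divergence z1 x + ?b x * divergence z2 x - 2 * L * norm (\<eta>' x) * \<bar>G (?ur x)\<bar>)
        = (LBINT x. ?a x * divergence z1 x) + (LBINT x. ?b x * divergence z2 x) - (LBINT x. 2 * L * norm (\<eta>' x) * \<bar>G (?ur x)\<bar>)"
        using i1 i2 i3 by (simp del: integral_mult_right_zero integral_mult_left_zero)
      also have "\<dots> = - (LBINT x. ?a' x \<bullet> z1 x) - (LBINT x. ?b' x \<bullet> z2 x) - (LBINT x. 2 * L * norm (\<eta>' x) * \<bar>G (?ur x)\<bar>)"
        unfolding integration_by_parts[OF gd C(1)] integration_by_parts[OF gG C(2)] by simp
      also have "\<dots> = (LBINT x. - (?a' x \<bullet> z1 x) - ?b' x \<bullet> z2 x - 2 * L * norm (\<eta>' x) * \<bar>G (?ur x)\<bar>)"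
      proof -
        have m: "(LBINT x. - p x - q x - s x) = - (LBINT x. p x) - (LBINT x. q x) - (LBINT x. s x)"
          if "integrable lborel p" "integrable lborel q" "integrable lborel s" for p q s :: "'a \<Rightarrow> real"
          using that by simp
        show ?thesis by (rule m[OF i4 i5 i3, symmetric])
      qed
      finally show ?thesis .
    qed
    also have "\<dots> \<le> (LBINT x. - (w x \<bullet> ?gr x))"
    proof (rule integral_mono)
      show "integrable lborel (\<lambda>x. - (?a' x \<bullet> z1 x) - ?b' x \<bullet> z2 x - 2 * L * norm (\<eta>' x) * \<bar>G (?ur x)\<bar>)"
        by (intro Bochner_Integration.integrable_diff Bochner_Integration.integrable_minus i4 i5 i3)
      show "integrable lborel (\<lambda>x. - (w x \<bullet> ?gr x))" using i6 by simp
      fix x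
      \<comment> \<open>The gradient of the cutoff is paired with \<open>z1 - z2\<close>; this is
        the source of the constant \<open>2 * L\<close>.\<close>
      have "norm (z1 x - z2 x) \<le> 2 * L"
        using norm_triangle_ineq4[of "z1 x" "z2 x"] admissible_norm[OF z1, of x] admissible_norm[OF z2, of x] by linarith
      then have "norm (\<eta>' x) * norm (z1 x - z2 x) \<le> norm (\<eta>' x) * (2 * L)" by (intro mult_left_mono) auto
      then have "\<bar>\<eta>' x \<bullet> (z1 x - z2 x)\<bar> \<le> norm (\<eta>' x) * (2 * L)"
        using Cauchy_Schwarz_ineq2[of "\<eta>' x" "z1 x - z2 x"] by linarith
      then have "\<bar>G (?ur x)\<bar> * \<bar>\<eta>' x \<bullet> (z1 x - z2 x)\<bar> \<le> \<bar>G (?ur x)\<bar> * (norm (\<eta>' x) * (2 * L))"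
        by (intro mult_left_mono) auto
      then have "G (?ur x) * (\<eta>' x \<bullet> (z1 x - z2 x)) \<le> 2 * L * norm (\<eta>' x) * \<bar>G (?ur x)\<bar>"
        unfolding abs_mult[symmetric] by (simp add: mult_ac)
      moreover have "- (?a' x \<bullet> z1 x) - ?b' x \<bullet> z2 x = - (w x \<bullet> ?gr x) + G (?ur x) * (\<eta>' x \<bullet> (z1 x - z2 x))"
        by (simp add: w_def inner_simps inner_commute algebra_simps)
      ultimately show "- (?a' x \<bullet> z1 x) - ?b' x \<bullet> z2 x - 2 * L * norm (\<eta>' x) * \<bar>G (?ur x)\<bar> \<le> - (w x \<bullet> ?gr x)"
        by linarith
    qed
    also have "\<dots> \<le> (1 + t) * V" using B by simp
    finally show ?thesis .
  qed
  then show ?thesis using d1(1) d2(1) by (intro exI[of _ "min d1 d2"]) auto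
qed

end

context truncation
begin

text \<open>Let the mollification radius tend to 0. The integrand is Lipschitz in the value of the
  function, with one constant for all \<open>x\<close>, so convergence of \<open>mollify r u\<close>
  to \<open>u\<close> in L1 suffices and no gradient has to converge.\<close>

lemma truncation_bound:
  assumes V: "\<And>z. z \<in> admissible \<phi> \<Omega> \<Longrightarrow> (LBINT x. u x * divergence z x) \<le> V"
    and u: "integrable lborel u"
    and z1: "z1 \<in> admissible \<phi> \<Omega>" and z2: "z2 \<in> admissible \<phi> \<Omega>"
  shows "(LBINT x. (u x - \<eta> x * G (u x)) * divergence z1 x) + (LBINT x. \<eta> x * G (u x) * divergence z2 x)
      \<le> V + 2 * L * (LBINT x. norm (\<eta>' x) * \<bar>G (u x)\<bar>)"
proof -
  have C: "z1 \<in> C1c \<Omega>" "z2 \<in> C1c \<Omega>" using z1 z2 by (auto simp: admissible_def)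
  obtain B1 where B1: "B1 > 0" "\<And>x. \<bar>divergence z1 x\<bar> \<le> B1" using C1c_bounded_support(4)[OF C(1)] by blast
  obtain B2 where B2: "B2 > 0" "\<And>x. \<bar>divergence z2 x\<bar> \<le> B2" using C1c_bounded_support(4)[OF C(2)] by blast
  have B\<eta>: "0 \<le> B\<eta>" using \<eta>(3)[of 0] norm_ge_zero order_trans by blast
  note [measurable] = integrable_lborel_borel[OF u]
  have [measurable]: "divergence z1 \<in> borel_measurable borel" "divergence z2 \<in> borel_measurable borel"
    using C1c_bounded_support(2)[OF C(1)] C1c_bounded_support(2)[OF C(2)] borel_measurable_continuous_UNIV by auto
  let ?P1 = "\<lambda>v x. (v - \<eta> x * G v) * divergence z1 x"
  let ?P2 = "\<lambda>v x. \<eta> x * G v * divergence z2 x"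
  let ?P3 = "\<lambda>v x. 2 * L * norm (\<eta>' x) * \<bar>G v\<bar>"
  let ?P = "\<lambda>v x. ?P1 v x + ?P2 v x - ?P3 v x"
  define M where "M = 2 * B1 + B2 + 2 * L * B\<eta>"
  have M: "M > 0" using B1 B2 L B\<eta> by (auto simp: M_def intro!: add_pos_nonneg)
  have eG: "\<bar>\<eta> x * G v - \<eta> x * G v'\<bar> \<le> \<bar>v - v'\<bar>" for x v v'
    using G_Lipschitz[of v v'] \<eta>(2)[of x] mult_mono[of "\<eta> x" 1 "\<bar>G v - G v'\<bar>" "\<bar>v - v'\<bar>"]
    unfolding right_diff_distrib[symmetric] by (simp add: abs_mult)
  have L1: "\<bar>?P1 v x - ?P1 v' x\<bar> \<le> 2 * B1 * \<bar>v - v'\<bar>" for v v' x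
  proof -
    have "\<bar>?P1 v x - ?P1 v' x\<bar> = \<bar>(v - v') - (\<eta> x * G v - \<eta> x * G v')\<bar> * \<bar>divergence z1 x\<bar>"
      unfolding abs_mult[symmetric] by (simp add: algebra_simps)
    also have "\<dots> \<le> (2 * \<bar>v - v'\<bar>) * B1"
      using abs_triangle_ineq4[of "v - v'" "\<eta> x * G v - \<eta> x * G v'"] eG[of x v v'] B1(2)[of x]
      by (intro mult_mono) simp_all
    finally show ?thesis by (simp add: mult_ac)
  qed
  have L2: "\<bar>?P2 v x - ?P2 v' x\<bar> \<le> B2 * \<bar>v - v'\<bar>" for v v' x
  proof -
    have "\<bar>?P2 v x - ?P2 v' x\<bar> = \<bar>\<eta> x * G v - \<eta> x * G v'\<bar> * \<bar>divergence z2 x\<bar>"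
      unfolding abs_mult[symmetric] by (simp add: algebra_simps)
    also have "\<dots> \<le> \<bar>v - v'\<bar> * B2"
      using eG[of x v v'] B2(2)[of x] by (intro mult_mono) auto
    finally show ?thesis by (simp add: mult_ac)
  qed
  have L3: "\<bar>?P3 v x - ?P3 v' x\<bar> \<le> 2 * L * B\<eta> * \<bar>v - v'\<bar>" for v v' x
  proof -
    have "\<bar>?P3 v x - ?P3 v' x\<bar> = (2 * L * norm (\<eta>' x)) * \<bar>\<bar>G v\<bar> - \<bar>G v'\<bar>\<bar>"
      unfolding right_diff_distrib[symmetric] abs_mult using L by simp
    also have "\<dots> \<le> (2 * L * B\<eta>) * \<bar>v - v'\<bar>"
      using G_Lipschitz[of v v'] \<eta>(3)[of x] L B\<eta> by (intro mult_mono) auto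
    finally show ?thesis .
  qed
  have LP: "\<bar>?P v x - ?P v' x\<bar> \<le> M * \<bar>v - v'\<bar>" for v v' x
  proof -
    have tri: "\<bar>(p + q - s) - (p' + q' - s')\<bar> \<le> A + B + C"
      if "\<bar>p - p'\<bar> \<le> A" "\<bar>q - q'\<bar> \<le> B" "\<bar>s - s'\<bar> \<le> C" for p q s p' q' s' A B C :: real
      using that by linarith
    show ?thesis unfolding M_def distrib_right by (rule tri[OF L1 L2 L3])
  qed
  have i1: "integrable lborel (\<lambda>x. ?P1 (u x) x)"
    by (rule integrable_Lipschitz_image[OF u, where P = ?P1 and C = "2 * B1"]) (use L1[of _ _ 0] G(4) in \<open>simp_all\<close>)
  have i2: "integrable lborel (\<lambda>x. ?P2 (u x) x)"
    by (rule integrable_Lipschitz_image[OF u, where P = ?P2 and C = B2]) (use L2[of _ _ 0] G(4) in \<open>simp_all\<close>)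
  have i3: "integrable lborel (\<lambda>x. ?P3 (u x) x)"
    by (rule integrable_Lipschitz_image[OF u, where P = ?P3 and C = "2 * L * B\<eta>"]) (use L3[of _ _ 0] G(4) in \<open>simp_all\<close>)
  have iP: "integrable lborel (\<lambda>x. ?P (u x) x)"
    by (intro Bochner_Integration.integrable_diff Bochner_Integration.integrable_add i1 i2 i3)
  have "(LBINT x. ?P (u x) x) \<le> V"
  proof (rule field_le_epsilon)
    fix e :: real assume e: "e > 0"
    \<comment> \<open>The same \<open>t\<close> serves as relative oscillation of \<phi> and as L1
      error; the two errors \<open>t * V\<close> and \<open>M * t\<close> add up to at most
      \<open>e\<close>.\<close>
    define t where "t = e / (\<bar>V\<bar> + M)"
    have t: "t > 0" using e M by (simp add: t_def add_nonneg_pos)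
    obtain d1 where d1: "d1 > 0" "\<And>r. 0 < r \<Longrightarrow> r < d1 \<Longrightarrow> integrable lborel (mollify r u) \<Longrightarrow> (LBINT x. ?P (mollify r u x) x) \<le> (1 + t) * V"
      using truncation_mollified[OF V u z1 z2 t] by blast
    obtain d2 where d2: "d2 > 0" "\<And>r. 0 < r \<Longrightarrow> r < d2 \<Longrightarrow>
      integrable lborel (mollify r u) \<and> (LBINT x. \<bar>mollify r u x - u x\<bar>) \<le> t"
      using mollify_L1_limit[OF u t] by metis
    define r where "r = min d1 d2 / 2"
    have r: "0 < r" "r < d1" "r < d2" using d1(1) d2(1) by (auto simp: r_def)
    let ?v = "mollify r u"
    have iv: "integrable lborel ?v" and dv: "(LBINT x. \<bar>?v x - u x\<bar>) \<le> t" using d2(2)[OF r(1,3)] by auto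
    note [measurable] = integrable_lborel_borel[OF iv]
    have iPv: "integrable lborel (\<lambda>x. ?P (?v x) x)"
    proof (rule integrable_Lipschitz_image[OF iv, where P = ?P and C = M])
      show "(\<lambda>x. ?P (?v x) x) \<in> borel_measurable borel" by measurable
      show "\<bar>?P v x\<bar> \<le> M * \<bar>v\<bar>" for v x using LP[of v x 0] G(4) by simp
    qed
    have "(LBINT x. ?P (u x) x) \<le> (LBINT x. ?P (?v x) x + M * \<bar>?v x - u x\<bar>)"
    proof (rule integral_mono[OF iP])
      show "integrable lborel (\<lambda>x. ?P (?v x) x + M * \<bar>?v x - u x\<bar>)"
        using iPv iv u by (intro Bochner_Integration.integrable_add) auto
      show "?P (u x) x \<le> ?P (?v x) x + M * \<bar>?v x - u x\<bar>" for x
      proof -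
        have ab: "p \<le> q + M * \<bar>s - s'\<bar>" if "\<bar>p - q\<bar> \<le> M * \<bar>s' - s\<bar>" for p q s s' :: real
          by (metis abs_le_D1 abs_minus_commute add.commute diff_le_eq that)
        show ?thesis by (rule ab[OF LP])
      qed
    qed
    also have "\<dots> = (LBINT x. ?P (?v x) x) + M * (LBINT x. \<bar>?v x - u x\<bar>)"
      by (subst Bochner_Integration.integral_add) (use iPv iv u in auto)
    also have "\<dots> \<le> (1 + t) * V + M * t"
      using d1(2)[OF r(1,2) iv] dv M by (intro add_mono mult_left_mono) auto
    also have "\<dots> = V + t * (V + M)" by (simp add: algebra_simps)
    also have "\<dots> \<le> V + t * (\<bar>V\<bar> + M)" using t by (intro add_mono mult_left_mono) auto
    also have "t * (\<bar>V\<bar> + M) = e" using M by (simp add: t_def add_nonneg_pos less_imp_neq[symmetric] abs_add_one_gt_zero)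
    finally show "(LBINT x. ?P (u x) x) \<le> V + e" .
  qed
  moreover have "(LBINT x. ?P (u x) x) = (LBINT x. ?P1 (u x) x) + (LBINT x. ?P2 (u x) x) - (LBINT x. ?P3 (u x) x)"
    using Bochner_Integration.integral_diff[OF Bochner_Integration.integrable_add[OF i1 i2] i3] Bochner_Integration.integral_add[OF i1 i2] by simp
  moreover have "(LBINT x. ?P3 (u x) x) = 2 * L * (LBINT x. norm (\<eta>' x) * \<bar>G (u x)\<bar>)"
    by (subst integral_mult_right_zero[symmetric]) (simp add: mult.assoc)
  ultimately show ?thesis by simp
qed

end

text \<open>\<open>u0\<close> is a Borel representative of \<open>u\<close>, so that all integrals are over \<^term>\<open>lborel\<close>.\<close>

definition zero_extension :: "'a::euclidean_space set \<Rightarrow> ('a \<Rightarrow> real) \<Rightarrow> ('a \<Rightarrow> real) \<Rightarrow> bool" where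
  "zero_extension \<Omega> u u0 \<longleftrightarrow> set_integrable lebesgue \<Omega> u \<and> integrable lborel u0 \<and>
     (AE x in lebesgue. x \<in> \<Omega> \<longrightarrow> u x = u0 x) \<and> (\<forall>x. x \<notin> \<Omega> \<longrightarrow> u0 x = 0)"

lemma zero_extension_exists:
  assumes "open \<Omega>" "set_integrable lebesgue \<Omega> u"
  obtains u0 where "zero_extension \<Omega> u u0"
proof -
  have i: "integrable lebesgue (\<lambda>x. indicator \<Omega> x *\<^sub>R u x)" using assms(2) by (simp add: set_integrable_def)
  then have "(\<lambda>x. indicator \<Omega> x *\<^sub>R u x) \<in> borel_measurable lebesgue" by (rule borel_measurable_integrable)
  from completion_ex_borel_measurable_real[OF this]
  obtain g where g: "g \<in> borel_measurable lborel" "AE x in lborel. indicator \<Omega> x *\<^sub>R u x = g x" by blast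
  have [measurable]: "\<Omega> \<in> sets borel" "g \<in> borel_measurable borel" using assms(1) g by auto
  define u0 where "u0 = (\<lambda>x. indicator \<Omega> x * g x)"
  have u0m: "u0 \<in> borel_measurable lborel" unfolding u0_def by measurable
  have ae: "AE x in lebesgue. indicator \<Omega> x *\<^sub>R u x = u0 x"
    using AE_completion[OF g(2)] by eventually_elim (auto simp: u0_def indicator_def split: if_splits)
  have u0m': "u0 \<in> borel_measurable lebesgue" using u0m by (rule measurable_completion)
  have "integrable lebesgue u0"
    using integrable_cong_AE[OF borel_measurable_integrable[OF i] u0m' ae] i by simp
  then have "integrable lborel u0" using integrable_completion[OF u0m] by simp
  moreover have "AE x in lebesgue. x \<in> \<Omega> \<longrightarrow> u x = u0 x"
    using ae by eventually_elim auto
  moreover have "\<forall>x. x \<notin> \<Omega> \<longrightarrow> u0 x = 0" by (simp add: u0_def)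
  ultimately show ?thesis using that assms(2) unfolding zero_extension_def by blast
qed

lemma set_integral_zero_extension:
  assumes "open \<Omega>" and u: "zero_extension \<Omega> u u0" and d: "d \<in> borel_measurable borel"
  shows "(LINT x:\<Omega>|lebesgue. u x * d x) = (LBINT x. u0 x * d x)"
proof -
  have [measurable]: "u0 \<in> borel_measurable borel" "d \<in> borel_measurable borel"
    using u d integrable_lborel_borel by (auto simp: zero_extension_def)
  have um: "(\<lambda>x. indicator \<Omega> x *\<^sub>R u x) \<in> borel_measurable lebesgue"
    using u by (auto simp: zero_extension_def set_integrable_def)
  have dm: "d \<in> borel_measurable lebesgue" by (rule measurable_completion) (use d in simp)
  have m: "(\<lambda>x. u0 x * d x) \<in> borel_measurable lborel" by measurable
  have "(LINT x:\<Omega>|lebesgue. u x * d x) = (\<integral>x. u0 x * d x \<partial>lebesgue)"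
    unfolding set_lebesgue_integral_def
  proof (rule integral_cong_AE)
    have "(\<lambda>x. (indicator \<Omega> x *\<^sub>R u x) * d x) \<in> borel_measurable lebesgue"
      using um dm by (rule borel_measurable_times)
    then show "(\<lambda>x. indicator \<Omega> x *\<^sub>R (u x * d x)) \<in> borel_measurable lebesgue" by (simp add: mult.assoc)
    show "(\<lambda>x. u0 x * d x) \<in> borel_measurable lebesgue" using m by (rule measurable_completion)
    have "AE x in lebesgue. x \<in> \<Omega> \<longrightarrow> u x = u0 x" using u by (simp add: zero_extension_def)
    then show "AE x in lebesgue. indicator \<Omega> x *\<^sub>R (u x * d x) = u0 x * d x"
      by eventually_elim (use u in \<open>auto simp: zero_extension_def indicator_def\<close>)
  qed
  also have "\<dots> = (LBINT x. u0 x * d x)" using integral_completion[OF m] by simp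
  finally show ?thesis .
qed

section \<open>The dual constraint and the variation as a supremum over admissible fields\<close>

lemma metric_integrandD:
  assumes "metric_integrand \<Omega> \<phi>"
  obtains l L where "l > 0" "L > 0"
    "\<And>x \<xi>. x \<in> closure \<Omega> \<Longrightarrow> l * norm \<xi> \<le> \<phi> x \<xi> \<and> \<phi> x \<xi> \<le> L * norm \<xi>"
  using assms unfolding metric_integrand_def by blast

text \<open>By homogeneity every nonzero \<xi> can be rescaled to \<open>\<phi> x \<xi> = 1\<close>.
  The lower bound \<open>l\<close> makes the set under the supremum bounded, so that
  \<open>Sup\<close> is meaningful.\<close>

lemma polar_integrand_le_1_iff:
  assumes \<phi>: "metric_integrand \<Omega> \<phi>" and x: "x \<in> closure \<Omega>"
  shows "polar_integrand \<phi> x \<zeta> \<le> 1 \<longleftrightarrow> (\<forall>\<xi>. \<zeta> \<bullet> \<xi> \<le> \<phi> x \<xi>)"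
proof -
  obtain l L where l: "l > 0" "\<And>\<xi>. l * norm \<xi> \<le> \<phi> x \<xi>" using metric_integrandD[OF \<phi>] x by metis
  have hom: "\<phi> x (t *\<^sub>R \<xi>) = \<bar>t\<bar> * \<phi> x \<xi>" for t \<xi> using \<phi> x by (auto simp: metric_integrand_def)
  let ?S = "{\<zeta> \<bullet> \<xi> |\<xi>. \<phi> x \<xi> \<le> 1}"
  have ne: "?S \<noteq> {}" using hom[of 0 0] by (auto intro!: exI[of _ 0])
  have bdd: "bdd_above ?S"
  proof (rule bdd_aboveI[of _ "norm \<zeta> * (1 / l)"])
    fix y assume "y \<in> ?S"
    then obtain \<xi> where \<xi>: "y = \<zeta> \<bullet> \<xi>" "\<phi> x \<xi> \<le> 1" by blast
    have "norm \<xi> \<le> 1 / l" using l(2)[of \<xi>] \<xi>(2) l(1) by (simp add: field_simps)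
    then show "y \<le> norm \<zeta> * (1 / l)" using norm_cauchy_schwarz[of \<zeta> \<xi>] \<xi>(1) by (meson mult_left_mono norm_ge_zero order_trans)
  qed
  have "polar_integrand \<phi> x \<zeta> \<le> 1 \<longleftrightarrow> (\<forall>\<xi>. \<phi> x \<xi> \<le> 1 \<longrightarrow> \<zeta> \<bullet> \<xi> \<le> 1)"
    unfolding polar_integrand_def cSup_le_iff[OF ne bdd] by blast
  also have "\<dots> \<longleftrightarrow> (\<forall>\<xi>. \<zeta> \<bullet> \<xi> \<le> \<phi> x \<xi>)"
  proof (intro iffI allI impI)
    fix \<xi> assume *: "\<forall>\<xi>. \<phi> x \<xi> \<le> 1 \<longrightarrow> \<zeta> \<bullet> \<xi> \<le> 1"
    show "\<zeta> \<bullet> \<xi> \<le> \<phi> x \<xi>"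
    proof (cases "\<xi> = 0")
      case True then show ?thesis using hom[of 0 0] by simp
    next
      case False
      then have "l * norm \<xi> > 0" using l by simp
      then have p: "\<phi> x \<xi> > 0" using l(2)[of \<xi>] by linarith
      have "\<phi> x ((1 / \<phi> x \<xi>) *\<^sub>R \<xi>) \<le> 1" using hom[of "1 / \<phi> x \<xi>" \<xi>] p by simp
      then have "\<zeta> \<bullet> ((1 / \<phi> x \<xi>) *\<^sub>R \<xi>) \<le> 1" using * by blast
      then show ?thesis using p by (simp add: field_simps)
    qed
  next
    fix \<xi> assume "\<forall>\<xi>. \<zeta> \<bullet> \<xi> \<le> \<phi> x \<xi>" "\<phi> x \<xi> \<le> 1"
    then show "\<zeta> \<bullet> \<xi> \<le> 1" using order_trans by blast
  qed
  finally show ?thesis .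
qed

text \<open>For fixed \<xi> the points of \<Omega> violating the inequality form an open set, by
  continuity. An open null set is empty.\<close>

lemma admissible_iff:
  assumes "open \<Omega>" and \<phi>: "metric_integrand \<Omega> \<phi>" and z: "z \<in> C1c \<Omega>"
  shows "(AE x in lebesgue. x \<in> \<Omega> \<longrightarrow> polar_integrand \<phi> x (z x) \<le> 1) \<longleftrightarrow> z \<in> admissible \<phi> \<Omega>"
proof -
  have pol: "polar_integrand \<phi> x (z x) \<le> 1 \<longleftrightarrow> (\<forall>\<xi>. z x \<bullet> \<xi> \<le> \<phi> x \<xi>)" if "x \<in> \<Omega>" for x
    using polar_integrand_le_1_iff[OF \<phi>, of x] that closure_subset by blast
  show ?thesis
  proof
    assume ae: "AE x in lebesgue. x \<in> \<Omega> \<longrightarrow> polar_integrand \<phi> x (z x) \<le> 1"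
    have "z x \<bullet> \<xi> \<le> \<phi> x \<xi>" if x: "x \<in> \<Omega>" for x \<xi>
    proof (rule ccontr)
      assume n: "\<not> z x \<bullet> \<xi> \<le> \<phi> x \<xi>"
      define U where "U = {x \<in> \<Omega>. z x \<bullet> \<xi> - \<phi> x \<xi> \<in> {0<..}}"
      have c: "continuous_on \<Omega> (\<lambda>x. \<phi> x \<xi>)"
      proof -
        have "continuous_on (closure \<Omega> \<times> UNIV) (\<lambda>(x, \<xi>). \<phi> x \<xi>)" using \<phi> by (simp add: metric_integrand_def)
        then have "continuous_on \<Omega> (\<lambda>x. (\<lambda>(x, \<xi>). \<phi> x \<xi>) (x, \<xi>))"
          by (rule continuous_on_compose2) (use closure_subset in \<open>auto intro!: continuous_intros\<close>)
        then show ?thesis by simp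
      qed
      have "continuous_on \<Omega> (\<lambda>x. z x \<bullet> \<xi> - \<phi> x \<xi>)"
        by (intro continuous_intros c continuous_on_subset[OF C1c_bounded_support(1)[OF z]]) auto
      then have "open ((\<lambda>x. z x \<bullet> \<xi> - \<phi> x \<xi>) -` {0<..} \<inter> \<Omega>)"
        using assms(1) by (simp add: continuous_on_open_vimage)
      moreover have "(\<lambda>x. z x \<bullet> \<xi> - \<phi> x \<xi>) -` {0<..} \<inter> \<Omega> = U" by (auto simp: U_def)
      ultimately have "open U" by simp
      moreover have "x \<in> U" using x n by (simp add: U_def)
      moreover have "negligible U"
      proof -
        have "AE x in lebesgue. x \<notin> U"
          using ae
        proof eventually_elim
          case (elim x)
          show "x \<notin> U"
          proof
            assume "x \<in> U"
            then have "x \<in> \<Omega>" "\<phi> x \<xi> < z x \<bullet> \<xi>" by (auto simp: U_def)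
            then show False using elim pol[of x] by (meson not_le)
          qed
        qed
        moreover have "U \<in> sets lebesgue" using \<open>open U\<close> by simp
        ultimately show ?thesis by (simp add: negligible_iff_null_sets AE_iff_null_sets)
      qed
      ultimately show False using open_not_negligible by blast
    qed
    then show "z \<in> admissible \<phi> \<Omega>" using z by (simp add: admissible_def)
  next
    assume "z \<in> admissible \<phi> \<Omega>"
    then show "AE x in lebesgue. x \<in> \<Omega> \<longrightarrow> polar_integrand \<phi> x (z x) \<le> 1"
      using pol by (auto simp: admissible_def)
  qed
qed

lemma phi_variation_eq:
  assumes "open \<Omega>" "metric_integrand \<Omega> \<phi>" "zero_extension \<Omega> u u0"
  shows "phi_variation \<phi> \<Omega> u = (SUP z\<in>admissible \<phi> \<Omega>. ereal (LBINT x. u0 x * divergence z x))"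
proof -
  have "{z \<in> C1c \<Omega>. AE x in lebesgue. x \<in> \<Omega> \<longrightarrow> polar_integrand \<phi> x (z x) \<le> 1} = admissible \<phi> \<Omega>"
    using admissible_iff[OF assms(1,2)] by (auto simp: admissible_def)
  moreover have "(LINT x:\<Omega>|lebesgue. u x * divergence z x) = (LBINT x. u0 x * divergence z x)" if "z \<in> admissible \<phi> \<Omega>" for z
    using that C1c_bounded_support(2)[of z \<Omega>]
    by (intro set_integral_zero_extension[OF assms(1,3)] borel_measurable_continuous_UNIV) (auto simp: admissible_def)
  ultimately show ?thesis unfolding phi_variation_def by (intro SUP_cong) auto
qed

text \<open>Minimality against \<open>u - \<eta> G(u)\<close> cancels the variation of
  \<open>u\<close> in \<open>truncation_bound\<close> and leaves only the boundary layer term. The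
  constant is independent of the cutoff, of \<open>G\<close> and of the test field, so all of these
  may depend on the level.\<close>

lemma least_gradient_truncation:
  assumes \<Omega>: "open \<Omega>" "bounded \<Omega>" and \<phi>: "metric_integrand \<Omega> \<phi>"
    and lg: "phi_least_gradient \<phi> \<Omega> u" and u0: "zero_extension \<Omega> u u0"
  obtains C where "C > 0" "\<And>\<eta> \<eta>' B G G' K z. has_C1_gradient \<eta> \<eta>' \<Longrightarrow> (\<And>x. 0 \<le> \<eta> x \<and> \<eta> x \<le> 1) \<Longrightarrow> (\<And>x. norm (\<eta>' x) \<le> B) \<Longrightarrow>
      (\<And>t. (G has_real_derivative G' t) (at t)) \<Longrightarrow> continuous_on UNIV G' \<Longrightarrow> (\<And>t. 0 \<le> G' t \<and> G' t \<le> 1) \<Longrightarrow> G 0 = 0 \<Longrightarrow>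
      compact K \<Longrightarrow> K \<subseteq> \<Omega> \<Longrightarrow> (\<And>x. x \<in> \<Omega> - K \<Longrightarrow> \<eta> x = 0) \<Longrightarrow>
      z \<in> C1c \<Omega> \<Longrightarrow> (\<And>x. norm (z x) \<le> 1) \<Longrightarrow>
      (LBINT x. \<eta> x * G (u0 x) * divergence z x) \<le> C * (LBINT x. norm (\<eta>' x) * \<bar>G (u0 x)\<bar>)"
proof -
  obtain l L where lL: "l > 0" "L > 0"
    "\<And>x \<xi>. x \<in> closure \<Omega> \<Longrightarrow> l * norm \<xi> \<le> \<phi> x \<xi> \<and> \<phi> x \<xi> \<le> L * norm \<xi>"
    using metric_integrandD[OF \<phi>] by metis
  have iu0: "integrable lborel u0" and iu: "set_integrable lebesgue \<Omega> u"
    and ae: "AE x in lebesgue. x \<in> \<Omega> \<longrightarrow> u x = u0 x" and u00: "\<And>x. x \<notin> \<Omega> \<Longrightarrow> u0 x = 0"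
    using u0 by (auto simp: zero_extension_def)
  note [measurable] = integrable_lborel_borel[OF iu0]
  have \<Omega>m [measurable]: "\<Omega> \<in> sets borel" using \<Omega> by simp
  have zadm: "(\<lambda>x. 0) \<in> admissible \<phi> \<Omega>"
  proof -
    have "0 \<le> \<phi> x \<xi>" if "x \<in> \<Omega>" for x \<xi>
      using \<phi> that closure_subset by (auto simp: metric_integrand_def)
    then show ?thesis by (simp add: admissible_def C1c_zero)
  qed
  have pv: "phi_variation \<phi> \<Omega> u = (SUP z\<in>admissible \<phi> \<Omega>. ereal (LBINT x. u0 x * divergence z x))"
    by (rule phi_variation_eq[OF \<Omega>(1) \<phi> u0])
  have "phi_variation \<phi> \<Omega> u < \<infinity>" using lg by (simp add: phi_least_gradient_def BV_phi_def)
  moreover have "ereal 0 \<le> phi_variation \<phi> \<Omega> u"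
    unfolding pv by (rule SUP_upper2[OF zadm]) (simp add: divergence_zero)
  ultimately obtain V where V: "phi_variation \<phi> \<Omega> u = ereal V"
    by (cases "phi_variation \<phi> \<Omega> u") auto
  have Vub: "(LBINT x. u0 x * divergence z x) \<le> V" if "z \<in> admissible \<phi> \<Omega>" for z
    using SUP_upper[OF that, of "\<lambda>z. ereal (LBINT x. u0 x * divergence z x)"] V pv by simp
  show ?thesis
  proof (rule that[of "2 * L / l"])
    show "2 * L / l > 0" using lL by simp
    fix \<eta> :: "'a \<Rightarrow> real" and \<eta>' B G G' K z
    assume \<eta>: "has_C1_gradient \<eta> \<eta>'" "\<And>x. 0 \<le> \<eta> x \<and> \<eta> x \<le> 1" "\<And>x. norm (\<eta>' x) \<le> B"
      and G: "\<And>t. (G has_real_derivative G' t) (at t)" "continuous_on UNIV G'" "\<And>t. 0 \<le> G' t \<and> G' t \<le> 1" "G 0 = 0"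
      and K: "compact K" "K \<subseteq> \<Omega>" "\<And>x. x \<in> \<Omega> - K \<Longrightarrow> \<eta> x = 0"
      and z: "z \<in> C1c \<Omega>" "\<And>x. norm (z x) \<le> 1"
    interpret truncation \<Omega> \<phi> l L \<eta> \<eta>' B G G'
      by unfold_locales (use \<Omega> \<phi> lL \<eta> G in \<open>auto simp: metric_integrand_def\<close>)
    define R where "R = 2 * L * (LBINT x. norm (\<eta>' x) * \<bar>G (u0 x)\<bar>)"
    define h where "h = (\<lambda>x. \<eta> x * G (u0 x))"
    have hm [measurable]: "h \<in> borel_measurable borel" unfolding h_def by measurable
    have ih: "integrable lborel h"
      unfolding h_def
    proof (rule integrable_Lipschitz_image[OF iu0, where P = "\<lambda>v x. \<eta> x * G v" and C = 1])
      fix v x show "\<bar>\<eta> x * G v\<bar> \<le> 1 * \<bar>v\<bar>"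
        using \<eta>(2)[of x] G_le[of v] mult_mono[of "\<eta> x" 1 "\<bar>G v\<bar>" "\<bar>v\<bar>"] by (simp add: abs_mult)
    qed measurable
    have h0: "x \<notin> \<Omega> \<Longrightarrow> h x = 0" for x using u00 G(4) by (simp add: h_def)
    have bnd: "(LBINT x. (u0 x - h x) * divergence z1 x) + (LBINT x. h x * divergence z2 x) \<le> V + R"
      if "z1 \<in> admissible \<phi> \<Omega>" "z2 \<in> admissible \<phi> \<Omega>" for z1 z2
      unfolding h_def R_def by (rule truncation_bound[OF Vub iu0 that])
    have set_int: "set_integrable lebesgue \<Omega> g" if "integrable lborel g" "\<And>x. x \<notin> \<Omega> \<Longrightarrow> g x = 0" for g :: "'a \<Rightarrow> real"
    proof -
      have "integrable lebesgue g" using that(1) integrable_completion[of g lborel] by auto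
      moreover have "(\<lambda>x. indicator \<Omega> x *\<^sub>R g x) = g" using that(2) by (auto simp: indicator_def fun_eq_iff)
      ultimately show ?thesis by (simp add: set_integrable_def)
    qed
    have zeh: "zero_extension \<Omega> (\<lambda>x. - h x) (\<lambda>x. - h x)"
      unfolding zero_extension_def using ih h0 by (auto intro!: set_int)
    have zeuh: "zero_extension \<Omega> (\<lambda>x. u x + - h x) (\<lambda>x. u0 x - h x)"
      unfolding zero_extension_def
    proof (intro conjI)
      show "set_integrable lebesgue \<Omega> (\<lambda>x. u x + - h x)"
        by (rule set_integral_add(1)[OF iu set_int]) (use ih h0 in auto)
      show "integrable lborel (\<lambda>x. u0 x - h x)" using iu0 ih by simp
      show "AE x in lebesgue. x \<in> \<Omega> \<longrightarrow> u x + - h x = u0 x - h x" using ae by eventually_elim simp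
      show "\<forall>x. x \<notin> \<Omega> \<longrightarrow> u0 x - h x = 0" using u00 h0 by simp
    qed
    \<comment> \<open>The perturbation of \<open>u\<close> is \<open>- h\<close>, so bounding its
      variation needs a change of sign, which is allowed because \<phi> is even.\<close>
    have negadm: "(\<lambda>x. (-1) *\<^sub>R z x) \<in> admissible \<phi> \<Omega>" if "z \<in> admissible \<phi> \<Omega>" for z
    proof -
      have "((-1) *\<^sub>R z x) \<bullet> \<xi> \<le> \<phi> x \<xi>" if x: "x \<in> \<Omega>" for x \<xi>
      proof -
        have "z x \<bullet> ((-1) *\<^sub>R \<xi>) \<le> \<phi> x ((-1) *\<^sub>R \<xi>)" using \<open>z \<in> admissible \<phi> \<Omega>\<close> x unfolding admissible_def by blast
        also have "\<dots> = \<phi> x \<xi>" using homogeneous[OF in_closure[OF x], of "-1" \<xi>] by simp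
        finally show ?thesis by simp
      qed
      then show ?thesis using C1c_scaleR(1)[of z \<Omega> "-1"] that by (auto simp: admissible_def)
    qed
    have "(\<lambda>x. - h x) \<in> BV_phi \<phi> \<Omega>"
      unfolding BV_phi_def
    proof (intro CollectI conjI)
      show "set_integrable lebesgue \<Omega> (\<lambda>x. - h x)" using zeh by (simp add: zero_extension_def)
      have "phi_variation \<phi> \<Omega> (\<lambda>x. - h x) \<le> ereal (V + R)"
        unfolding phi_variation_eq[OF \<Omega>(1) \<phi> zeh]
      proof (rule SUP_least)
        fix z assume z: "z \<in> admissible \<phi> \<Omega>"
        then have "divergence (\<lambda>x. (-1) *\<^sub>R z x) = (\<lambda>x. - divergence z x)" using C1c_scaleR(2)[of z \<Omega> "-1"] by (auto simp: admissible_def)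
        then show "ereal (LBINT x. - h x * divergence z x) \<le> ereal (V + R)"
          using bnd[OF zadm negadm[OF z]] by (simp add: divergence_zero)
      qed
      then show "phi_variation \<phi> \<Omega> (\<lambda>x. - h x) < \<infinity>" by (auto simp: less_top[symmetric] top_ereal_def)
    qed
    moreover have "compactly_supported_in \<Omega> (\<lambda>x. - h x)"
      unfolding compactly_supported_in_def using K by (intro exI[of _ K]) (auto simp: h_def)
    ultimately have le: "ereal V \<le> phi_variation \<phi> \<Omega> (\<lambda>x. u x + - h x)"
      using lg V unfolding phi_least_gradient_def by metis
    \<comment> \<open>Scaling by \<open>l\<close> makes a field of Euclidean norm at most 1
      admissible; dividing by \<open>l\<close> at the end yields the constant
      \<open>2 * L / l\<close>.\<close>
    have ladm: "(\<lambda>x. l *\<^sub>R z x) \<in> admissible \<phi> \<Omega>"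
      unfolding admissible_def
    proof (intro CollectI conjI ballI allI C1c_scaleR(1)[OF z(1)])
      fix x \<xi> assume x: "x \<in> \<Omega>"
      have "z x \<bullet> \<xi> \<le> norm (z x) * norm \<xi>" by (rule norm_cauchy_schwarz)
      also have "\<dots> \<le> 1 * norm \<xi>" by (intro mult_right_mono z(2)) auto
      finally have "l * (z x \<bullet> \<xi>) \<le> l * norm \<xi>" using lL(1) by simp
      also have "\<dots> \<le> \<phi> x \<xi>" using bounds[OF in_closure[OF x]] by blast
      finally show "(l *\<^sub>R z x) \<bullet> \<xi> \<le> \<phi> x \<xi>" by simp
    qed
    have "(LBINT x. h x * divergence (\<lambda>x. l *\<^sub>R z x) x) \<le> R"
    proof (rule field_le_epsilon)
      fix e :: real assume "e > 0"
      \<comment> \<open>A field \<open>z1\<close> that nearly attains the variation of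
        \<open>u - h\<close> takes up more than \<open>V - e\<close> of the bound
        \<open>V + R\<close>.\<close>
      then have "ereal (V - e) < phi_variation \<phi> \<Omega> (\<lambda>x. u x + - h x)"
        using le by (meson diff_less_eq ereal_less_eq(3) less_add_same_cancel1 less_ereal.simps(1) order_less_le_trans)
      then obtain z1 where z1: "z1 \<in> admissible \<phi> \<Omega>" "V - e < (LBINT x. (u0 x - h x) * divergence z1 x)"
        unfolding phi_variation_eq[OF \<Omega>(1) \<phi> zeuh] less_SUP_iff by auto
      then show "(LBINT x. h x * divergence (\<lambda>x. l *\<^sub>R z x) x) \<le> R + e"
        using bnd[OF z1(1) ladm] by linarith
    qed
    then have "l * (LBINT x. h x * divergence z x) \<le> R"
      by (simp add: C1c_scaleR(2)[OF z(1)] mult.left_commute)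
    then show "(LBINT x. \<eta> x * G (u0 x) * divergence z x) \<le> 2 * L / l * (LBINT x. norm (\<eta>' x) * \<bar>G (u0 x)\<bar>)"
      using lL(1) by (simp add: R_def h_def field_simps)
  qed
qed

section \<open>Translations and level sets\<close>

lemma sum_cball_subset:
  fixes K :: "'a::euclidean_space set"
  assumes "(\<Union>x\<in>K. ball x d) \<subseteq> \<Omega>" "r < d"
  shows "{x + y |x y. x \<in> K \<and> y \<in> cball 0 r} \<subseteq> \<Omega>"
proof
  fix x assume "x \<in> {x + y |x y. x \<in> K \<and> y \<in> cball 0 r}"
  then obtain k y where "k \<in> K" "x = k + y" "norm y \<le> r" by auto
  then have "x \<in> ball k d" using assms(2) by (simp add: dist_norm)
  then show "x \<in> \<Omega>" using assms(1) \<open>k \<in> K\<close> by blast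
qed

lemma sum_cballI:
  fixes x :: "'a::euclidean_space"
  assumes "x - y \<in> K" "norm y \<le> r"
  shows "x \<in> {x + y |x y. x \<in> K \<and> y \<in> cball 0 r}"
  using assms by (intro CollectI exI[of _ "x - y"] exI[of _ y]) auto

text \<open>Mollify the indicator of the neighbourhood of \<open>K\<close> of width
  \<open>d / 2\<close> at radius \<open>d / 4\<close>: the result is 1 within \<open>d / 4\<close>
  of \<open>K\<close>, hence has zero gradient on \<open>K\<close>, and it vanishes beyond distance
  \<open>3 * d / 4\<close>.\<close>

lemma C1_cutoff_exists:
  fixes K :: "'a::euclidean_space set"
  assumes K: "compact K" "K \<subseteq> \<Omega>" and \<Omega>: "open \<Omega>"
  obtains \<zeta> \<zeta>' K' where "has_C1_gradient \<zeta> \<zeta>'" "\<And>x. 0 \<le> \<zeta> x \<and> \<zeta> x \<le> 1" "compact K'" "K' \<subseteq> \<Omega>"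
    "\<And>x. x \<notin> K' \<Longrightarrow> \<zeta> x = 0" "\<And>x. x \<in> K \<Longrightarrow> \<zeta> x = 1 \<and> \<zeta>' x = 0"
proof -
  obtain d where d: "d > 0" "(\<Union>x\<in>K. ball x d) \<subseteq> \<Omega>"
    using compact_subset_open_imp_ball_epsilon_subset[OF K(1) \<Omega> K(2)] by metis
  define A where "A = {x + y |x y. x \<in> K \<and> y \<in> cball 0 (d/2)}"
  define K' where "K' = {x + y |x y. x \<in> K \<and> y \<in> cball 0 (3 * d/4)}"
  have cA: "compact A" unfolding A_def by (rule compact_sums[OF K(1) compact_cball])
  have cK': "compact K'" unfolding K'_def by (rule compact_sums[OF K(1) compact_cball])
  have ia: "integrable lborel (indicator A :: 'a \<Rightarrow> real)"
    by (rule integrable_real_indicator) (use cA emeasure_compact_finite[OF cA] in \<open>auto simp: compact_imp_closed\<close>)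
  let ?r = "d / 4"
  have r: "?r > 0" using d by simp
  let ?z = "mollify ?r (indicator A :: 'a \<Rightarrow> real)" and ?z' = "mollify_grad ?r (indicator A :: 'a \<Rightarrow> real)"
  have C1: "has_C1_gradient ?z ?z'" by (rule has_C1_gradient_mollify[OF r ia])
  have one: "?z x = 1" if "x \<in> ball k ?r" "k \<in> K" for x k
  proof -
    have "x - y \<in> A" if "norm y < ?r" for y
    proof -
      have "norm (x - k - y) \<le> norm (x - k) + norm y" by (rule norm_triangle_ineq4)
      then have "norm (x - y - k) \<le> d / 2" using that \<open>x \<in> ball k ?r\<close> by (simp add: dist_norm norm_minus_commute algebra_simps)
      then show ?thesis unfolding A_def using \<open>k \<in> K\<close> by (intro CollectI exI[of _ k] exI[of _ "x - y - k"]) auto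
    qed
    then show ?thesis
      using mollify_le[OF r ia, of x 1] mollify_ge[OF r ia, of 1 x] by (auto simp: indicator_def intro!: antisym)
  qed
  have grad0: "?z' x = 0" if "x \<in> K" for x
  proof -
    have "(?z has_derivative (\<lambda>h. 0)) (at x)"
      by (rule has_derivative_transform_within_open[where f = "\<lambda>x. 1" and s = "ball x ?r"])
         (use that one r in auto)
    then have "(\<lambda>h. ?z' x \<bullet> h) = (\<lambda>h. 0)"
      using has_derivative_unique has_C1_gradientD(1)[OF C1] by blast
    then show ?thesis by (metis inner_eq_zero_iff)
  qed
  show ?thesis
  proof (rule that[OF C1 _ cK'])
    show "0 \<le> ?z x \<and> ?z x \<le> 1" for x
      by (intro conjI mollify_ge[OF r ia] mollify_le[OF r ia]) (auto simp: indicator_def)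
    show "K' \<subseteq> \<Omega>" unfolding K'_def by (rule sum_cball_subset[OF d(2)]) (use d in auto)
    show "?z x = 0" if "x \<notin> K'" for x
    proof (rule mollify_eq_0[OF r ia])
      fix y :: 'a assume y: "norm y < ?r"
      have "x - y \<notin> A"
      proof
        assume "x - y \<in> A"
        then obtain k w where kw: "k \<in> K" "x - y = k + w" "norm w \<le> d / 2" by (auto simp: A_def)
        have "norm (w + y) \<le> 3 * d / 4" using norm_triangle_ineq[of w y] kw(3) y by linarith
        moreover have "x = k + (w + y)" using kw(2) by (simp add: algebra_simps)
        ultimately show False using that kw(1) unfolding K'_def by auto
      qed
      then show "indicator A (x - y) = (0::real)" by simp
    qed
    show "?z x = 1 \<and> ?z' x = 0" if "x \<in> K" for x using one[of x x] that r grad0 by auto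
  qed
qed

lemma has_C1_gradient_affine:
  assumes "has_C1_gradient f f'"
  shows "has_C1_gradient (\<lambda>x. f (a + t *\<^sub>R x)) (\<lambda>x. t *\<^sub>R f' (a + t *\<^sub>R x))"
proof (rule has_C1_gradientI)
  fix x
  have "((\<lambda>x. a + t *\<^sub>R x) has_derivative (\<lambda>h. t *\<^sub>R h)) (at x)" by (auto intro!: derivative_eq_intros)
  from has_derivative_compose[OF this has_C1_gradientD(1)[OF assms]]
  show "((\<lambda>x. f (a + t *\<^sub>R x)) has_derivative (\<lambda>h. (t *\<^sub>R f' (a + t *\<^sub>R x)) \<bullet> h)) (at x)" by simp
  show "continuous_on UNIV (\<lambda>x. t *\<^sub>R f' (a + t *\<^sub>R x))"
    by (intro continuous_intros continuous_on_compose2[OF has_C1_gradientD(2)[OF assms]]) auto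
qed

text \<open>The dual form of the fact that a translation by \<open>h\<close> changes
  \<open>v\<close> in L1 by at most \<open>norm h\<close> times its variation. Shifting the
  translation onto a smooth test function gives a differentiable function of the shift, whose
  derivative along \<open>h\<close> is \<open>v\<close> tested against a vector field parallel to
  \<open>h\<close>.\<close>

lemma variation_bounds_translation:
  fixes v :: "'a::euclidean_space \<Rightarrow> real"
  assumes \<Omega>: "open \<Omega>" and v: "integrable lborel v" "\<And>x. \<bar>v x\<bar> \<le> Bv"
    and K: "compact K" "K \<subseteq> \<Omega>" "\<And>x. x \<notin> K \<Longrightarrow> v x = 0"
    and M: "\<And>z. z \<in> C1c \<Omega> \<Longrightarrow> (\<And>x. norm (z x) \<le> 1) \<Longrightarrow> (LBINT x. v x * divergence z x) \<le> M"
    and g: "integrable lborel g" "\<And>x. \<bar>g x\<bar> \<le> 1" "compact K2" "\<And>x. x \<notin> K2 \<Longrightarrow> g x = 0"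
  shows "(LBINT x. (v (x + h) - v x) * g x) \<le> norm h * M"
proof (cases "h = 0")
  case True then show ?thesis by simp
next
  case False
  note [measurable] = integrable_lborel_borel[OF v(1)] integrable_lborel_borel[OF g(1)]
  obtain \<zeta> \<zeta>' K' where \<zeta>: "has_C1_gradient \<zeta> \<zeta>'" "\<And>x. 0 \<le> \<zeta> x \<and> \<zeta> x \<le> 1" "compact K'" "K' \<subseteq> \<Omega>"
    "\<And>x. x \<notin> K' \<Longrightarrow> \<zeta> x = 0" "\<And>x. x \<in> K \<Longrightarrow> \<zeta> x = 1 \<and> \<zeta>' x = 0"
    using C1_cutoff_exists[OF K(1,2) \<Omega>] by metis
  have ivh: "integrable lborel (\<lambda>x. v (x + h))" using lborel_integrable_plus[of v h] v(1) by simp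
  define e where "e = h /\<^sub>R norm h"
  have e: "norm e = 1" "norm h *\<^sub>R e = h" using False by (auto simp: e_def)
  have smooth: "(LBINT x. (v (x + h) - v x) * mollify r g x) \<le> norm h * M" if r: "r > 0" for r
  proof -
    let ?g = "mollify r g" and ?g' = "mollify_grad r g"
    note C1 = has_C1_gradient_mollify[OF r g(1)]
    note D = has_C1_gradientD[OF C1]
    define K3 where "K3 = {x + y |x y. x \<in> K2 \<and> y \<in> cball 0 r}"
    have K3: "compact K3" unfolding K3_def by (rule compact_sums[OF g(3) compact_cball])
    have g0: "?g x = 0" if "x \<notin> K3" for x
    proof (rule mollify_eq_0[OF r g(1)])
      fix y :: 'a assume "norm y < r"
      then show "g (x - y) = 0" using that sum_cballI[of x y K2 r] g(4) unfolding K3_def by force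
    qed
    have g1: "\<bar>?g x\<bar> \<le> 1" for x
      using mollify_le[OF r g(1), of x 1] mollify_ge[OF r g(1), of "-1" x] g(2) by (simp add: abs_le_iff minus_le_iff)
    have g'0: "?g' x = 0" if "x \<notin> K3" for x
      by (rule gradient_eq_0_outside[OF C1 compact_imp_closed[OF K3] g0 that])
    obtain R where R: "\<And>x. x \<in> K3 \<Longrightarrow> norm x \<le> R" using compact_imp_bounded[OF K3] bounded_pos by metis
    have uc: "uniformly_continuous_on UNIV ?g'"
      by (rule compact_support_uniformly_continuous[OF D(2), of R]) (use g'0 R in \<open>auto simp: not_le[symmetric]\<close>)
    obtain B where B: "\<And>x. norm (?g' x) \<le> B" using compact_support_bounded[OF D(2) K3 g'0] by metis
    \<comment> \<open>\<open>F h - F 0\<close> is the integral to be estimated, after the change of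
      variable \<open>x + h\<close>.\<close>
    define F where "F = (\<lambda>w. \<integral>x. v x * ?g (x - w) \<partial>lborel)"
    define F' where "F' = (\<lambda>w. \<integral>x. v x *\<^sub>R (- ?g' (x - w)) \<partial>lborel)"
    have "has_C1_gradient (\<lambda>w. \<integral>x. v x * (\<lambda>y. ?g (0 + (-1) *\<^sub>R y)) (w - x) \<partial>lborel)
        (\<lambda>w. \<integral>x. v x *\<^sub>R (\<lambda>y. (-1) *\<^sub>R ?g' (0 + (-1) *\<^sub>R y)) (w - x) \<partial>lborel)"
    proof (rule convolution_has_C1_gradient[OF v(1) has_C1_gradient_affine[OF C1], where B = "max 1 B"])
      show "uniformly_continuous_on UNIV (\<lambda>y. (-1) *\<^sub>R ?g' (0 + (-1) *\<^sub>R y))"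
        by (rule compact_support_uniformly_continuous[of _ R])
           (use g'0 R in \<open>force intro!: continuous_intros continuous_on_compose2[OF D(2)] simp: not_le[symmetric]\<close>)+
      show "\<bar>?g (0 + (-1) *\<^sub>R x)\<bar> \<le> max 1 B" for x using g1[of "- x"] by auto
      show "norm ((-1) *\<^sub>R ?g' (0 + (-1) *\<^sub>R x)) \<le> max 1 B" for x using B[of "- x"] by auto
    qed
    then have F: "has_C1_gradient F F'" by (simp add: F_def F'_def)
    have F'le: "F' w \<bullet> h \<le> norm h * M" for w
    proof -
      define p where "p = (\<lambda>x. ?g ((- w) + 1 *\<^sub>R x))"
      define p' where "p' = (\<lambda>x. 1 *\<^sub>R ?g' ((- w) + 1 *\<^sub>R x))"
      have p: "has_C1_gradient p p'" unfolding p_def p'_def by (rule has_C1_gradient_affine[OF C1])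
      \<comment> \<open>This is the field \<open>- \<zeta> p e\<close>. The cutoff \<zeta> puts its
        support inside \<Omega> and, being 1 with zero gradient on \<open>K\<close>, does not change
        the divergence where \<open>v\<close> lives.\<close>
      define z where "z = (\<lambda>x. \<Sum>b\<in>Basis. (- (e \<bullet> b) * (\<zeta> x * p x)) *\<^sub>R b)"
      have gr: "has_C1_gradient (\<lambda>x. - (e \<bullet> b) * (\<zeta> x * p x)) (\<lambda>x. (- (e \<bullet> b)) *\<^sub>R (\<zeta> x *\<^sub>R p' x + p x *\<^sub>R \<zeta>' x))" for b
        by (rule has_C1_gradient_cmult[OF has_C1_gradient_mult[OF \<zeta>(1) p]])
      have sup: "- (e \<bullet> b) * (\<zeta> x * p x) = 0" if "x \<notin> K'" for b x using \<zeta>(5)[OF that] by simp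
      have zC: "z \<in> C1c \<Omega>" and zd: "divergence z x = (\<Sum>b\<in>Basis. ((- (e \<bullet> b)) *\<^sub>R (\<zeta> x *\<^sub>R p' x + p x *\<^sub>R \<zeta>' x)) \<bullet> b)" for x
        unfolding z_def using C1c_I[OF gr \<zeta>(3,4) sup] by auto
      have zeq: "z x = - (\<zeta> x * p x) *\<^sub>R e" for x
      proof -
        have "z x = - (\<zeta> x * p x) *\<^sub>R (\<Sum>b\<in>Basis. (e \<bullet> b) *\<^sub>R b)"
          unfolding z_def scaleR_sum_right by (intro sum.cong refl) simp
        then show ?thesis by (simp add: euclidean_representation)
      qed
      have zn: "norm (z x) \<le> 1" for x
        using zeq[of x] e(1) \<zeta>(2)[of x] g1[of "x - w"] mult_mono[of "\<bar>\<zeta> x\<bar>" 1 "\<bar>p x\<bar>" 1]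
        by (simp add: abs_mult p_def)
      have zdK: "divergence z x = - (?g' (x - w) \<bullet> e)" if "x \<in> K" for x
      proof -
        have "divergence z x = - (\<Sum>b\<in>Basis. (p' x \<bullet> b) * (e \<bullet> b))"
          unfolding zd using \<zeta>(6)[OF that] by (simp add: sum_negf[symmetric] mult.commute)
        also have "\<dots> = - (p' x \<bullet> e)" by (simp only: euclidean_inner[symmetric])
        finally show ?thesis by (simp add: p'_def)
      qed
      have iv': "integrable lborel (\<lambda>x. v x *\<^sub>R (- ?g' (x - w)))"
      proof (rule integrable_scaleR_bounded[OF v(1), where B = B])
        show "(\<lambda>x. - ?g' (x - w)) \<in> borel_measurable lborel" using D(5) by measurable
      qed (use B in auto)
      have "F' w \<bullet> h = norm h * (F' w \<bullet> e)" by (subst e(2)[symmetric]) simp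
      also have "F' w \<bullet> e = (LBINT x. (v x *\<^sub>R (- ?g' (x - w))) \<bullet> e)"
        unfolding F'_def using iv' by (rule integral_inner_left[symmetric])
      also have "\<dots> = (LBINT x. v x * divergence z x)"
      proof (rule Bochner_Integration.integral_cong[OF refl])
        fix x show "(v x *\<^sub>R (- ?g' (x - w))) \<bullet> e = v x * divergence z x"
          using zdK[of x] K(3)[of x] by (cases "x \<in> K") auto
      qed
      also have "norm h * \<dots> \<le> norm h * M" by (intro mult_left_mono M zC zn) auto
      finally show ?thesis .
    qed
    have dF: "((\<lambda>s. F (0 + s *\<^sub>R h)) has_real_derivative F' (0 + s *\<^sub>R h) \<bullet> h) (at s)" for s :: real
    proof -
      have "((\<lambda>s. 0 + s *\<^sub>R h) has_derivative (\<lambda>t. t *\<^sub>R h)) (at s)" by (auto intro!: derivative_eq_intros)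
      from has_derivative_compose[OF this has_C1_gradientD(1)[OF F]]
      show ?thesis by (simp add: has_field_derivative_def mult.commute[of _ "F' (s *\<^sub>R h) \<bullet> h"] fun_eq_iff)
    qed
    have "\<exists>s. 0 < s \<and> s < 1 \<and> F (0 + 1 *\<^sub>R h) - F (0 + 0 *\<^sub>R h) = (1 - 0) * (F' (0 + s *\<^sub>R h) \<bullet> h)"
      by (rule MVT2[where f = "\<lambda>s. F (0 + s *\<^sub>R h)"]) (use dF in auto)
    then have "F h - F 0 \<le> norm h * M" using F'le by auto
    moreover have "F h - F 0 = (LBINT x. (v (x + h) - v x) * ?g x)"
    proof -
      have [measurable]: "?g \<in> borel_measurable borel" by (rule D(4))
      have i1: "integrable lborel (\<lambda>x. v (x + h) * ?g x)" "integrable lborel (\<lambda>x. v x * ?g x)"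
        by (rule integrable_mult_bounded[OF ivh _ g1] integrable_mult_bounded[OF v(1) _ g1]; measurable)+
      have "F h = (LBINT x. (\<lambda>x. v x * ?g (x - h)) (x + h))"
        unfolding F_def by (rule lborel_integral_plus[symmetric]) measurable
      then have "F h = (LBINT x. v (x + h) * ?g x)" by simp
      moreover have "F 0 = (LBINT x. v x * ?g x)" by (simp add: F_def)
      ultimately show ?thesis using i1 by (simp add: left_diff_distrib)
    qed
    ultimately show ?thesis by simp
  qed
  show ?thesis
  proof (rule field_le_epsilon)
    fix t :: real assume t: "t > 0"
    \<comment> \<open>The factor \<open>2 * (\<bar>Bv\<bar> + 1)\<close> bounds the translation
      difference of \<open>v\<close>, so an L1 error \<open>q\<close> in \<open>g\<close> costs at
      most \<open>t\<close>.\<close>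
    define q where "q = t / (2 * (\<bar>Bv\<bar> + 1))"
    have q: "q > 0" using t by (simp add: q_def)
    obtain d where d: "d > 0" "\<And>r. 0 < r \<Longrightarrow> r < d \<Longrightarrow> integrable lborel (mollify r g) \<and> (LBINT x. \<bar>mollify r g x - g x\<bar>) \<le> q"
      using mollify_L1_limit[OF g(1) q] by metis
    let ?g = "mollify (d/2) g"
    have ig: "integrable lborel ?g" and dg: "(LBINT x. \<bar>?g x - g x\<bar>) \<le> q" using d(2)[of "d/2"] d(1) by auto
    note [measurable] = integrable_lborel_borel[OF ig]
    have b: "\<bar>v (x + h) - v x\<bar> \<le> 2 * (\<bar>Bv\<bar> + 1)" for x
    proof -
      have "\<bar>v (x + h) - v x\<bar> \<le> \<bar>v (x + h)\<bar> + \<bar>v x\<bar>" by (rule abs_triangle_ineq4)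
      also have "\<dots> \<le> Bv + Bv" by (intro add_mono v(2))
      also have "\<dots> \<le> 2 * (\<bar>Bv\<bar> + 1)" by (simp add: abs_le_iff)
      finally show ?thesis .
    qed
    have iA: "integrable lborel (\<lambda>x. k x * (v (x + h) - v x))" if "integrable lborel k" for k
      by (rule integrable_mult_bounded[OF that _ b]) measurable
    have "(LBINT x. (v (x + h) - v x) * g x) \<le> (LBINT x. ?g x * (v (x + h) - v x) + (2 * (\<bar>Bv\<bar> + 1)) * \<bar>?g x - g x\<bar>)"
    proof (rule integral_mono)
      show "integrable lborel (\<lambda>x. (v (x + h) - v x) * g x)" using iA[OF g(1)] by (simp add: mult.commute)
      show "integrable lborel (\<lambda>x. ?g x * (v (x + h) - v x) + (2 * (\<bar>Bv\<bar> + 1)) * \<bar>?g x - g x\<bar>)"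
        using ig g(1) by (intro Bochner_Integration.integrable_add iA) auto
      fix x
      have "(v (x + h) - v x) * g x - ?g x * (v (x + h) - v x) = (v (x + h) - v x) * (g x - ?g x)" by (simp add: algebra_simps)
      also have "\<dots> \<le> \<bar>v (x + h) - v x\<bar> * \<bar>g x - ?g x\<bar>" by (metis abs_ge_self abs_mult)
      also have "\<dots> \<le> (2 * (\<bar>Bv\<bar> + 1)) * \<bar>g x - ?g x\<bar>" by (intro mult_right_mono b) auto
      finally show "(v (x + h) - v x) * g x \<le> ?g x * (v (x + h) - v x) + (2 * (\<bar>Bv\<bar> + 1)) * \<bar>?g x - g x\<bar>"
        by (simp add: abs_minus_commute)
    qed
    also have "\<dots> = (LBINT x. ?g x * (v (x + h) - v x)) + (2 * (\<bar>Bv\<bar> + 1)) * (LBINT x. \<bar>?g x - g x\<bar>)"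
      by (subst Bochner_Integration.integral_add) (use ig g(1) iA[OF ig] in auto)
    also have "(LBINT x. ?g x * (v (x + h) - v x)) = (LBINT x. (v (x + h) - v x) * ?g x)" by (simp add: mult.commute)
    also have "\<dots> + (2 * (\<bar>Bv\<bar> + 1)) * (LBINT x. \<bar>?g x - g x\<bar>) \<le> norm h * M + (2 * (\<bar>Bv\<bar> + 1)) * q"
      using dg d(1) by (intro add_mono mult_left_mono smooth) auto
    also have "(2 * (\<bar>Bv\<bar> + 1)) * q = t" by (simp add: q_def)
    finally show "(LBINT x. (v (x + h) - v x) * g x) \<le> norm h * M + t" .
  qed
qed

text \<open>Translates of \<open>F\<close> by \<open>h\<close> meet \<open>E\<close> in at most a quarter of its measure for some \<open>h\<close> in the ball of
  radius \<open>\<rho>\<close>, because the average over \<open>h\<close> of \<open>|E \<inter> (F - h)|\<close> is \<open>|E| |F| / |ball 0 \<rho>|\<close>.\<close>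

lemma level_set_estimate:
  fixes v :: "'a::euclidean_space \<Rightarrow> real"
  assumes \<Omega>: "open \<Omega>" and v: "integrable lborel v"
    and K: "compact K" "K \<subseteq> \<Omega>" "\<And>x. x \<notin> K \<Longrightarrow> v x = 0"
    and M: "\<And>z. z \<in> C1c \<Omega> \<Longrightarrow> (\<And>x. norm (z x) \<le> 1) \<Longrightarrow> (LBINT x. v x * divergence z x) \<le> M"
    and E: "E \<in> sets borel" "E \<subseteq> K" "\<And>x. x \<in> E \<Longrightarrow> 1 / 2 \<le> \<bar>v x\<bar>"
    and F: "F \<in> sets borel" "emeasure lborel F < \<infinity>" "\<And>x. \<bar>v x\<bar> \<le> indicator F x"
    and \<rho>: "\<rho> > 0" "4 * measure lborel F \<le> measure lborel (ball (0::'a) \<rho>)"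
  shows "measure lborel E \<le> 4 * \<rho> * M"
proof -
  note [measurable] = integrable_lborel_borel[OF v] E(1) F(1)
  have M0: "0 \<le> M" using M[OF C1c_zero] by (simp add: divergence_zero)
  have fE: "emeasure lborel E < \<infinity>"
    using emeasure_mono[OF E(2), of lborel] emeasure_compact_finite[OF K(1)] K(1)
    by (metis borel_compact order_le_less_trans sets_lborel)
  have iE: "integrable lborel (indicator E :: 'a \<Rightarrow> real)" using fE by (intro integrable_real_indicator) auto
  have [measurable]: "(\<lambda>x::'a. x + h) \<in> borel_measurable borel" for h by measurable
  define q where "q = (\<lambda>h. \<integral>x. indicator E x * indicator F (x + h) \<partial>lborel :: real)"
  have iq: "integrable lborel (\<lambda>x. indicator E x * indicator F (x + h) :: real)" for h
  proof (rule integrable_mult_bounded[OF iE, where B = 1])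
    have "(\<lambda>x. indicator F (x + h) :: real) \<in> borel_measurable borel"
      by (rule measurable_compose[of "\<lambda>x. x + h" borel borel]) (use F(1) in auto)
    then show "(\<lambda>x. indicator F (x + h) :: real) \<in> borel_measurable lborel" by simp
  qed (auto simp: indicator_def)
  have low: "measure lborel E / 2 - \<rho> * M \<le> q h" if h: "norm h < \<rho>" for h
  proof -
    \<comment> \<open>With this sign the integrand is at least \<open>1 / 2\<close> at points of
      \<open>E\<close> whose translate by \<open>h\<close> misses \<open>F\<close>, since
      \<open>v\<close> vanishes at the translate.\<close>
    define g where "g = (\<lambda>x. - sgn (v x) * indicator E x)"
    have [measurable]: "g \<in> borel_measurable borel" unfolding g_def by measurable
    have ig: "integrable lborel g"
    proof (rule Bochner_Integration.integrable_bound[OF iE])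
      show "AE x in lborel. norm (g x) \<le> norm (indicator E x :: real)" by (intro AE_I2) (auto simp: g_def indicator_def abs_sgn_eq)
    qed measurable
    have bv: "\<bar>v x\<bar> \<le> 1" for x using F(3)[of x] by (auto simp: indicator_def intro: order_trans)
    have "(LBINT x. (v (x + h) - v x) * g x) \<le> norm h * M"
      by (rule variation_bounds_translation[OF \<Omega> v bv K M ig _ K(1)]) (use E(2) in \<open>auto simp: g_def indicator_def abs_sgn_eq\<close>)
    also have "\<dots> \<le> \<rho> * M" using h M0 by (intro mult_right_mono) auto
    finally have 1: "(LBINT x. (v (x + h) - v x) * g x) \<le> \<rho> * M" .
    have "measure lborel E / 2 - q h = (LBINT x. indicator E x / 2 - indicator E x * indicator F (x + h))"
      using iE iq[of h] by (simp add: q_def)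
    also have "\<dots> \<le> (LBINT x. (v (x + h) - v x) * g x)"
    proof (rule integral_mono)
      show "integrable lborel (\<lambda>x. indicator E x / 2 - indicator E x * indicator F (x + h) :: real)" using iE iq[of h] by simp
      have "integrable lborel (\<lambda>x. g x * (v (x + h) - v x))"
      proof (rule integrable_mult_bounded[OF ig, where B = 2])
        show "\<bar>v (x + h) - v x\<bar> \<le> 2" for x using bv[of x] bv[of "x + h"] by linarith
      qed measurable
      then show "integrable lborel (\<lambda>x. (v (x + h) - v x) * g x)" by (simp add: mult.commute)
      fix x
      show "indicator E x / 2 - indicator E x * indicator F (x + h) \<le> (v (x + h) - v x) * g x"
      proof (cases "x \<in> E")
        case True
        have "(v (x + h) - v x) * g x = \<bar>v x\<bar> - sgn (v x) * v (x + h)"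
          using True by (simp add: g_def algebra_simps abs_sgn)
        moreover have "sgn (v x) * v (x + h) \<le> \<bar>v (x + h)\<bar>"
          by (cases "v x" "0::real" rule: linorder_cases) auto
        ultimately show ?thesis using E(3)[OF True] F(3)[of "x + h"] True by simp
      qed (simp add: g_def)
    qed
    finally show ?thesis using 1 by linarith
  qed
  show ?thesis
  \<comment> \<open>If the lower bound in \<open>low\<close> is not positive, this already gives the
    claim; otherwise it can be averaged over \<open>h\<close> as a nonnegative extended
    number.\<close>
  proof (cases "measure lborel E / 2 - \<rho> * M \<le> 0")
    case True
    moreover have "0 \<le> \<rho> * M" using \<rho>(1) M0 by simp
    ultimately show ?thesis by linarith
  next
    case False
    define c where "c = measure lborel E / 2 - \<rho> * M"
    have c: "c > 0" using False by (simp add: c_def)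
    have qn: "ennreal (q h) = (\<integral>\<^sup>+x. indicator E x * indicator F (x + h) \<partial>lborel)" for h
      unfolding q_def using iq[of h]
      by (subst nn_integral_eq_integral[symmetric]) (auto intro!: nn_integral_cong simp: indicator_def)
    have bf: "emeasure lborel (ball (0::'a) \<rho>) = ennreal (measure lborel (ball (0::'a) \<rho>))"
      using emeasure_lborel_ball_finite[of "0::'a" \<rho>] by (intro emeasure_eq_ennreal_measure) auto
    have eE: "emeasure lborel E = ennreal (measure lborel E)" and eF: "emeasure lborel F = ennreal (measure lborel F)"
      using fE F(2) by (auto intro!: emeasure_eq_ennreal_measure)
    have "ennreal (c * measure lborel (ball (0::'a) \<rho>)) = (\<integral>\<^sup>+h. ennreal c * indicator (ball (0::'a) \<rho>) h \<partial>lborel)"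
      using c by (subst nn_integral_cmult_indicator) (auto simp: bf ennreal_mult)
    also have "\<dots> \<le> (\<integral>\<^sup>+h. (\<integral>\<^sup>+x. indicator E x * indicator F (x + h) \<partial>lborel) \<partial>(lborel :: 'a measure))"
    proof (rule nn_integral_mono)
      fix h :: 'a
      show "ennreal c * indicator (ball 0 \<rho>) h \<le> (\<integral>\<^sup>+x. indicator E x * indicator F (x + h) \<partial>lborel)"
        using low[of h] unfolding qn[symmetric] by (auto simp: indicator_def c_def ennreal_leI)
    qed
    also have "\<dots> = (\<integral>\<^sup>+x. (\<integral>\<^sup>+h. indicator E x * indicator F (x + h) \<partial>(lborel :: 'a measure)) \<partial>lborel)"
      by (rule lborel_pair.Fubini') measurable
    also have "\<dots> = (\<integral>\<^sup>+x. ennreal (measure lborel F) * indicator E x \<partial>lborel)"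
    proof (rule nn_integral_cong)
      fix x :: 'a
      have "(\<integral>\<^sup>+h. indicator F (x + h) \<partial>lborel) = (\<integral>\<^sup>+h. indicator F h \<partial>distr lborel borel ((+) x))"
        by (rule nn_integral_distr[symmetric]) auto
      also have "\<dots> = ennreal (measure lborel F)" using F(1) by (simp add: lborel_distr_plus eF)
      finally have "(\<integral>\<^sup>+h. indicator F (x + h) \<partial>lborel) = ennreal (measure lborel F)" .
      then show "(\<integral>\<^sup>+h. indicator E x * indicator F (x + h) \<partial>lborel) = ennreal (measure lborel F) * indicator E x"
        by (cases "x \<in> E") auto
    qed
    also have "\<dots> = ennreal (measure lborel F * measure lborel E)"
      by (subst nn_integral_cmult_indicator) (auto simp: eE ennreal_mult)
    finally have "c * measure lborel (ball (0::'a) \<rho>) \<le> measure lborel F * measure lborel E"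
      by (simp add: ennreal_le_iff)
    also have "\<dots> \<le> measure lborel (ball (0::'a) \<rho>) / 4 * measure lborel E"
      using \<rho>(2) by (intro mult_right_mono) auto
    finally have "c * measure lborel (ball (0::'a) \<rho>) \<le> (measure lborel E / 4) * measure lborel (ball (0::'a) \<rho>)" by (simp add: mult.commute)
    moreover have "measure lborel (ball (0::'a) \<rho>) > 0" using content_ball_pos[OF \<rho>(1)] by simp
    ultimately have "c \<le> measure lborel E / 4" by simp
    then show ?thesis by (simp add: c_def)
  qed
qed

section \<open>Hausdorff measure\<close>

lemma hausdorff_outer_mono: "A \<subseteq> B \<Longrightarrow> hausdorff_outer s A \<le> hausdorff_outer s B"
  using outer_measure_space_hausdorff_outer[of s] by (auto simp: outer_measure_space_def increasing_def)

lemma hausdorff_outer_empty [simp]: "hausdorff_outer s {} = 0"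
  using outer_measure_space_hausdorff_outer[of s] by (auto simp: outer_measure_space_def positive_def)

lemma hausdorff_outer_UN: "hausdorff_outer s (\<Union>i. A i) \<le> (\<Sum>i::nat. hausdorff_outer s (A i))"
  unfolding hausdorff_outer_def
  by (auto intro!: SUP_least order_trans[OF hausdorff_pre_subadditive] suminf_le SUP_upper)

lemma hausdorff_outer_Un:
  "hausdorff_outer s (A \<union> B) \<le> hausdorff_outer s A + hausdorff_outer s B"
proof -
  have eq: "A \<union> B = (\<Union>i::nat. if i = 0 then A else if i = 1 then B else {})" by (auto split: if_splits)
  have "hausdorff_outer s (A \<union> B) \<le> (\<Sum>i::nat. hausdorff_outer s (if i = 0 then A else if i = 1 then B else {}))"
    by (subst eq) (rule hausdorff_outer_UN)
  also have "\<dots> = (\<Sum>i<(2::nat). hausdorff_outer s (if i = 0 then A else if i = 1 then B else {}))"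
    by (rule suminf_finite) auto
  also have "\<dots> = hausdorff_outer s A + hausdorff_outer s B" by (simp add: numeral_2_eq_2)
  finally show ?thesis .
qed

lemma hausdorff_pre_antimono: "d \<le> d' \<Longrightarrow> hausdorff_pre s d' A \<le> hausdorff_pre s d A"
  unfolding hausdorff_pre_def
  by (rule INF_superset_mono) (auto simp: hausdorff_covers_def intro: order_trans)

text \<open>A set of diameter at most \<delta>, with \<open>\<delta> < d\<close>, cannot meet both
  \<open>P\<close> and \<open>Q\<close>, so a cover of the union splits into a cover of
  each.\<close>

lemma hausdorff_pre_separated:
  fixes P Q :: "'a::metric_space set"
  assumes sep: "\<And>x y. x \<in> P \<Longrightarrow> y \<in> Q \<Longrightarrow> d \<le> dist x y" and \<delta>: "0 < \<delta>" "\<delta> < d"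
  shows "hausdorff_pre s \<delta> P + hausdorff_pre s \<delta> Q \<le> hausdorff_pre s \<delta> (P \<union> Q)"
  unfolding hausdorff_pre_def[of s \<delta> "P \<union> Q"]
proof (rule INF_greatest)
  fix C assume C: "C \<in> hausdorff_covers \<delta> (P \<union> Q)"
  define C1 where "C1 = (\<lambda>i. if C i \<inter> P \<noteq> {} then C i else {})"
  define C2 where "C2 = (\<lambda>i. if C i \<inter> P = {} then C i else {})"
  have "C1 \<in> hausdorff_covers \<delta> P" using C \<delta> unfolding hausdorff_covers_def C1_def by fastforce
  moreover have "C2 \<in> hausdorff_covers \<delta> Q"
  proof -
    have "\<exists>i. y \<in> C2 i" if y: "y \<in> Q" for y
    proof -
      obtain i where i: "y \<in> C i" using C y unfolding hausdorff_covers_def by blast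
      have "C i \<inter> P = {}"
      proof (rule ccontr)
        assume "C i \<inter> P \<noteq> {}"
        then obtain x where x: "x \<in> C i" "x \<in> P" by blast
        then have "dist x y \<le> diameter (C i)" using C i by (intro diameter_bounded_bound) (auto simp: hausdorff_covers_def)
        also have "\<dots> \<le> \<delta>" using C by (auto simp: hausdorff_covers_def)
        finally show False using sep[OF x(2) y] \<delta> by simp
      qed
      then show ?thesis using i by (auto simp: C2_def)
    qed
    moreover have "\<forall>i. bounded (C2 i) \<and> diameter (C2 i) \<le> \<delta>"
      using C \<delta> by (auto simp: hausdorff_covers_def C2_def)
    ultimately show ?thesis by (auto simp: hausdorff_covers_def)
  qed
  ultimately have "hausdorff_pre s \<delta> P + hausdorff_pre s \<delta> Q \<le> (\<Sum>i. hausdorff_weight s (C1 i)) + (\<Sum>i. hausdorff_weight s (C2 i))"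
    unfolding hausdorff_pre_def by (intro add_mono INF_lower)
  also have "\<dots> = (\<Sum>i. hausdorff_weight s (C1 i) + hausdorff_weight s (C2 i))" by (rule suminf_add) auto
  also have "\<dots> = (\<Sum>i. hausdorff_weight s (C i))"
    by (intro suminf_cong) (auto simp: C1_def C2_def hausdorff_weight_def)
  finally show "hausdorff_pre s \<delta> P + hausdorff_pre s \<delta> Q \<le> (\<Sum>i. hausdorff_weight s (C i))" .
qed

text \<open>Suprema over a directed family add up, and only mesh sizes below \<open>d\<close> matter
  in them.\<close>

lemma hausdorff_outer_separated:
  fixes P Q :: "'a::metric_space set"
  assumes sep: "\<And>x y. x \<in> P \<Longrightarrow> y \<in> Q \<Longrightarrow> d \<le> dist x y" and d: "0 < d"
  shows "hausdorff_outer s P + hausdorff_outer s Q \<le> hausdorff_outer s (P \<union> Q)"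
proof -
  have "(SUP \<delta>\<in>{0<..}. hausdorff_pre s \<delta> P) + (SUP \<delta>\<in>{0<..}. hausdorff_pre s \<delta> Q)
     = (SUP \<delta>\<in>{0<..}. hausdorff_pre s \<delta> P + hausdorff_pre s \<delta> Q)"
  proof (rule SUP_add_directed_ennreal[symmetric])
    fix a b :: real assume "a \<in> {0<..}" "b \<in> {0<..}"
    then show "\<exists>k\<in>{0<..}. hausdorff_pre s a P + hausdorff_pre s b Q \<le> hausdorff_pre s k P + hausdorff_pre s k Q"
      by (intro bexI[of _ "min a b"] add_mono hausdorff_pre_antimono) auto
  qed
  also have "\<dots> \<le> hausdorff_outer s (P \<union> Q)"
  proof (rule SUP_least)
    fix a :: real assume a: "a \<in> {0<..}"
    let ?\<delta> = "min a (d/2)"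
    have "hausdorff_pre s a P + hausdorff_pre s a Q \<le> hausdorff_pre s ?\<delta> P + hausdorff_pre s ?\<delta> Q"
      by (intro add_mono hausdorff_pre_antimono) auto
    also have "\<dots> \<le> hausdorff_pre s ?\<delta> (P \<union> Q)"
      by (rule hausdorff_pre_separated[OF sep]) (use a d in auto)
    also have "\<dots> \<le> hausdorff_outer s (P \<union> Q)"
      unfolding hausdorff_outer_def by (rule SUP_upper) (use a d in auto)
    finally show "hausdorff_pre s a P + hausdorff_pre s a Q \<le> hausdorff_outer s (P \<union> Q)" .
  qed
  finally show ?thesis by (simp add: hausdorff_outer_def)
qed

lemma sum_lessThan_double:
  fixes f :: "nat \<Rightarrow> 'b::comm_monoid_add"
  shows "(\<Sum>k<2 * m. f k) = (\<Sum>i<m. f (2 * i)) + (\<Sum>i<m. f (2 * i + 1))"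
  by (induction m) (auto simp: ac_simps)

text \<open>The shells \<open>R n\<close> around \<open>A\<close> of even index are at positive distance from each other, and likewise
  those of odd index; hence their measures have a finite sum.\<close>

lemma closed_caratheodory:
  fixes A S :: "'a::metric_space set"
  assumes A: "closed A"
  shows "hausdorff_outer s (S \<inter> A) + hausdorff_outer s (S - A) \<le> hausdorff_outer s S"
proof (cases "A = {} \<or> hausdorff_outer s S = top")
  case True
  then show ?thesis by auto
next
  case False
  let ?H = "hausdorff_outer s :: 'a set \<Rightarrow> ennreal"
  let ?i = "\<lambda>x. infdist x A"
  \<comment> \<open>\<open>T n\<close> stays away from \<open>A\<close>, and the shells
    \<open>R i\<close> with \<open>i \<ge> n\<close> fill the rest of \<open>S - A\<close>, because
    points outside the closed set \<open>A\<close> have positive distance to it.\<close>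
  define T where "T = (\<lambda>n::nat. {x \<in> S. 1 / real (Suc n) \<le> ?i x})"
  define R where "R = (\<lambda>n::nat. {x \<in> S. 1 / real (Suc (Suc n)) \<le> ?i x \<and> ?i x < 1 / real (Suc n)})"
  have fin: "?H B < top" if "B \<subseteq> S" for B
    using hausdorff_outer_mono[OF that, of s] False by (simp add: less_top order_le_less_trans)
  have A0: "x \<in> A \<longleftrightarrow> ?i x = 0" for x using in_closed_iff_infdist_zero[OF A] False by auto
  have sep: "?H (\<Union>i<m. R (2 * i + j)) \<ge> (\<Sum>i<m. ?H (R (2 * i + j)))" for m j
  proof (induction m)
    case (Suc m)
    show ?case
    \<comment> \<open>The first shell is separate since \<open>1 / real (2 * m + j)\<close> in the
      gap below takes the default value 0 when \<open>m\<close> and \<open>j\<close> are both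
      0.\<close>
    proof (cases "m = 0")
      case True then show ?thesis by (simp add: lessThan_Suc)
    next
      case m: False
      \<comment> \<open>Points of the earlier shells have distance at least
        \<open>1 / real (2 * m + j)\<close> from \<open>A\<close>, points of the new one less than
        \<open>1 / real (Suc (2 * m + j))\<close>, and the distance to \<open>A\<close> is Lipschitz
        with constant 1.\<close>
      let ?d = "1 / real (2 * m + j) - 1 / real (Suc (2 * m + j))"
      have "?H (\<Union>i<m. R (2 * i + j)) + ?H (R (2 * m + j)) \<le> ?H ((\<Union>i<m. R (2 * i + j)) \<union> R (2 * m + j))"
      proof (rule hausdorff_outer_separated[where d = ?d])
        fix x y assume "x \<in> (\<Union>i<m. R (2 * i + j))" and y: "y \<in> R (2 * m + j)"
        then obtain i where i: "i < m" "1 / real (Suc (Suc (2 * i + j))) \<le> ?i x" by (auto simp: R_def)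
        have "1 / real (2 * m + j) \<le> 1 / real (Suc (Suc (2 * i + j)))" using i m by (intro divide_left_mono) auto
        then show "?d \<le> dist x y" using i(2) y infdist_triangle[of x A y] by (auto simp: R_def)
      next
        have "1 / real (Suc (2 * m + j)) < 1 / real (2 * m + j)"
          using m by (intro divide_strict_left_mono) auto
        then show "0 < ?d" by simp
      qed
      moreover have "(\<Union>i<Suc m. R (2 * i + j)) = (\<Union>i<m. R (2 * i + j)) \<union> R (2 * m + j)"
        by (auto simp: less_Suc_eq)
      ultimately show ?thesis
        using add_right_mono[OF Suc, of "?H (R (2 * m + j))"] by (simp only: sum.lessThan_Suc)
    qed
  qed simp
  have sum2: "(\<Sum>i<m. ?H (R (2 * i + j))) \<le> ?H S" for m j
    by (rule order_trans[OF sep hausdorff_outer_mono]) (auto simp: R_def)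
  define a where "a = (\<lambda>n. enn2real (?H (R n)))"
  have aH: "?H (R n) = ennreal (a n)" for n
    unfolding a_def using fin[of "R n"] by (simp add: R_def less_top)
  have a0: "a n \<ge> 0" for n by (simp add: a_def)
  have "summable a"
  proof (rule summableI_nonneg_bounded[OF a0])
    fix n
    \<comment> \<open>An even number of terms splits into the two parities, each bounded by the
      measure of \<open>S\<close>.\<close>
    have "(\<Sum>k<n. a k) \<le> (\<Sum>k<2 * n. a k)" using a0 by (intro sum_mono2) auto
    also have "\<dots> \<le> 2 * enn2real (?H S)"
    proof -
      have "ennreal (\<Sum>i<n. a (2 * i + j)) \<le> ennreal (enn2real (?H S))" for j
        using sum2[where m = n and j = j] fin[of S] a0 by (simp add: aH less_top)
      then have "(\<Sum>i<n. a (2 * i + j)) \<le> enn2real (?H S)" for j by simp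
      from this[of 0] this[of 1] show ?thesis unfolding sum_lessThan_double by simp
    qed
    finally show "(\<Sum>k<n. a k) \<le> 2 * enn2real (?H S)" .
  qed
  show ?thesis
  proof (rule ennreal_le_epsilon)
    fix e :: real assume e: "e > 0"
    obtain n where n: "norm (\<Sum>i. a (i + n)) < e" using suminf_exist_split[OF e \<open>summable a\<close>] by blast
    have "S - A \<subseteq> T n \<union> (\<Union>i. R (i + n))"
    proof
      fix x assume x: "x \<in> S - A"
      then have p: "?i x > 0" using A0[of x] infdist_nonneg[of x A] by simp
      show "x \<in> T n \<union> (\<Union>i. R (i + n))"
      proof (cases "x \<in> T n")
        case False
        then have lt: "?i x < 1 / real (Suc n)" using x by (auto simp: T_def)
        obtain N where N: "inverse (real (Suc N)) < ?i x" using reals_Archimedean[OF p] by blast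
        define k where "k = (LEAST k. 1 / real (Suc k) \<le> ?i x)"
        have ex: "1 / real (Suc N) \<le> ?i x" using N by (simp add: inverse_eq_divide)
        have k: "1 / real (Suc k) \<le> ?i x" unfolding k_def by (rule LeastI[of _ N]) (rule ex)
        have kn: "n < k"
        proof (rule ccontr)
          assume "\<not> n < k"
          then have "1 / real (Suc n) \<le> 1 / real (Suc k)" by (intro divide_left_mono) auto
          then show False using k lt by linarith
        qed
        then obtain j where j: "k = Suc j" "n \<le> j" by (cases k) auto
        have "\<not> 1 / real (Suc j) \<le> ?i x" using not_less_Least[of j "\<lambda>k. 1 / real (Suc k) \<le> ?i x"] j by (simp add: k_def)
        then have "x \<in> R j" using k j x by (simp add: R_def)
        moreover have "R j = R ((j - n) + n)" using j by simp
        ultimately show ?thesis by blast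
      qed simp
    qed
    then have "?H (S - A) \<le> ?H (T n \<union> (\<Union>i. R (i + n)))" by (rule hausdorff_outer_mono)
    also have "\<dots> \<le> ?H (T n) + ?H (\<Union>i. R (i + n))" by (rule hausdorff_outer_Un)
    also have "?H (\<Union>i. R (i + n)) \<le> (\<Sum>i. ?H (R (i + n)))" by (rule hausdorff_outer_UN)
    also have "(\<Sum>i. ?H (R (i + n))) = ennreal (\<Sum>i. a (i + n))"
      unfolding aH using \<open>summable a\<close> a0 by (intro suminf_ennreal2) (auto simp: summable_iff_shift)
    also have "\<dots> \<le> ennreal e" using n by (intro ennreal_leI) auto
    finally have "?H (S \<inter> A) + ?H (S - A) \<le> ?H (S \<inter> A) + (?H (T n) + ennreal e)"
      by (simp add: add_left_mono)
    also have "\<dots> \<le> ?H S + ennreal e"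
    proof -
      have "?H (S \<inter> A) + ?H (T n) \<le> ?H ((S \<inter> A) \<union> T n)"
      proof (rule hausdorff_outer_separated[where d = "1 / real (Suc n)"])
        fix x y assume "x \<in> S \<inter> A" "y \<in> T n"
        then show "1 / real (Suc n) \<le> dist x y" using infdist_le[of x A y] by (auto simp: T_def dist_commute)
      qed simp
      also have "\<dots> \<le> ?H S" by (rule hausdorff_outer_mono) (auto simp: T_def)
      finally show ?thesis by (simp add: add.assoc[symmetric] add_right_mono)
    qed
    finally show "?H (S \<inter> A) + ?H (S - A) \<le> ?H S + ennreal e" .
  qed
qed

lemma closed_in_sets_hausdorff_measure:
  fixes A :: "'a::metric_space set"
  assumes "closed A"
  shows "A \<in> sets (hausdorff_measure s)"
  unfolding sets_hausdorff_measure lambda_system_def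
proof (intro CollectI conjI ballI)
  fix S :: "'a set"
  have "hausdorff_outer s S \<le> hausdorff_outer s (S \<inter> A) + hausdorff_outer s (S - A)"
    using hausdorff_outer_Un[of s "S \<inter> A" "S - A"] by (simp add: Int_Diff_Un)
  then show "hausdorff_outer s (A \<inter> S) + hausdorff_outer s ((UNIV - A) \<inter> S) = hausdorff_outer s S"
    using closed_caratheodory[OF assms, of s S] by (intro antisym) (simp_all add: Int_commute Diff_eq)
qed simp

lemma space_hausdorff_measure [simp]: "space (hausdorff_measure s) = UNIV"
  by (simp add: hausdorff_measure_def space_measure_of_conv)

text \<open>The factor between the power \<open>d ^ s\<close> of a diameter and the normalised
  weight of a set with that diameter.\<close>

definition hausdorff_const :: "nat \<Rightarrow> real" where
  "hausdorff_const s = 2 ^ s / unit_ball_vol (real s)"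

lemma hausdorff_const_pos: "hausdorff_const s > 0"
  by (simp add: hausdorff_const_def)

text \<open>Each covering set that meets \<open>S\<close> is replaced by a ball around one of its
  points in \<open>S\<close>, with a radius slightly above the diameter. Finite partial sums are
  what is controlled, since compactness selects finitely many balls later.\<close>

lemma hausdorff_ball_cover:
  fixes S :: "'a::metric_space set"
  assumes b: "hausdorff_outer s S \<le> ennreal b" "b \<ge> 0" and \<delta>: "\<delta> > 0" and \<epsilon>: "\<epsilon> > 0"
  obtains P where "P \<subseteq> S \<times> {0<..<\<delta>}" "S \<subseteq> (\<Union>(x, r)\<in>P. ball x r)"
    "\<And>Q. finite Q \<Longrightarrow> Q \<subseteq> P \<Longrightarrow> (\<Sum>(x, r)\<in>Q. r ^ s) \<le> hausdorff_const s * b + \<epsilon>"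
proof -
  let ?c = "hausdorff_const s"
  have c: "?c > 0" by (rule hausdorff_const_pos)
  \<comment> \<open>Half of \<epsilon> pays for a cover that is only nearly optimal, the other half
    for enlarging the radii.\<close>
  define e where "e = \<epsilon> / (2 * ?c)"
  have e: "e > 0" using \<epsilon> c by (simp add: e_def)
  have ce: "?c * (b + e) = ?c * b + \<epsilon> / 2" using c by (simp add: e_def distrib_left)
  have "hausdorff_pre s (\<delta>/2) S \<le> hausdorff_outer s S"
    unfolding hausdorff_outer_def by (rule SUP_upper) (use \<delta> in auto)
  also have "\<dots> \<le> ennreal b" by (rule b)
  also have "\<dots> < ennreal (b + e)" using e b by (simp add: ennreal_lessI)
  finally obtain C where C: "C \<in> hausdorff_covers (\<delta>/2) S" "(\<Sum>i. hausdorff_weight s (C i)) < ennreal (b + e)"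
    unfolding hausdorff_pre_def INF_less_iff by blast
  have Cb: "bounded (C i)" "diameter (C i) \<le> \<delta> / 2" for i using C by (auto simp: hausdorff_covers_def)
  have dn: "diameter (C i) \<ge> 0" for i using Cb(1) by (rule diameter_ge_0)
  \<comment> \<open>Radii exceed the diameters strictly, because the balls are open and sets of
    diameter 0 occur. The mesh \<open>\<delta> / 2\<close> leaves room below \<delta>, and the
    excess in \<open>r ^ s\<close> is summable.\<close>
  have ex: "\<exists>r. diameter (C i) < r \<and> r < \<delta> \<and> r ^ s < diameter (C i) ^ s + \<epsilon> / 2 * (1/2) ^ Suc i" for i
  proof -
    let ?d = "diameter (C i)"
    have "((\<lambda>r::real. r ^ s) \<longlongrightarrow> ?d ^ s) (at_right ?d)" by (intro tendsto_intros)
    then have "\<forall>\<^sub>F r in at_right ?d. r ^ s < ?d ^ s + \<epsilon> / 2 * (1/2) ^ Suc i"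
      using \<epsilon> by (intro order_tendstoD) auto
    moreover have "\<forall>\<^sub>F r in at_right ?d. r \<in> {?d<..<\<delta>}"
      using Cb(2)[of i] \<delta> by (intro eventually_at_right_real) auto
    ultimately have "\<forall>\<^sub>F r in at_right ?d. r ^ s < ?d ^ s + \<epsilon> / 2 * (1/2) ^ Suc i \<and> r \<in> {?d<..<\<delta>}"
      by (rule eventually_conj)
    then obtain r where "r ^ s < ?d ^ s + \<epsilon> / 2 * (1/2) ^ Suc i \<and> r \<in> {?d<..<\<delta>}"
      using eventually_happens[of _ "at_right ?d"] trivial_limit_at_right_real by blast
    then show ?thesis by auto
  qed
  then obtain r where r: "\<And>i. diameter (C i) < r i" "\<And>i. r i < \<delta>" "\<And>i. r i ^ s < diameter (C i) ^ s + \<epsilon> / 2 * (1/2) ^ Suc i"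
    by metis
  have rpos: "0 < r i" for i by (rule le_less_trans[OF dn r(1)])
  define I where "I = {i. C i \<inter> S \<noteq> {}}"
  define x where "x = (\<lambda>i. SOME x. x \<in> C i \<inter> S)"
  have x: "x i \<in> C i \<inter> S" if "i \<in> I" for i
    unfolding x_def by (subst some_in_eq) (use that in \<open>simp add: I_def\<close>)
  define P where "P = (\<lambda>i. (x i, r i)) ` I"
  have wd: "ennreal (diameter (C i) ^ s) = ennreal ?c * hausdorff_weight s (C i)" if "i \<in> I" for i
  proof -
    have "C i \<noteq> {}" using that by (auto simp: I_def)
    moreover have "diameter (C i) ^ s = ?c * (unit_ball_vol (real s) * (diameter (C i) / 2) ^ s)"
    proof -
      have "unit_ball_vol (real s) \<noteq> 0" using unit_ball_vol_pos[of "real s"] by fastforce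
      then show ?thesis by (simp add: hausdorff_const_def power_divide)
    qed
    ultimately show ?thesis
      using dn[of i] c by (simp add: hausdorff_weight_def ennreal_mult)
  qed
  show ?thesis
  proof (rule that[of P])
    show "P \<subseteq> S \<times> {0<..<\<delta>}"
      using x r(2) rpos by (auto simp: P_def)
    show "S \<subseteq> (\<Union>(x, r)\<in>P. ball x r)"
    proof
      fix y assume y: "y \<in> S"
      then obtain i where i: "y \<in> C i" using C by (auto simp: hausdorff_covers_def)
      then have iI: "i \<in> I" using y by (auto simp: I_def)
      have "dist (x i) y \<le> diameter (C i)" using x[OF iI] i by (intro diameter_bounded_bound Cb) auto
      then have "y \<in> ball (x i) (r i)" using r(1)[of i] by simp
      then show "y \<in> (\<Union>(x, r)\<in>P. ball x r)" using iI by (auto simp: P_def)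
    qed
    fix Q assume Q: "finite Q" "Q \<subseteq> P"
    obtain J where J: "finite J" "J \<subseteq> I" "Q = (\<lambda>i. (x i, r i)) ` J"
      using finite_subset_image[OF Q[unfolded P_def]] by metis
    have "(\<Sum>(x, r)\<in>Q. r ^ s) \<le> (\<Sum>i\<in>J. r i ^ s)"
      unfolding J(3) using sum_image_le[OF J(1), of "\<lambda>(x, r). r ^ s" "\<lambda>i. (x i, r i)"] rpos
      by (simp add: o_def less_imp_le)
    also have "\<dots> \<le> (\<Sum>i\<in>J. diameter (C i) ^ s + \<epsilon> / 2 * (1/2) ^ Suc i)"
      using r(3) by (intro sum_mono less_imp_le)
    also have "\<dots> = (\<Sum>i\<in>J. diameter (C i) ^ s) + (\<Sum>i\<in>J. \<epsilon> / 2 * (1/2) ^ Suc i)" by (rule sum.distrib)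
    also have "(\<Sum>i\<in>J. diameter (C i) ^ s) \<le> ?c * (b + e)"
    proof -
      have "ennreal (\<Sum>i\<in>J. diameter (C i) ^ s) = (\<Sum>i\<in>J. ennreal (diameter (C i) ^ s))"
        using dn by (intro sum_ennreal[symmetric]) auto
      also have "\<dots> = (\<Sum>i\<in>J. ennreal ?c * hausdorff_weight s (C i))"
        using J(2) wd by (intro sum.cong) auto
      also have "\<dots> = ennreal ?c * (\<Sum>i\<in>J. hausdorff_weight s (C i))" by (simp add: sum_distrib_left)
      also have "\<dots> \<le> ennreal ?c * (\<Sum>i. hausdorff_weight s (C i))"
        using J(1) by (intro mult_left_mono sum_le_suminf) auto
      also have "\<dots> \<le> ennreal ?c * ennreal (b + e)" using C(2) by (intro mult_left_mono) auto
      also have "\<dots> = ennreal (?c * (b + e))" using c b e by (simp add: ennreal_mult)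
      finally show ?thesis using c b e by (simp add: ennreal_le_iff)
    qed
    also have "(\<Sum>i\<in>J. \<epsilon> / 2 * (1/2) ^ Suc i) \<le> \<epsilon> / 2"
    proof -
      have "(\<Sum>i\<in>J. \<epsilon> / 2 * (1/2) ^ Suc i) \<le> (\<Sum>i. \<epsilon> / 2 * (1/2) ^ Suc i)"
        using \<epsilon> J(1) sums_summable[OF sums_mult[OF power_half_series, of "\<epsilon>/2"]] by (intro sum_le_suminf) auto
      also have "\<dots> = \<epsilon> / 2" using sums_unique[OF sums_mult[OF power_half_series, of "\<epsilon>/2"]] by simp
      finally show ?thesis .
    qed
    finally show "(\<Sum>(x, r)\<in>Q. r ^ s) \<le> ?c * b + \<epsilon>"
      unfolding ce by simp
  qed
qed

section \<open>Covering a Lipschitz boundary\<close>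

lemma norm_projection_le:
  fixes e :: "'a::euclidean_space"
  assumes "norm e = 1" shows "norm (w - (w \<bullet> e) *\<^sub>R e) \<le> norm w"
proof -
  have "e \<bullet> e = 1" using assms by (simp add: norm_eq_1)
  then have "(w - (w \<bullet> e) *\<^sub>R e) \<bullet> (w - (w \<bullet> e) *\<^sub>R e) = w \<bullet> w - (w \<bullet> e) * (w \<bullet> e)"
    by (simp add: inner_simps inner_commute)
  also have "\<dots> \<le> w \<bullet> w" by simp
  finally show ?thesis by (simp add: norm_le)
qed

text \<open>The translates of \<open>T\<close> by multiples of \<open>\<delta> e\<close> are the centres of disjoint balls, so a comparison of
  \<open>N\<close>-dimensional volumes yields the \<open>(N - 1)\<close>-dimensional bound.\<close>

lemma graph_packing:
  fixes T :: "'a::euclidean_space set"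
  assumes e: "norm e = 1" and T: "finite T" "T \<subseteq> ball x0 R" and c: "0 < c" "c \<le> 1"
    and bl: "\<And>y y'. y \<in> T \<Longrightarrow> y' \<in> T \<Longrightarrow> c * norm (y - y') \<le> norm ((y - y') - ((y - y') \<bullet> e) *\<^sub>R e)"
    and sep: "\<And>y y'. y \<in> T \<Longrightarrow> y' \<in> T \<Longrightarrow> y \<noteq> y' \<Longrightarrow> \<delta> \<le> dist y y'"
    and \<delta>: "0 < \<delta>" "\<delta> \<le> 1"
  shows "real (card T) * \<delta> ^ (DIM('a) - 1) \<le> (\<bar>R\<bar> + 2) ^ DIM('a) * (2 / c) ^ DIM('a)"
proof -
  let ?N = "DIM('a)"
  \<comment> \<open>About \<open>1 / \<delta>\<close> vertical steps of length \<delta>, a column of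
    height at most 1, which supplies the missing dimension.\<close>
  define n where "n = nat \<lfloor>1 / \<delta>\<rfloor>"
  have n1: "real n * \<delta> \<le> 1"
  proof -
    have "real n \<le> 1 / \<delta>" using \<delta> unfolding n_def by simp
    then show ?thesis using \<delta> by (simp add: field_simps)
  qed
  have n2: "1 / \<delta> \<le> real (n + 1)" unfolding n_def using \<delta> by linarith
  define B where "B = (\<lambda>(t, k). ball (t + (real k * \<delta>) *\<^sub>R e) (c * \<delta> / 2))"
  let ?I = "T \<times> {0..n}"
  have fin: "finite ?I" using T by simp
  \<comment> \<open>Within a column the spacing is \<delta>. Centres in different columns are
    compared after projection along \<open>e\<close>, which removes the vertical shifts and by
    \<open>bl\<close> retains at least the fraction \<open>c\<close> of the distance.\<close>
  have far: "c * \<delta> \<le> dist (t + (real k * \<delta>) *\<^sub>R e) (t' + (real k' * \<delta>) *\<^sub>R e)"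
    if "t \<in> T" "t' \<in> T" "(t, k) \<noteq> (t', k')" for t t' k k'
  proof (cases "t = t'")
    case True
    then have "k \<noteq> k'" using that by simp
    then have "1 \<le> \<bar>real k - real k'\<bar>" by linarith
    then have "c * \<delta> \<le> \<bar>real k - real k'\<bar> * \<delta>" using c \<delta> by (intro mult_right_mono) auto
    also have "\<dots> = norm ((real k * \<delta> - real k' * \<delta>) *\<^sub>R e)"
      using e \<delta> by (simp add: left_diff_distrib[symmetric] abs_mult)
    finally show ?thesis using True by (simp add: dist_norm scaleR_diff_left)
  next
    case False
    let ?w = "(t + (real k * \<delta>) *\<^sub>R e) - (t' + (real k' * \<delta>) *\<^sub>R e)"
    have ee: "e \<bullet> e = 1" using e by (simp add: norm_eq_1)
    have "?w - (?w \<bullet> e) *\<^sub>R e = (t - t') - ((t - t') \<bullet> e) *\<^sub>R e"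
      by (simp add: inner_simps ee algebra_simps)
    then have "norm ((t - t') - ((t - t') \<bullet> e) *\<^sub>R e) \<le> norm ?w" using norm_projection_le[OF e, of ?w] by metis
    moreover have "c * \<delta> \<le> c * norm (t - t')" using sep[OF that(1,2) False] c by (simp add: dist_norm)
    ultimately show ?thesis using bl[OF that(1,2)] by (simp add: dist_norm)
  qed
  have disj: "disjoint_family_on B ?I"
    unfolding disjoint_family_on_def
  proof (intro ballI impI)
    fix i j assume "i \<in> ?I" "j \<in> ?I" "i \<noteq> j"
    then show "B i \<inter> B j = {}" using far[of "fst i" "fst j" "snd i" "snd j"]
      by (auto simp: B_def split_beta prod_eq_iff mult.commute intro!: disjoint_ballI)
  qed
  have sub: "(\<Union>i\<in>?I. B i) \<subseteq> ball x0 (\<bar>R\<bar> + 2)"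
  proof
    fix y assume "y \<in> (\<Union>i\<in>?I. B i)"
    then obtain t k where tk: "t \<in> T" "k \<le> n" "dist (t + (real k * \<delta>) *\<^sub>R e) y < c * \<delta> / 2" by (auto simp: B_def)
    have "norm ((real k * \<delta>) *\<^sub>R e) = real k * \<delta>" using e \<delta> by simp
    also have "\<dots> \<le> real n * \<delta>" using tk \<delta> by (intro mult_right_mono) auto
    finally have 1: "dist t (t + (real k * \<delta>) *\<^sub>R e) \<le> 1" using n1 by (simp add: dist_norm)
    have 2: "c * \<delta> / 2 < 1" using c \<delta> mult_mono[of c 1 \<delta> 1] by simp
    have 3: "dist x0 t < \<bar>R\<bar>" using T tk by auto
    show "y \<in> ball x0 (\<bar>R\<bar> + 2)"
      using dist_triangle[of x0 y t] dist_triangle[of t y "t + (real k * \<delta>) *\<^sub>R e"] 1 2 3 tk(3) by simp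
  qed
  let ?v = "unit_ball_vol (real ?N)"
  have v: "?v > 0" by simp
  have "real (card T) * real (n + 1) * (?v * (c * \<delta> / 2) ^ ?N) = (\<Sum>i\<in>?I. measure lborel (B i))"
    using c \<delta> by (simp add: B_def split_beta content_ball card_cartesian_product distrib_left)
  also have "\<dots> = measure lborel (\<Union>i\<in>?I. B i)"
  proof (rule measure_finite_Union[symmetric, OF fin _ disj])
    show "B ` ?I \<subseteq> sets lborel" by (auto simp: B_def)
    show "emeasure lborel (B i) \<noteq> \<infinity>" for i
      using emeasure_lborel_ball_finite by (auto simp: B_def split_beta less_top[symmetric])
  qed
  also have "\<dots> \<le> measure lborel (ball x0 (\<bar>R\<bar> + 2))"
  proof (rule measure_mono_fmeasurable[OF sub])
    show "(\<Union>i\<in>?I. B i) \<in> sets lborel" using fin by (intro sets.finite_UN) (auto simp: B_def)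
    show "ball x0 (\<bar>R\<bar> + 2) \<in> fmeasurable lborel"
      using emeasure_lborel_ball_finite by (auto simp: fmeasurable_def)
  qed
  also have "\<dots> = ?v * (\<bar>R\<bar> + 2) ^ ?N" by (simp add: content_ball)
  finally have "(real (card T) * real (n + 1) * (c * \<delta> / 2) ^ ?N) * ?v \<le> (\<bar>R\<bar> + 2) ^ ?N * ?v"
    by (simp add: mult_ac)
  then have A: "real (card T) * real (n + 1) * (c * \<delta> / 2) ^ ?N \<le> (\<bar>R\<bar> + 2) ^ ?N"
    using v by simp
  have "real (card T) * \<delta> ^ (?N - 1) * (c / 2) ^ ?N = real (card T) * (1 / \<delta>) * (c * \<delta> / 2) ^ ?N"
  proof -
    have "\<delta> ^ ?N = \<delta> * \<delta> ^ (?N - 1)" using DIM_positive by (metis power_minus_mult mult.commute)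
    then show ?thesis using \<delta> by (simp add: power_mult_distrib power_divide)
  qed
  also have "\<dots> \<le> real (card T) * real (n + 1) * (c * \<delta> / 2) ^ ?N"
    using n2 c \<delta> by (intro mult_right_mono mult_left_mono) auto
  also note A
  finally have "real (card T) * \<delta> ^ (?N - 1) * (c / 2) ^ ?N * (2 / c) ^ ?N \<le> (\<bar>R\<bar> + 2) ^ ?N * (2 / c) ^ ?N"
    using c by (intro mult_right_mono) auto
  moreover have "(c / 2) ^ ?N * (2 / c) ^ ?N = 1" using c by (simp add: power_mult_distrib[symmetric])
  ultimately show ?thesis by (simp add: mult.assoc)
qed

text \<open>The packing bound limits the size of \<delta>-separated subsets, so one of largest size
  exists; by maximality the balls of radius \<delta> around it cover, with a total weight bounded
  independently of \<delta>.\<close>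

lemma hausdorff_outer_graph_finite:
  fixes S :: "'a::euclidean_space set"
  assumes e: "norm e = 1" and S: "S \<subseteq> ball x0 R" and c: "0 < c" "c \<le> 1"
    and bl: "\<And>y y'. y \<in> S \<Longrightarrow> y' \<in> S \<Longrightarrow> c * norm (y - y') \<le> norm ((y - y') - ((y - y') \<bullet> e) *\<^sub>R e)"
  shows "hausdorff_outer (DIM('a) - 1) S < top"
proof -
  let ?s = "DIM('a) - 1"
  define V where "V = (\<bar>R\<bar> + 2) ^ DIM('a) * (2 / c) ^ DIM('a)"
  let ?v = "unit_ball_vol (real ?s)"
  have v: "?v > 0" by simp
  have V0: "V \<ge> 0" using c by (simp add: V_def)
  have small: "hausdorff_pre ?s (2 * \<delta>) S \<le> ennreal (?v * V)" if \<delta>: "0 < \<delta>" "\<delta> \<le> 1" for \<delta>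
  proof -
    define P where "P = (\<lambda>T. finite T \<and> T \<subseteq> S \<and> (\<forall>y\<in>T. \<forall>y'\<in>T. y \<noteq> y' \<longrightarrow> \<delta> \<le> dist y y'))"
    have pack: "real (card T) * \<delta> ^ ?s \<le> V" if "P T" for T
      unfolding V_def using that S by (intro graph_packing[OF e _ _ c bl _ \<delta>]) (auto simp: P_def)
    have "card T < nat \<lceil>V / \<delta> ^ ?s\<rceil> + 1" if "P T" for T
    proof -
      have "real (card T) \<le> V / \<delta> ^ ?s" using pack[OF that] \<delta> by (simp add: field_simps)
      then show ?thesis by linarith
    qed
    moreover have "P {}" by (simp add: P_def)
    ultimately obtain T where T: "P T" "\<And>T'. P T' \<Longrightarrow> card T' \<le> card T"
      using ex_has_greatest_nat[of P "{}" card "nat \<lceil>V / \<delta> ^ ?s\<rceil> + 1"] by (metis less_imp_le)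
    have cov: "S \<subseteq> (\<Union>t\<in>T. cball t \<delta>)"
    proof (rule ccontr)
      assume "\<not> S \<subseteq> (\<Union>t\<in>T. cball t \<delta>)"
      then obtain y where y0: "y \<in> S" "y \<notin> (\<Union>t\<in>T. cball t \<delta>)" by blast
      have y: "y \<in> S" "\<And>t. t \<in> T \<Longrightarrow> \<delta> < dist t y" using y0 by (auto simp: not_le)
      have "P (insert y T)" using T(1) y by (auto simp: P_def dist_commute less_imp_le)
      then have "card (insert y T) \<le> card T" by (rule T(2))
      moreover have "y \<notin> T" using y(2)[of y] \<delta> by auto
      ultimately show False using T(1) by (simp add: P_def)
    qed
    obtain h where h: "bij_betw h {0..<card T} T" using T(1) ex_bij_betw_nat_finite[of T] by (auto simp: P_def)
    define C where "C = (\<lambda>i. if i < card T then cball (h i) \<delta> else {})"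
    have "C \<in> hausdorff_covers (2 * \<delta>) S"
    proof -
      have "S \<subseteq> (\<Union>i. C i)"
      proof
        fix y assume "y \<in> S"
        then obtain t where "t \<in> T" "y \<in> cball t \<delta>" using cov by blast
        moreover then obtain i where "i < card T" "h i = t" using h unfolding bij_betw_def by (metis atLeastLessThan_iff imageE)
        ultimately show "y \<in> (\<Union>i. C i)" by (auto simp: C_def)
      qed
      then show ?thesis using \<delta> by (auto simp: hausdorff_covers_def C_def)
    qed
    then have "hausdorff_pre ?s (2 * \<delta>) S \<le> (\<Sum>i. hausdorff_weight ?s (C i))"
      unfolding hausdorff_pre_def by (rule INF_lower)
    also have "\<dots> = (\<Sum>i<card T. hausdorff_weight ?s (C i))"
      by (rule suminf_finite) (auto simp: C_def hausdorff_weight_def)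
    also have "\<dots> = (\<Sum>i<card T. ennreal (?v * \<delta> ^ ?s))"
      using \<delta> by (intro sum.cong refl) (auto simp: C_def hausdorff_weight_def)
    also have "\<dots> = ennreal (real (card T) * (?v * \<delta> ^ ?s))"
      using \<delta> v by (simp add: ennreal_mult ennreal_of_nat_eq_real_of_nat)
    also have "\<dots> \<le> ennreal (?v * V)"
      using pack[OF T(1)] v mult_left_mono[of "real (card T) * \<delta> ^ ?s" V ?v] by (intro ennreal_leI) (simp add: mult_ac)
    finally show ?thesis .
  qed
  have "hausdorff_outer ?s S \<le> ennreal (?v * V)"
    unfolding hausdorff_outer_def
  proof (rule SUP_least)
    fix d :: real assume d: "d \<in> {0<..}"
    \<comment> \<open>The packing bound requires a separation of at most 1; passing to a finer mesh
      only increases \<open>hausdorff_pre\<close>.\<close>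
    let ?\<delta> = "min (d/2) 1"
    have "hausdorff_pre ?s d S \<le> hausdorff_pre ?s (2 * ?\<delta>) S" by (rule hausdorff_pre_antimono) auto
    also have "\<dots> \<le> ennreal (?v * V)" using d by (intro small) auto
    finally show "hausdorff_pre ?s d S \<le> ennreal (?v * V)" .
  qed
  then show ?thesis by (rule order_le_less_trans) simp
qed

text \<open>Locally the frontier lies on a Lipschitz graph, on which the projection along
  \<open>e\<close> is injective with Lipschitz inverse; compactness leaves finitely many such
  pieces.\<close>

lemma hausdorff_outer_frontier_finite:
  fixes \<Omega> :: "'a::euclidean_space set"
  assumes \<Omega>: "open \<Omega>" "bounded \<Omega>" "lipschitz_boundary \<Omega>"
  shows "hausdorff_outer (DIM('a) - 1) (frontier \<Omega>) < top"
proof -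
  let ?H = "hausdorff_outer (DIM('a) - 1) :: 'a set \<Rightarrow> ennreal"
  have loc: "\<exists>r>0. ?H (frontier \<Omega> \<inter> ball x r) < top" if x: "x \<in> frontier \<Omega>" for x
  proof -
    obtain e \<gamma> L r where e: "norm e = 1" "r > 0" "L-lipschitz_on {y. y \<bullet> e = 0} \<gamma>"
      and eq: "\<Omega> \<inter> ball x r = {y \<in> ball x r. \<gamma> (y - (y \<bullet> e) *\<^sub>R e) < y \<bullet> e}"
      using \<Omega>(3) x unfolding lipschitz_boundary_def by meson
    have ee: "e \<bullet> e = 1" using e by (simp add: norm_eq_1)
    have L: "L \<ge> 0" using e(3) by (rule lipschitz_on_nonneg)
    define p where "p = (\<lambda>y. y - (y \<bullet> e) *\<^sub>R e)"
    have pH: "p y \<bullet> e = 0" for y by (simp add: p_def inner_diff_left ee)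
    have cont: "continuous_on UNIV (\<lambda>y. y \<bullet> e - \<gamma> (p y))"
    proof (intro continuous_intros)
      show "continuous_on UNIV (\<lambda>y. \<gamma> (p y))"
        by (rule continuous_on_compose2[OF lipschitz_on_continuous_on[OF e(3)]])
           (use pH in \<open>auto simp: p_def intro!: continuous_intros\<close>)
    qed
    \<comment> \<open>Points above the graph lie in the open set \<Omega>, and points strictly below
      it have a neighbourhood that misses \<Omega>; neither kind belongs to the frontier.\<close>
    have on_graph: "\<gamma> (p y) = y \<bullet> e" if y: "y \<in> frontier \<Omega> \<inter> ball x r" for y
    proof (rule ccontr)
      assume n: "\<gamma> (p y) \<noteq> y \<bullet> e"
      have "y \<notin> \<Omega>" using y \<Omega>(1) by (simp add: frontier_def interior_open)
      then have "\<not> \<gamma> (p y) < y \<bullet> e" using eq y by (auto simp: p_def)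
      then have neg: "y \<bullet> e - \<gamma> (p y) < 0" using n by simp
      let ?U = "ball x r \<inter> {z. z \<bullet> e - \<gamma> (p z) < 0}"
      have "open ?U" by (intro open_Int open_ball open_Collect_less cont continuous_intros)
      moreover have "y \<in> ?U" using y neg by auto
      moreover have "y \<in> closure \<Omega>" using y by (simp add: frontier_def)
      ultimately obtain z where z: "z \<in> \<Omega>" "z \<in> ?U" by (meson closure_iff_nhds_not_empty disjoint_iff order_refl)
      then have "z \<in> \<Omega> \<inter> ball x r" by auto
      then have "\<gamma> (p z) < z \<bullet> e" using eq by (auto simp: p_def)
      then show False using z by auto
    qed
    have "?H (frontier \<Omega> \<inter> ball x r) < top"
    \<comment> \<open>The height difference is at most \<open>L\<close> times the projected
      distance, so the full distance is at most \<open>1 + L\<close> times the projected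
      one.\<close>
    proof (rule hausdorff_outer_graph_finite[OF e(1), where c = "1 / (1 + L)"])
      show "frontier \<Omega> \<inter> ball x r \<subseteq> ball x r" by auto
      show "0 < 1 / (1 + L)" "1 / (1 + L) \<le> 1" using L by auto
      fix y y' assume y: "y \<in> frontier \<Omega> \<inter> ball x r" "y' \<in> frontier \<Omega> \<inter> ball x r"
      have "\<bar>y \<bullet> e - y' \<bullet> e\<bar> = dist (\<gamma> (p y)) (\<gamma> (p y'))" using on_graph[OF y(1)] on_graph[OF y(2)] by (simp add: dist_real_def)
      also have "\<dots> \<le> L * dist (p y) (p y')" using pH by (intro lipschitz_onD[OF e(3)]) auto
      finally have 1: "\<bar>(y - y') \<bullet> e\<bar> \<le> L * norm (p y - p y')" by (simp add: dist_norm inner_diff_left)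
      have peq: "p y - p y' = (y - y') - ((y - y') \<bullet> e) *\<^sub>R e" by (simp add: p_def algebra_simps)
      have "norm (y - y') \<le> norm (p y - p y') + norm (((y - y') \<bullet> e) *\<^sub>R e)"
        using norm_triangle_ineq[of "p y - p y'" "((y - y') \<bullet> e) *\<^sub>R e"] by (simp add: peq)
      also have "\<dots> \<le> (1 + L) * norm (p y - p y')" using 1 e(1) by (simp add: distrib_right)
      finally show "1 / (1 + L) * norm (y - y') \<le> norm ((y - y') - ((y - y') \<bullet> e) *\<^sub>R e)"
        using L by (simp add: peq field_simps)
    qed
    then show ?thesis using e(2) by blast
  qed
  then obtain r where r: "\<And>x. x \<in> frontier \<Omega> \<Longrightarrow> r x > 0 \<and> ?H (frontier \<Omega> \<inter> ball x (r x)) < top" by metis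
  have cf: "compact (frontier \<Omega>)" using \<Omega>(2) by (rule compact_frontier_bounded)
  have cov: "frontier \<Omega> \<subseteq> (\<Union>x\<in>frontier \<Omega>. ball x (r x))" using r by force
  obtain C where C: "C \<subseteq> frontier \<Omega>" "finite C" "frontier \<Omega> \<subseteq> (\<Union>x\<in>C. ball x (r x))"
    by (rule compactE_image[OF cf _ cov]) auto
  have "?H (\<Union>x\<in>C'. frontier \<Omega> \<inter> ball x (r x)) < top" if "C' \<subseteq> C" for C'
    using finite_subset[OF that C(2)] that
  proof (induction C' rule: finite_induct)
    case (insert x C')
    have "?H (\<Union>x\<in>insert x C'. frontier \<Omega> \<inter> ball x (r x)) \<le> ?H (frontier \<Omega> \<inter> ball x (r x)) + ?H (\<Union>x\<in>C'. frontier \<Omega> \<inter> ball x (r x))"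
      using hausdorff_outer_Un by simp
    also have "\<dots> < top" using insert r[of x] C(1) by auto
    finally show ?case .
  qed simp
  moreover have "frontier \<Omega> \<subseteq> (\<Union>x\<in>C. frontier \<Omega> \<inter> ball x (r x))" using C(3) by auto
  ultimately show ?thesis using hausdorff_outer_mono order_le_less_trans by blast
qed

text \<open>Moving the centre translates the ball, whose indicator is continuous under translation
  in L1. Continuity makes the sets of points with small averages closed, hence measurable for the
  Hausdorff measure.\<close>

lemma continuous_on_ball_integral:
  fixes m :: "'a::euclidean_space \<Rightarrow> real"
  assumes m: "m \<in> borel_measurable borel" "\<And>x. 0 \<le> m x \<and> m x \<le> 1"
  shows "continuous_on UNIV (\<lambda>x. \<integral>y. indicator (ball x r) y * m y \<partial>lborel)"
  unfolding continuous_on_iff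
proof (intro ballI allI impI)
  fix x :: 'a and e :: real assume e: "e > 0"
  have ib: "integrable lborel (indicator (ball x r) :: 'a \<Rightarrow> real)" for x :: 'a
    using emeasure_lborel_ball_finite by (intro integrable_real_indicator) auto
  have im: "integrable lborel (\<lambda>y. indicator (ball x r) y * m y)" for x
    by (rule integrable_mult_bounded[OF ib, where B = 1]) (use m in auto)
  obtain d where d: "d > 0" "\<And>h. norm h < d \<Longrightarrow> (\<integral>y. \<bar>indicator (ball x r) (y + h) - indicator (ball x r) y :: real\<bar> \<partial>lborel) < e"
    using L1_translation_small[OF ib e] by metis
  show "\<exists>d>0. \<forall>x'\<in>UNIV. dist x' x < d \<longrightarrow> dist (LBINT y. indicator (ball x' r) y * m y) (LBINT y. indicator (ball x r) y * m y) < e"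
  proof (intro exI[of _ d] conjI ballI impI d(1))
    fix x' assume x': "dist x' x < d"
    have sh: "indicator (ball x' r) y = (indicator (ball x r) (y + (x - x')) :: real)" for y
      by (auto simp: indicator_def dist_norm algebra_simps norm_minus_commute)
    have "dist (LBINT y. indicator (ball x' r) y * m y) (LBINT y. indicator (ball x r) y * m y)
      = \<bar>\<integral>y. indicator (ball x' r) y * m y - indicator (ball x r) y * m y \<partial>lborel\<bar>"
      using im by (simp add: dist_real_def)
    also have "\<dots> \<le> (LBINT y. \<bar>indicator (ball x r) (y + (x - x')) - indicator (ball x r) y\<bar>)"
    proof (rule order_trans[OF integral_abs_bound], rule integral_mono)
      show "integrable lborel (\<lambda>y. \<bar>indicator (ball x' r) y * m y - indicator (ball x r) y * m y\<bar>)" using im by simp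
      show "integrable lborel (\<lambda>y. \<bar>indicator (ball x r) (y + (x - x')) - indicator (ball x r) y\<bar> :: real)"
        by (rule integrable_translation_diff[OF ib])
      fix y
      have "\<bar>indicator (ball x' r) y * m y - indicator (ball x r) y * m y\<bar> = \<bar>indicator (ball x' r) y - indicator (ball x r) y\<bar> * m y"
        using m(2)[of y] unfolding left_diff_distrib[symmetric] abs_mult by simp
      also have "\<dots> \<le> \<bar>indicator (ball x' r) y - indicator (ball x r) y\<bar> * 1" using m(2)[of y] by (intro mult_left_mono) auto
      finally show "\<bar>indicator (ball x' r) y * m y - indicator (ball x r) y * m y\<bar> \<le> \<bar>indicator (ball x r) (y + (x - x')) - indicator (ball x r) y\<bar>"
        by (simp add: sh)
    qed
    also have "\<dots> < e" using x' by (intro d(2)) (simp add: dist_norm norm_minus_commute)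
    finally show "dist (LBINT y. indicator (ball x' r) y * m y) (LBINT y. indicator (ball x r) y * m y) < e" .
  qed
qed

lemma sum_Un_le:
  fixes f :: "'b \<Rightarrow> real"
  assumes "finite A" "finite B" "\<And>x. x \<in> A \<union> B \<Longrightarrow> 0 \<le> f x"
  shows "sum f (A \<union> B) \<le> sum f A + sum f B"
proof -
  have "sum f (A \<union> B) + sum f (A \<inter> B) = sum f A + sum f B" using assms by (intro sum.union_inter)
  moreover have "0 \<le> sum f (A \<inter> B)" using assms by (intro sum_nonneg) auto
  ultimately show ?thesis by linarith
qed

text \<open>\<open>\<Gamma>\<close> is split into \<open>D\<close>, a set where the averages of \<open>m\<close> are uniformly small, and a set of small
  measure, as in Egorov's theorem; on the first and the third the trivial bound \<open>m \<le> 1\<close> is used.\<close>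

lemma boundary_cover:
  fixes m :: "'a::euclidean_space \<Rightarrow> real" and \<Gamma> D :: "'a set"
  defines "s \<equiv> DIM('a) - 1"
  defines "J \<equiv> \<lambda>x r. \<integral>y. indicator (ball x r) y * m y \<partial>lborel"
  assumes \<Gamma>: "compact \<Gamma>" "hausdorff_outer s \<Gamma> < top"
    and D: "D \<in> sets (hausdorff_measure s)" "D \<subseteq> \<Gamma>"
    and m: "m \<in> borel_measurable borel" "\<And>x. 0 \<le> m x \<and> m x \<le> 1"
    and ae: "AE x in hausdorff_measure s. x \<in> \<Gamma> - D \<longrightarrow> ((\<lambda>r. J x r / r ^ DIM('a)) \<longlongrightarrow> 0) (at_right 0)"
    and \<epsilon>: "\<epsilon> > 0"
  obtains Q where "finite Q" "Q \<subseteq> \<Gamma> \<times> {0<..}" "\<Gamma> \<subseteq> (\<Union>(x, r)\<in>Q. ball x r)"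
    "(\<Sum>(x, r)\<in>Q. J x (2 * r) / r) \<le> unit_ball_vol (real DIM('a)) * 2 ^ DIM('a) * hausdorff_const s * measure (hausdorff_measure s) D + \<epsilon>"
    "(\<Sum>(x, r)\<in>Q. r ^ DIM('a)) \<le> \<epsilon>"
proof -
  let ?N = "DIM('a)" and ?H = "hausdorff_outer s :: 'a set \<Rightarrow> ennreal" and ?M = "hausdorff_measure s :: 'a measure"
  let ?v = "unit_ball_vol (real ?N)" and ?c = "hausdorff_const s"
  have Ns: "?N = Suc s" unfolding s_def using DIM_positive[where 'a = 'a] by linarith
  have v: "?v > 0" by simp
  have c: "?c > 0" by (rule hausdorff_const_pos)
  have \<Gamma>m: "\<Gamma> \<in> sets ?M" by (rule closed_in_sets_hausdorff_measure[OF compact_imp_closed[OF \<Gamma>(1)]])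
  have fin: "emeasure ?M B < top" if "B \<subseteq> \<Gamma>" for B
    using emeasure_mono[OF that \<Gamma>m] \<Gamma>(2) emeasure_hausdorff_measure[OF \<Gamma>m] by (simp add: order_le_less_trans)
  have Hm: "?H B = ennreal (measure ?M B)" if "B \<subseteq> \<Gamma>" "B \<in> sets ?M" for B
    using emeasure_hausdorff_measure[OF that(2)] fin[OF that(1)] emeasure_eq_ennreal_measure[of ?M B] by (simp add: less_top)
  have ib: "integrable lborel (indicator (ball x r) :: 'a \<Rightarrow> real)" for x :: 'a and r
    using emeasure_lborel_ball_finite by (intro integrable_real_indicator) auto
  have im: "integrable lborel (\<lambda>y. indicator (ball x r) y * m y)" for x r
    by (rule integrable_mult_bounded[OF ib, where B = 1]) (use m in auto)
  have J0: "0 \<le> J x r" for x r unfolding J_def using m by (intro integral_nonneg_AE) auto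
  have Jle: "J x r \<le> ?v * r ^ ?N" if "r \<ge> 0" for x r
  proof -
    have "J x r \<le> (LBINT y. indicator (ball x r) y)"
      unfolding J_def by (rule integral_mono[OF im ib]) (use m in \<open>auto simp: indicator_def\<close>)
    also have "\<dots> = ?v * r ^ ?N" using that by (simp add: content_ball)
    finally show ?thesis .
  qed
  define bD where "bD = measure ?M D"
  define b\<Gamma> where "b\<Gamma> = measure ?M \<Gamma>"
  have b0: "bD \<ge> 0" "b\<Gamma> \<ge> 0" by (auto simp: bD_def b\<Gamma>_def)
  \<comment> \<open>The total coefficient of \<open>e\<close> in the final estimate of the first
    sum.\<close>
  define X where "X = ?v * 2 ^ ?N * (2 + ?c) + 2 ^ ?N * (?c * b\<Gamma> + 1)"
  have X: "X > 0" using v c b0 by (auto simp: X_def intro!: add_pos_pos mult_pos_pos add_nonneg_pos)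
  define e where "e = min 1 (\<epsilon> / X)"
  have e: "e > 0" "e \<le> 1" "e * X \<le> \<epsilon>" using X \<epsilon> by (auto simp: e_def min_def field_simps)
  \<comment> \<open>Points whose averages stay within the tolerance at all scales under
    \<open>1 / real (Suc k)\<close>. The intersection is uncountable, but its members are
    closed.\<close>
  define A where "A = (\<lambda>k::nat. \<Inter>r\<in>{0<..<1 / real (Suc k)}. {x. J x r \<le> e * r ^ ?N})"
  have Am: "A k \<in> sets ?M" for k
    unfolding A_def
    by (intro closed_in_sets_hausdorff_measure closed_INT ballI closed_Collect_le continuous_intros)
       (auto simp: J_def intro: continuous_on_ball_integral[OF m])
  define R where "R = (\<lambda>k. \<Gamma> - D - A k)"
  have Rm: "R k \<in> sets ?M" for k unfolding R_def using \<Gamma>m D Am by auto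
  have "decseq R"
  proof (rule decseq_SucI)
    fix k
    have "A k \<subseteq> A (Suc k)"
    proof
      fix x assume x: "x \<in> A k"
      show "x \<in> A (Suc k)" unfolding A_def
      proof (intro INT_I)
        fix r assume r: "r \<in> {0<..<1 / real (Suc (Suc k))}"
        have "1 / real (Suc (Suc k)) \<le> 1 / real (Suc k)" by (intro divide_left_mono) auto
        then have "r \<in> {0<..<1 / real (Suc k)}" using r by auto
        then show "x \<in> {x. J x r \<le> e * r ^ ?N}" using x by (auto simp: A_def)
      qed
    qed
    then show "R (Suc k) \<subseteq> R k" by (auto simp: R_def)
  qed
  then have lim: "(\<lambda>k. emeasure ?M (R k)) \<longlonglongrightarrow> emeasure ?M (\<Inter>k. R k)"
    using Rm fin[of "R _"] by (intro Lim_emeasure_decseq) (auto simp: R_def less_top)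
  \<comment> \<open>Pointwise convergence puts almost every point of \<open>\<Gamma> - D\<close>
    into some \<open>A k\<close>; as \<Gamma> has finite measure, the decreasing sets
    \<open>R k\<close> become small in measure.\<close>
  have "AE x in ?M. x \<notin> (\<Inter>k. R k)"
    using ae
  proof eventually_elim
    case (elim x)
    show ?case
    proof
      assume x: "x \<in> (\<Inter>k. R k)"
      then have "((\<lambda>r. J x r / r ^ ?N) \<longlongrightarrow> 0) (at_right 0)" using elim by (auto simp: R_def)
      then have "\<forall>\<^sub>F r in at_right 0. J x r / r ^ ?N < e" using e(1) by (rule order_tendstoD)
      then obtain b where b: "b > 0" "\<And>r. 0 < r \<Longrightarrow> r < b \<Longrightarrow> J x r / r ^ ?N < e"
        unfolding eventually_at_right_field by auto
      obtain k where k: "inverse (real (Suc k)) < b" using reals_Archimedean[OF b(1)] by blast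
      have "x \<in> A k" unfolding A_def
      proof (intro INT_I CollectI)
        fix r assume "r \<in> {0<..<1 / real (Suc k)}"
        then have r: "0 < r" "r < b" using k by (auto simp: inverse_eq_divide)
        then show "J x r \<le> e * r ^ ?N" using b(2)[OF r] by (simp add: field_simps)
      qed
      then show False using x by (auto simp: R_def)
    qed
  qed
  moreover have "(\<Inter>k. R k) \<in> sets ?M" using Rm by (intro sets.countable_INT) auto
  ultimately have "emeasure ?M (\<Inter>k. R k) = 0" by (simp add: AE_iff_null_sets null_setsD1)
  with lim have "(\<lambda>k. emeasure ?M (R k)) \<longlonglongrightarrow> 0" by simp
  then have "\<forall>\<^sub>F k in sequentially. emeasure ?M (R k) < ennreal e" using e(1) by (intro order_tendstoD) auto
  then obtain k where k: "emeasure ?M (R k) < ennreal e" by (auto simp: eventually_sequentially)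
  define Y where "Y = (?c * bD + e) + (?c * b\<Gamma> + 1) + (?c * e + e)"
  have Y: "Y > 0" using c b0 e by (auto simp: Y_def intro!: add_pos_pos add_nonneg_pos)
  \<comment> \<open>The first bound makes the sum of \<open>r ^ N\<close> small, because
    \<open>r ^ N \<le> \<delta> * r ^ s\<close>; the second brings the doubled radius
    \<open>2 * r\<close> under the scale of \<open>A k\<close>.\<close>
  define \<delta> where "\<delta> = min (\<epsilon> / Y) (1 / (2 * real (Suc k)))"
  have \<delta>: "\<delta> > 0" "\<delta> * Y \<le> \<epsilon>" "2 * \<delta> \<le> 1 / real (Suc k)"
    using Y \<epsilon> by (auto simp: \<delta>_def min_def field_simps)
  obtain P1 where P1: "P1 \<subseteq> D \<times> {0<..<\<delta>}" "D \<subseteq> (\<Union>(x, r)\<in>P1. ball x r)"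
    "\<And>Q. finite Q \<Longrightarrow> Q \<subseteq> P1 \<Longrightarrow> (\<Sum>(x, r)\<in>Q. r ^ s) \<le> ?c * bD + e"
    using hausdorff_ball_cover[of s D bD \<delta> e] Hm[OF D(2,1)] b0 \<delta>(1) e(1) unfolding bD_def by (metis order_refl)
  have HA: "?H ((\<Gamma> - D) \<inter> A k) \<le> ennreal b\<Gamma>"
    using hausdorff_outer_mono[of "(\<Gamma> - D) \<inter> A k" \<Gamma> s] Hm[OF _ \<Gamma>m] unfolding b\<Gamma>_def by auto
  \<comment> \<open>The slack may be 1 here, since in the first sum every term of this family
    carries a factor \<open>e\<close>.\<close>
  obtain P2 where P2: "P2 \<subseteq> ((\<Gamma> - D) \<inter> A k) \<times> {0<..<\<delta>}" "(\<Gamma> - D) \<inter> A k \<subseteq> (\<Union>(x, r)\<in>P2. ball x r)"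
    "\<And>Q. finite Q \<Longrightarrow> Q \<subseteq> P2 \<Longrightarrow> (\<Sum>(x, r)\<in>Q. r ^ s) \<le> ?c * b\<Gamma> + 1"
    using hausdorff_ball_cover[OF HA b0(2) \<delta>(1), of 1] by (metis zero_less_one)
  have HR: "?H (R k) \<le> ennreal e" using k emeasure_hausdorff_measure[OF Rm[of k]] by (simp add: less_imp_le)
  obtain P3 where P3: "P3 \<subseteq> R k \<times> {0<..<\<delta>}" "R k \<subseteq> (\<Union>(x, r)\<in>P3. ball x r)"
    "\<And>Q. finite Q \<Longrightarrow> Q \<subseteq> P3 \<Longrightarrow> (\<Sum>(x, r)\<in>Q. r ^ s) \<le> ?c * e + e"
    using hausdorff_ball_cover[OF HR less_imp_le[OF e(1)] \<delta>(1) e(1)] by metis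
  let ?P = "P1 \<union> P2 \<union> P3"
  have Psub: "?P \<subseteq> \<Gamma> \<times> {0<..<\<delta>}" using P1(1) P2(1) P3(1) D(2) by (auto simp: R_def)
  have "\<Gamma> \<subseteq> D \<union> ((\<Gamma> - D) \<inter> A k) \<union> R k" by (auto simp: R_def)
  then have cover: "\<Gamma> \<subseteq> (\<Union>p\<in>?P. case p of (x, r) \<Rightarrow> ball x r)" using P1(2) P2(2) P3(2) by blast
  have op: "open (case p of (x, r) \<Rightarrow> ball x r)" for p :: "'a \<times> real" by (simp add: split_beta)
  obtain Q where Q: "Q \<subseteq> ?P" "finite Q" "\<Gamma> \<subseteq> (\<Union>p\<in>Q. case p of (x, r) \<Rightarrow> ball x r)"
    by (rule compactE_image[OF \<Gamma>(1) op cover]) (rule that)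
  have Qpos: "0 < r \<and> r < \<delta>" if "(x, r) \<in> Q" for x r using subsetD[OF Psub subsetD[OF Q(1) that]] by simp
  \<comment> \<open>The families may share balls, so splitting a sum of nonnegative terms costs an
    inequality.\<close>
  have split3: "(\<Sum>p\<in>Q. f p) \<le> (\<Sum>p\<in>Q \<inter> P1. f p) + (\<Sum>p\<in>Q \<inter> P2. f p) + (\<Sum>p\<in>Q \<inter> P3. f p)"
    if "\<And>p. p \<in> Q \<Longrightarrow> 0 \<le> f p" for f :: "'a \<times> real \<Rightarrow> real"
  proof -
    have "Q = (Q \<inter> P1 \<union> Q \<inter> P2) \<union> Q \<inter> P3" using Q(1) by auto
    then have "sum f Q \<le> sum f (Q \<inter> P1 \<union> Q \<inter> P2) + sum f (Q \<inter> P3)"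
      using sum_Un_le[of "Q \<inter> P1 \<union> Q \<inter> P2" "Q \<inter> P3" f] Q(2) that by auto
    also have "sum f (Q \<inter> P1 \<union> Q \<inter> P2) \<le> sum f (Q \<inter> P1) + sum f (Q \<inter> P2)"
      using sum_Un_le[of "Q \<inter> P1" "Q \<inter> P2" f] Q(2) that by auto
    finally show ?thesis by simp
  qed
  have S1: "(\<Sum>(x, r)\<in>Q \<inter> P1. r ^ s) \<le> ?c * bD + e" using P1(3) Q(2) by auto
  have S2: "(\<Sum>(x, r)\<in>Q \<inter> P2. r ^ s) \<le> ?c * b\<Gamma> + 1" using P2(3) Q(2) by auto
  have S3: "(\<Sum>(x, r)\<in>Q \<inter> P3. r ^ s) \<le> ?c * e + e" using P3(3) Q(2) by auto
  have crude: "J x (2 * r) / r \<le> ?v * 2 ^ ?N * r ^ s" if "r > 0" for x r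
  proof -
    have "J x (2 * r) / r \<le> ?v * (2 * r) ^ ?N / r" using Jle[of "2 * r" x] that by (intro divide_right_mono) auto
    also have "\<dots> = ?v * 2 ^ ?N * r ^ s" using that by (simp add: Ns power_mult_distrib)
    finally show ?thesis .
  qed
  have fine: "J x (2 * r) / r \<le> e * 2 ^ ?N * r ^ s" if "(x, r) \<in> P2" for x r
  proof -
    have r: "0 < r" "r < \<delta>" "x \<in> A k" using that P2(1) by auto
    then have "2 * r \<in> {0<..<1 / real (Suc k)}" using \<delta>(3) by auto
    then have "J x (2 * r) \<le> e * (2 * r) ^ ?N" using r(3) unfolding A_def by blast
    then have "J x (2 * r) / r \<le> e * (2 * r) ^ ?N / r" using r by (intro divide_right_mono) auto
    also have "\<dots> = e * 2 ^ ?N * r ^ s" using r by (simp add: Ns power_mult_distrib)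
    finally show ?thesis .
  qed
  show ?thesis
  proof (rule that[of Q])
    show "finite Q" by (rule Q(2))
    show "Q \<subseteq> \<Gamma> \<times> {0<..}" using order_trans[OF Q(1) Psub] by auto
    show "\<Gamma> \<subseteq> (\<Union>(x, r)\<in>Q. ball x r)" by (rule Q(3))
    have "(\<Sum>(x, r)\<in>Q. J x (2 * r) / r)
      \<le> (\<Sum>(x, r)\<in>Q \<inter> P1. J x (2 * r) / r) + (\<Sum>(x, r)\<in>Q \<inter> P2. J x (2 * r) / r) + (\<Sum>(x, r)\<in>Q \<inter> P3. J x (2 * r) / r)"
      by (rule split3) (use Qpos J0 in \<open>force intro: divide_nonneg_pos\<close>)
    also have "\<dots> \<le> (\<Sum>(x, r)\<in>Q \<inter> P1. ?v * 2 ^ ?N * r ^ s) + (\<Sum>(x, r)\<in>Q \<inter> P2. e * 2 ^ ?N * r ^ s) + (\<Sum>(x, r)\<in>Q \<inter> P3. ?v * 2 ^ ?N * r ^ s)"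
      using crude fine Qpos by (intro add_mono sum_mono) auto
    also have "\<dots> = ?v * 2 ^ ?N * (\<Sum>(x, r)\<in>Q \<inter> P1. r ^ s) + e * 2 ^ ?N * (\<Sum>(x, r)\<in>Q \<inter> P2. r ^ s) + ?v * 2 ^ ?N * (\<Sum>(x, r)\<in>Q \<inter> P3. r ^ s)"
      by (simp add: sum_distrib_left split_beta)
    also have "\<dots> \<le> ?v * 2 ^ ?N * (?c * bD + e) + e * 2 ^ ?N * (?c * b\<Gamma> + 1) + ?v * 2 ^ ?N * (?c * e + e)"
      using S1 S2 S3 e v by (intro add_mono mult_left_mono) auto
    also have "\<dots> = ?v * 2 ^ ?N * ?c * bD + e * X" by (simp add: X_def algebra_simps)
    also have "\<dots> \<le> ?v * 2 ^ ?N * ?c * bD + \<epsilon>" using e(3) by simp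
    finally show "(\<Sum>(x, r)\<in>Q. J x (2 * r) / r) \<le> ?v * 2 ^ ?N * ?c * measure ?M D + \<epsilon>" by (simp add: bD_def)
    have "(\<Sum>(x, r)\<in>Q. r ^ ?N) \<le> (\<Sum>(x, r)\<in>Q. \<delta> * r ^ s)"
    proof (intro sum_mono, clarify)
      fix x r assume "(x, r) \<in> Q"
      from Qpos[OF this] show "r ^ ?N \<le> \<delta> * r ^ s" by (simp add: Ns mult_right_mono)
    qed
    also have "\<dots> = \<delta> * (\<Sum>(x, r)\<in>Q. r ^ s)" by (simp add: sum_distrib_left split_beta)
    also have "(\<Sum>(x, r)\<in>Q. r ^ s) \<le> Y"
    proof -
      have "(\<Sum>(x, r)\<in>Q. r ^ s) \<le> (\<Sum>(x, r)\<in>Q \<inter> P1. r ^ s) + (\<Sum>(x, r)\<in>Q \<inter> P2. r ^ s) + (\<Sum>(x, r)\<in>Q \<inter> P3. r ^ s)"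
        by (rule split3) (use Qpos in \<open>force intro: zero_le_power less_imp_le\<close>)
      then show ?thesis using S1 S2 S3 unfolding Y_def by linarith
    qed
    then have "\<delta> * (\<Sum>(x, r)\<in>Q. r ^ s) \<le> \<delta> * Y" using \<delta>(1) by (intro mult_left_mono) auto
    also note \<delta>(2)
    finally show "(\<Sum>(x, r)\<in>Q. r ^ ?N) \<le> \<epsilon>" .
  qed
qed

section \<open>Threshold and cutoff functions\<close>

text \<open>A threshold of class C1: 0 up to 1, at least \<open>1 / 2\<close> from 2 on, with slope
  at most 1. Its values stay below 1, so an integral over a ball is bounded by the volume of the
  ball.\<close>

definition threshold_pos :: "real \<Rightarrow> real" where
  "threshold_pos s = pos_sq (s - 1) / (1 + pos_sq (s - 1))"

definition threshold_pos' :: "real \<Rightarrow> real" where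
  "threshold_pos' s = 2 * max 0 (s - 1) / (1 + pos_sq (s - 1))\<^sup>2"

definition threshold :: "real \<Rightarrow> real" where
  "threshold s = threshold_pos s - threshold_pos (- s)"

definition threshold' :: "real \<Rightarrow> real" where
  "threshold' s = threshold_pos' s + threshold_pos' (- s)"

lemma one_plus_pos_sq: "1 + pos_sq t > 0"
  using pos_sq_nonneg[of t] by linarith

lemma threshold_pos_deriv: "(threshold_pos has_real_derivative threshold_pos' s) (at s)"
proof -
  have d: "((\<lambda>s. pos_sq (s - 1)) has_real_derivative 2 * max 0 (s - 1)) (at s)"
  proof -
    have "((\<lambda>s. s - 1) has_real_derivative 1) (at s)" by (auto intro!: derivative_eq_intros)
    from DERIV_chain2[OF pos_sq_has_real_derivative this] show ?thesis by simp
  qed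
  have "((\<lambda>s. pos_sq (s - 1) / (1 + pos_sq (s - 1))) has_real_derivative
     (2 * max 0 (s - 1) * (1 + pos_sq (s - 1)) - pos_sq (s - 1) * (0 + 2 * max 0 (s - 1))) / ((1 + pos_sq (s - 1)) * (1 + pos_sq (s - 1)))) (at s)"
    using one_plus_pos_sq[of "s - 1"] by (intro DERIV_divide DERIV_add DERIV_const d) auto
  moreover have "(2 * max 0 (s - 1) * (1 + pos_sq (s - 1)) - pos_sq (s - 1) * (0 + 2 * max 0 (s - 1))) = 2 * max 0 (s - 1)"
    by (simp add: algebra_simps)
  ultimately show ?thesis
    unfolding threshold_pos_def[abs_def] threshold_pos'_def power2_eq_square by simp
qed

lemma threshold_pos'_bounds: "0 \<le> threshold_pos' s" "threshold_pos' s \<le> 1"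
proof -
  show "0 \<le> threshold_pos' s" by (simp add: threshold_pos'_def)
  let ?a = "max 0 (s - 1)"
  have "2 * ?a \<le> 1 + ?a\<^sup>2" using zero_le_power2[of "?a - 1"] by (simp add: power2_diff)
  also have "\<dots> \<le> (1 + ?a\<^sup>2)\<^sup>2"
    using mult_right_mono[of 1 "1 + ?a\<^sup>2" "1 + ?a\<^sup>2"] by (simp add: power2_eq_square[of "1 + _"])
  finally show "threshold_pos' s \<le> 1"
    using one_plus_pos_sq[of "s - 1"] by (simp add: threshold_pos'_def pos_sq_def divide_le_eq_1)
qed

lemma threshold_pos_le_1: "s \<le> 1 \<Longrightarrow> threshold_pos s = 0" "s \<le> 1 \<Longrightarrow> threshold_pos' s = 0"
  by (auto simp: threshold_pos_def threshold_pos'_def pos_sq_def max_def)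

lemma threshold_pos_bounds: "0 \<le> threshold_pos s" "threshold_pos s \<le> 1"
  using pos_sq_nonneg[of "s - 1"] one_plus_pos_sq[of "s - 1"]
  by (auto simp: threshold_pos_def divide_le_eq_1)

lemma threshold_pos_ge: "2 \<le> s \<Longrightarrow> 1 / 2 \<le> threshold_pos s"
proof -
  assume s: "2 \<le> s"
  then have "1 \<le> pos_sq (s - 1)" using power_mono[of 1 "s - 1" 2] by (simp add: pos_sq_def)
  then show ?thesis by (simp add: threshold_pos_def field_simps)
qed

lemma threshold_deriv: "(threshold has_real_derivative threshold' s) (at s)"
proof -
  have "((\<lambda>s. - s) has_real_derivative - 1) (at s)" by (auto intro!: derivative_eq_intros)
  from DERIV_chain2[OF threshold_pos_deriv this]
  have "((\<lambda>s. threshold_pos (- s)) has_real_derivative - threshold_pos' (- s)) (at s)" by simp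
  from DERIV_diff[OF threshold_pos_deriv this] show ?thesis
    by (simp add: threshold_def[abs_def] threshold'_def)
qed

lemma continuous_on_threshold': "continuous_on UNIV threshold'"
  unfolding threshold'_def threshold_pos'_def
  using one_plus_pos_sq by (intro continuous_intros) (metis less_irrefl power_eq_0_iff)+

text \<open>The two summands live on \<open>s > 1\<close> and on \<open>s < - 1\<close>, so at most
  one of them is nonzero.\<close>

lemma threshold'_bounds: "0 \<le> threshold' s" "threshold' s \<le> 1"
  using threshold_pos'_bounds[of s] threshold_pos'_bounds[of "- s"] threshold_pos_le_1(2)[of s] threshold_pos_le_1(2)[of "- s"]
  by (auto simp: threshold'_def) linarith

lemma threshold_small: "\<bar>s\<bar> \<le> 1 \<Longrightarrow> threshold s = 0"
  by (simp add: threshold_def threshold_pos_le_1)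

lemma threshold_abs_le_1: "\<bar>threshold s\<bar> \<le> 1"
  using threshold_pos_bounds[of s] threshold_pos_bounds[of "- s"] by (auto simp: threshold_def)

lemma threshold_large: "2 \<le> \<bar>s\<bar> \<Longrightarrow> 1 / 2 \<le> \<bar>threshold s\<bar>"
  using threshold_pos_ge[of s] threshold_pos_ge[of "- s"] threshold_pos_le_1(1)[of s] threshold_pos_le_1(1)[of "- s"]
  by (auto simp: threshold_def abs_if split: if_splits)

text \<open>One bump per ball, added up and fed into \<open>pos_sq (1 - t)\<close>. Overlaps are
  harmless, because the gradient bound is a sum over the balls as well.\<close>

lemma ball_cutoff:
  fixes Q :: "('a::euclidean_space \<times> real) set"
  assumes Q: "finite Q" "\<And>a r. (a, r) \<in> Q \<Longrightarrow> r > 0"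
  obtains \<eta> \<eta>' where "has_C1_gradient \<eta> \<eta>'" "\<And>x. 0 \<le> \<eta> x \<and> \<eta> x \<le> 1"
    "\<And>x. x \<in> (\<Union>(a, r)\<in>Q. ball a r) \<Longrightarrow> \<eta> x = 0"
    "\<And>x. x \<notin> (\<Union>(a, r)\<in>Q. ball a (2 * r)) \<Longrightarrow> \<eta> x = 1"
    "\<And>x. norm (\<eta>' x) \<le> (\<Sum>(a, r)\<in>Q. 8 / r * indicator (ball a (2 * r)) x)"
proof -
  \<comment> \<open>For \<open>norm (x - a) \<le> r\<close> the argument of \<open>pos_sq\<close> is
    at least 3, so with the factor \<open>1 / 9\<close> the bump is at least 1; it is 0 from
    distance \<open>2 * r\<close> on.\<close>
  define \<beta> where "\<beta> = (\<lambda>(a::'a, r::real) x. 1 / 9 * pos_sq (4 - (x - a) \<bullet> (x - a) * (1 / r\<^sup>2)))"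
  define \<beta>' where "\<beta>' = (\<lambda>(a::'a, r::real) x. (1 / 9) *\<^sub>R ((- 4 * (1 / r\<^sup>2) * max 0 (4 - (x - a) \<bullet> (x - a) * (1 / r\<^sup>2))) *\<^sub>R (x - a)))"
  define \<sigma> where "\<sigma> = (\<lambda>x. \<Sum>p\<in>Q. \<beta> p x)"
  define \<sigma>' where "\<sigma>' = (\<lambda>x. \<Sum>p\<in>Q. \<beta>' p x)"
  have \<beta>0: "0 \<le> \<beta> p x" for p x by (simp add: \<beta>_def split_beta)
  have \<sigma>0: "0 \<le> \<sigma> x" for x unfolding \<sigma>_def by (intro sum_nonneg \<beta>0)
  have "has_C1_gradient (\<beta> p) (\<beta>' p)" for p
    unfolding \<beta>_def \<beta>'_def split_beta by (intro has_C1_gradient_cmult has_C1_gradient_pos_sq_dist)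
  then have \<sigma>: "has_C1_gradient \<sigma> \<sigma>'" unfolding \<sigma>_def \<sigma>'_def by (intro has_C1_gradient_sum)
  have d: "((\<lambda>t. pos_sq (1 - t)) has_real_derivative - 2 * max 0 (1 - t)) (at t)" for t
  proof -
    have "((\<lambda>t::real. 1 - t) has_real_derivative - 1) (at t)" by (auto intro!: derivative_eq_intros)
    from DERIV_chain2[OF pos_sq_has_real_derivative this] show ?thesis by simp
  qed
  have out: "\<beta> (a, r) x = 0 \<and> \<beta>' (a, r) x = 0" if ar: "(a, r) \<in> Q" and x: "x \<notin> ball a (2 * r)" for a r x
  proof -
    have "2 * r \<le> norm (x - a)" using x by (simp add: dist_norm norm_minus_commute)
    then have "(2 * r)\<^sup>2 \<le> (x - a) \<bullet> (x - a)" using Q(2)[OF ar] unfolding power2_norm_eq_inner[symmetric] by (intro power_mono) auto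
    then have "4 \<le> (x - a) \<bullet> (x - a) * (1 / r\<^sup>2)" using Q(2)[OF ar] by (simp add: power_mult_distrib field_simps)
    then show ?thesis by (simp add: \<beta>_def \<beta>'_def pos_sq_def max_def)
  qed
  have bd: "norm (\<beta>' (a, r) x) \<le> 4 / r * indicator (ball a (2 * r)) x" if ar: "(a, r) \<in> Q" for a r x
  proof (cases "x \<in> ball a (2 * r)")
    case True
    have r: "r > 0" by (rule Q(2)[OF ar])
    have "norm (x - a) \<le> 2 * r" using True by (simp add: dist_norm norm_minus_commute)
    moreover have "max 0 (4 - (x - a) \<bullet> (x - a) * (1 / r\<^sup>2)) \<le> 4" by simp
    ultimately have "max 0 (4 - (x - a) \<bullet> (x - a) * (1 / r\<^sup>2)) * norm (x - a) \<le> 4 * (2 * r)"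
      by (intro mult_mono) auto
    then have "4 * (1 / r\<^sup>2) * (max 0 (4 - (x - a) \<bullet> (x - a) * (1 / r\<^sup>2)) * norm (x - a)) \<le> 4 * (1 / r\<^sup>2) * (4 * (2 * r))"
      by (intro mult_left_mono) auto
    moreover have "norm (\<beta>' (a, r) x) = 1 / 9 * (4 * (1 / r\<^sup>2) * (max 0 (4 - (x - a) \<bullet> (x - a) * (1 / r\<^sup>2)) * norm (x - a)))"
      by (simp add: \<beta>'_def abs_mult)
    ultimately have "norm (\<beta>' (a, r) x) \<le> 1 / 9 * (4 * (1 / r\<^sup>2) * (4 * (2 * r)))" by simp
    \<comment> \<open>The value \<open>32 / (9 * r)\<close> is rounded up.\<close>
    also have "\<dots> \<le> 4 / r" using r by (simp add: power2_eq_square field_simps)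
    finally show ?thesis using True by simp
  next
    case False then show ?thesis using out[OF ar] by simp
  qed
  show ?thesis
  proof (rule that)
    show "has_C1_gradient (\<lambda>x. pos_sq (1 - \<sigma> x)) (\<lambda>x. (- 2 * max 0 (1 - \<sigma> x)) *\<^sub>R \<sigma>' x)"
      by (rule has_C1_gradient_compose[OF \<sigma> d]) (intro continuous_intros)
    fix x
    have "(max 0 (1 - \<sigma> x))\<^sup>2 \<le> 1\<^sup>2" using \<sigma>0[of x] by (intro power_mono) auto
    then show "0 \<le> pos_sq (1 - \<sigma> x) \<and> pos_sq (1 - \<sigma> x) \<le> 1" by (simp add: pos_sq_def)
    show "pos_sq (1 - \<sigma> x) = 0" if x: "x \<in> (\<Union>(a, r)\<in>Q. ball a r)"
    proof -
      obtain a r where ar: "(a, r) \<in> Q" "x \<in> ball a r" using x by auto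
      have r: "r > 0" by (rule Q(2)[OF ar(1)])
      have "norm (x - a) \<le> r" using ar by (simp add: dist_norm norm_minus_commute)
      then have "(x - a) \<bullet> (x - a) \<le> r\<^sup>2" unfolding power2_norm_eq_inner[symmetric] by (intro power_mono) auto
      then have "(x - a) \<bullet> (x - a) * (1 / r\<^sup>2) \<le> 1" using r by (simp add: field_simps)
      then have "3\<^sup>2 \<le> pos_sq (4 - (x - a) \<bullet> (x - a) * (1 / r\<^sup>2))" unfolding pos_sq_def by (intro power_mono) auto
      then have "1 \<le> \<beta> (a, r) x" by (simp add: \<beta>_def)
      also have "\<dots> \<le> \<sigma> x" unfolding \<sigma>_def by (rule member_le_sum[OF ar(1) _ Q(1)]) (rule \<beta>0)
      finally show ?thesis by (simp add: pos_sq_def)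
    qed
    show "pos_sq (1 - \<sigma> x) = 1" if x: "x \<notin> (\<Union>(a, r)\<in>Q. ball a (2 * r))"
    proof -
      have "\<sigma> x = 0" unfolding \<sigma>_def using x out by (intro sum.neutral) force
      then show ?thesis by (simp add: pos_sq_def)
    qed
    \<comment> \<open>The derivative of \<open>pos_sq (1 - t)\<close> is at most 2 in absolute value
      for \<open>t \<ge> 0\<close>, which doubles \<open>4 / r\<close>.\<close>
    have "norm ((- 2 * max 0 (1 - \<sigma> x)) *\<^sub>R \<sigma>' x) \<le> 2 * norm (\<sigma>' x)"
      using \<sigma>0[of x] by (simp add: abs_mult mult_right_mono)
    also have "norm (\<sigma>' x) \<le> (\<Sum>p\<in>Q. norm (\<beta>' p x))" unfolding \<sigma>'_def by (rule norm_sum)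
    also have "\<dots> \<le> (\<Sum>(a, r)\<in>Q. 4 / r * indicator (ball a (2 * r)) x)"
      using bd by (intro sum_mono) (auto split: prod.split)
    also have "2 * (\<Sum>(a, r)\<in>Q. 4 / r * indicator (ball a (2 * r)) x) = (\<Sum>(a, r)\<in>Q. 8 / r * indicator (ball a (2 * r)) x)"
      by (simp add: sum_distrib_left split_beta)
    finally show "norm ((- 2 * max 0 (1 - \<sigma> x)) *\<^sub>R \<sigma>' x) \<le> (\<Sum>(a, r)\<in>Q. 8 / r * indicator (ball a (2 * r)) x)" by simp
  qed
qed

text \<open>As \<open>G c = 0\<close>, the Lipschitz bound gives
  \<open>|G (u y)| \<le> |c - u y|\<close>. The trace averages are normalised by the measure of
  \<open>ball x r \<inter> \<Omega>\<close>, which is at most a constant times \<open>r ^ N\<close>,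
  so dividing by the power instead can only help.\<close>

lemma trace_vanishing_average:
  fixes \<Omega> :: "'a::euclidean_space set"
  assumes \<Omega>: "open \<Omega>" "bounded \<Omega>" and u0: "zero_extension \<Omega> u u0"
    and G: "\<And>s t. \<bar>G s - G t\<bar> \<le> \<bar>s - t\<bar>" "G 0 = 0" "\<And>s. \<bar>G s\<bar> \<le> 1" "G \<in> borel_measurable borel"
    and c: "G c = 0"
    and tr: "((\<lambda>r. (LINT y:ball x r \<inter> \<Omega>|lebesgue. \<bar>c - u y\<bar>) / measure lebesgue (ball x r \<inter> \<Omega>)) \<longlongrightarrow> 0) (at_right 0)"
  shows "((\<lambda>r. (LBINT y. indicator (ball x r) y * \<bar>G (u0 y)\<bar>) / r ^ DIM('a)) \<longlongrightarrow> 0) (at_right 0)"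
proof -
  have iu: "set_integrable lebesgue \<Omega> u" and ae: "AE y in lebesgue. y \<in> \<Omega> \<longrightarrow> u y = u0 y"
    and u00: "\<And>y. y \<notin> \<Omega> \<Longrightarrow> u0 y = 0" and [measurable]: "u0 \<in> borel_measurable borel"
    using u0 integrable_lborel_borel by (auto simp: zero_extension_def)
  note [measurable] = G(4)
  let ?v = "unit_ball_vol (real DIM('a))"
  let ?J = "\<lambda>r. \<integral>y. indicator (ball x r) y * \<bar>G (u0 y)\<bar> \<partial>lborel"
  let ?T = "\<lambda>r. LINT y:ball x r \<inter> \<Omega>|lebesgue. \<bar>c - u y\<bar>"
  let ?\<mu> = "\<lambda>r. measure lebesgue (ball x r \<inter> \<Omega>)"
  have ib: "integrable lborel (indicator (ball x r \<inter> \<Omega>) :: 'a \<Rightarrow> real)" for r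
  proof (rule integrable_real_indicator)
    have "emeasure lborel (ball x r \<inter> \<Omega>) \<le> emeasure lborel (ball x r)" by (intro emeasure_mono) auto
    then show "emeasure lborel (ball x r \<inter> \<Omega>) < \<infinity>" using emeasure_lborel_ball_finite order_le_less_trans by blast
  qed (use \<Omega> in auto)
  have out: "indicator (ball x r) y * \<bar>G (u0 y)\<bar> = indicator (ball x r \<inter> \<Omega>) y * \<bar>G (u0 y)\<bar>" for r y
    using u00[of y] G(2) by (auto simp: indicator_def)
  have iJ: "integrable lborel (\<lambda>y. indicator (ball x r \<inter> \<Omega>) y * \<bar>G (u0 y)\<bar>)" for r
    by (rule integrable_mult_bounded[OF ib, where B = 1]) (use G(3) in auto)
  have J1: "?J r \<le> ?\<mu> r" for r
  proof -
    have "?J r \<le> (LBINT y. indicator (ball x r \<inter> \<Omega>) y)"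
      unfolding out by (rule integral_mono[OF iJ ib]) (use G(3) in \<open>auto simp: indicator_def\<close>)
    then show ?thesis using \<Omega> by simp
  qed
  have J2: "?J r \<le> ?T r" for r
  proof -
    have sub: "set_integrable lebesgue (ball x r \<inter> \<Omega>) u"
      by (rule set_integrable_subset[OF iu]) (use \<Omega> in auto)
    have "set_integrable lebesgue (ball x r \<inter> \<Omega>) (\<lambda>y. c)"
      using ib[of r] \<Omega> unfolding set_integrable_def
      by (intro integrable_scaleR_left) (auto simp: integrable_completion)
    then have "set_integrable lebesgue (ball x r \<inter> \<Omega>) (\<lambda>y. c - u y)" using sub by (rule set_integral_diff)
    then have iT: "set_integrable lebesgue (ball x r \<inter> \<Omega>) (\<lambda>y. \<bar>c - u y\<bar>)" by (rule set_integrable_abs)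
    have mJ: "(\<lambda>y. indicator (ball x r \<inter> \<Omega>) y * \<bar>G (u0 y)\<bar>) \<in> borel_measurable lborel" using iJ[of r] by (rule borel_measurable_integrable)
    have "?J r = (\<integral>y. indicator (ball x r \<inter> \<Omega>) y * \<bar>G (u0 y)\<bar> \<partial>lebesgue)"
      unfolding out using integral_completion[OF mJ] by simp
    also have "\<dots> \<le> (\<integral>y. indicator (ball x r \<inter> \<Omega>) y *\<^sub>R \<bar>c - u y\<bar> \<partial>lebesgue)"
    proof (rule integral_mono_AE)
      show "integrable lebesgue (\<lambda>y. indicator (ball x r \<inter> \<Omega>) y * \<bar>G (u0 y)\<bar>)"
        using iJ[of r] integrable_completion[OF mJ] by simp
      show "integrable lebesgue (\<lambda>y. indicator (ball x r \<inter> \<Omega>) y *\<^sub>R \<bar>c - u y\<bar>)"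
        using iT by (simp add: set_integrable_def)
      show "AE y in lebesgue. indicator (ball x r \<inter> \<Omega>) y * \<bar>G (u0 y)\<bar> \<le> indicator (ball x r \<inter> \<Omega>) y *\<^sub>R \<bar>c - u y\<bar>"
        using ae
      proof eventually_elim
        case (elim y)
        show ?case using elim G(1)[of "u0 y" c] c by (auto simp: indicator_def abs_minus_commute)
      qed
    qed
    finally show ?thesis by (simp add: set_lebesgue_integral_def)
  qed
  have J0: "0 \<le> ?J r" for r by (intro integral_nonneg_AE) auto
  have \<mu>v: "?\<mu> r \<le> ?v * r ^ DIM('a)" if "r > 0" for r
  proof -
    have "?\<mu> r \<le> measure lebesgue (ball x r)"
      using \<Omega> by (intro measure_mono_fmeasurable) auto
    also have "\<dots> = ?v * r ^ DIM('a)" using that content_ball[of r x] by simp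
    finally show ?thesis .
  qed
  have key: "?J r / r ^ DIM('a) \<le> ?v * (?T r / ?\<mu> r)" if r: "r > 0" for r
  \<comment> \<open>Division by 0 makes the right-hand side 0; the left one is 0 too, because
    \<open>G\<close> is bounded by 1.\<close>
  proof (cases "?\<mu> r = 0")
    case True
    then have "?J r = 0" using J1[of r] J0[of r] by simp
    then show ?thesis using True by simp
  next
    case False
    then have p: "?\<mu> r > 0" using measure_nonneg[of lebesgue "ball x r \<inter> \<Omega>"] by linarith
    have "?J r * ?\<mu> r \<le> ?T r * (?v * r ^ DIM('a))"
      using J2[of r] \<mu>v[OF r] order_trans[OF J0[of r] J2[of r]] p by (intro mult_mono) auto
    then show ?thesis using p r by (simp add: field_simps)
  qed
  have lim: "((\<lambda>r. ?v * (?T r / ?\<mu> r)) \<longlongrightarrow> 0) (at_right 0)" using tendsto_mult_right_zero[OF tr] .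
  show ?thesis
  proof (rule tendsto_sandwich[OF _ _ tendsto_const lim])
    show "\<forall>\<^sub>F r in at_right 0. 0 \<le> ?J r / r ^ DIM('a)"
      using eventually_at_right_less[of "0::real"] by eventually_elim (intro divide_nonneg_pos J0 zero_less_power)
    show "\<forall>\<^sub>F r in at_right 0. ?J r / r ^ DIM('a) \<le> ?v * (?T r / ?\<mu> r)"
      using eventually_at_right_less[of "0::real"] by eventually_elim (rule key)
  qed
qed

section \<open>Decay of the level sets\<close>

text \<open>The radius \<rho> is left free until the measure of the level set is known; up to a
  constant it stands for the root of order \<open>N\<close> of that measure. \<open>A\<close> does
  not depend on \<open>t\<close>, which is what the recursion over dyadic levels needs.\<close>

lemma level_set_decay:
  fixes \<Omega> :: "'a::euclidean_space set" and u f :: "'a \<Rightarrow> real"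
  defines "s \<equiv> DIM('a) - 1"
  assumes \<Omega>: "open \<Omega>" "bounded \<Omega>" "lipschitz_boundary \<Omega>" and \<phi>: "metric_integrand \<Omega> \<phi>"
    and lg: "phi_least_gradient \<phi> \<Omega> u" and tr: "has_trace \<Omega> u f" and u0: "zero_extension \<Omega> u u0"
  obtains A where "A > 0" "\<And>t \<rho>. 1 \<le> t \<Longrightarrow> {x \<in> frontier \<Omega>. t < \<bar>f x\<bar>} \<in> sets (hausdorff_measure s) \<Longrightarrow> \<rho> > 0 \<Longrightarrow>
      4 * measure lborel {x. t < \<bar>u0 x\<bar>} \<le> measure lborel (ball (0::'a) \<rho>) \<Longrightarrow>
      measure lborel {x. 2 * t \<le> \<bar>u0 x\<bar>} \<le> A * \<rho> * measure (hausdorff_measure s) {x \<in> frontier \<Omega>. t < \<bar>f x\<bar>}"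
proof -
  have iu0: "integrable lborel u0" and u00: "\<And>x. x \<notin> \<Omega> \<Longrightarrow> u0 x = 0"
    using u0 by (auto simp: zero_extension_def)
  note [measurable] = integrable_lborel_borel[OF iu0]
  let ?\<Gamma> = "frontier \<Omega>"
  have c\<Gamma>: "compact ?\<Gamma>" using \<Omega>(2) by (rule compact_frontier_bounded)
  have H\<Gamma>: "hausdorff_outer s ?\<Gamma> < top" unfolding s_def by (rule hausdorff_outer_frontier_finite[OF \<Omega>])
  obtain C where C: "C > 0" "\<And>\<eta> \<eta>' B G G' K z. has_C1_gradient \<eta> \<eta>' \<Longrightarrow> (\<And>x. 0 \<le> \<eta> x \<and> \<eta> x \<le> 1) \<Longrightarrow> (\<And>x. norm (\<eta>' x) \<le> B) \<Longrightarrow>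
      (\<And>t. (G has_real_derivative G' t) (at t)) \<Longrightarrow> continuous_on UNIV G' \<Longrightarrow> (\<And>t. 0 \<le> G' t \<and> G' t \<le> 1) \<Longrightarrow> G 0 = 0 \<Longrightarrow>
      compact K \<Longrightarrow> K \<subseteq> \<Omega> \<Longrightarrow> (\<And>x. x \<in> \<Omega> - K \<Longrightarrow> \<eta> x = 0) \<Longrightarrow>
      z \<in> C1c \<Omega> \<Longrightarrow> (\<And>x. norm (z x) \<le> 1) \<Longrightarrow>
      (LBINT x. \<eta> x * G (u0 x) * divergence z x) \<le> C * (LBINT x. norm (\<eta>' x) * \<bar>G (u0 x)\<bar>)"
    using least_gradient_truncation[OF \<Omega>(1,2) \<phi> lg u0] by blast
  let ?v = "unit_ball_vol (real DIM('a))"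
  have v: "?v > 0" by simp
  define C0 where "C0 = ?v * 2 ^ DIM('a) * hausdorff_const s"
  have C0: "C0 > 0" using v hausdorff_const_pos by (simp add: C0_def)
  \<comment> \<open>\<epsilon> is the tolerance of the boundary cover and is sent to 0 at the end;
    both the layer integral and the volume of the removed balls contribute to its
    coefficient.\<close>
  have main: "measure lborel {x. 2 * t \<le> \<bar>u0 x\<bar>} \<le> 4 * \<rho> * (8 * C * (C0 * measure (hausdorff_measure s) {x \<in> ?\<Gamma>. t < \<bar>f x\<bar>} + \<epsilon>)) + ?v * 2 ^ DIM('a) * \<epsilon>"
    if t: "1 \<le> t" and D: "{x \<in> ?\<Gamma>. t < \<bar>f x\<bar>} \<in> sets (hausdorff_measure s)" and \<rho>: "\<rho> > 0"
      "4 * measure lborel {x. t < \<bar>u0 x\<bar>} \<le> measure lborel (ball (0::'a) \<rho>)" and \<epsilon>: "\<epsilon> > 0" for t \<rho> \<epsilon>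
  proof -
    \<comment> \<open>Scaled so that levels up to \<open>t\<close> are cut off; the slope is at most
      \<open>1 / t\<close>, hence at most 1 as \<open>t \<ge> 1\<close>.\<close>
    define G where "G = (\<lambda>x. threshold (x / t))"
    define G' where "G' = (\<lambda>x. threshold' (x / t) * (1 / t))"
    have G1: "(G has_real_derivative G' x) (at x)" for x
    proof -
      have "((\<lambda>x. x / t) has_real_derivative 1 / t) (at x)" using t by (auto intro!: derivative_eq_intros)
      from DERIV_chain2[OF threshold_deriv this] show ?thesis by (simp add: G_def[abs_def] G'_def)
    qed
    have G2: "continuous_on UNIV G'"
      unfolding G'_def using t by (intro continuous_intros continuous_on_compose2[OF continuous_on_threshold']) auto
    have G3: "0 \<le> G' x \<and> G' x \<le> 1" for x
    proof -
      have "1 / t \<le> 1" "0 \<le> 1 / t" using t by auto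
      then show ?thesis unfolding G'_def using threshold'_bounds[of "x / t"] mult_mono[of "threshold' (x / t)" 1 "1 / t" 1] by simp
    qed
    have G4: "G 0 = 0" by (simp add: G_def threshold_small)
    have G5: "\<bar>G x\<bar> \<le> 1" for x by (simp add: G_def threshold_abs_le_1)
    have G6: "G x = 0" if "\<bar>x\<bar> \<le> t" for x using that t by (simp add: G_def threshold_small)
    have G7: "1 / 2 \<le> \<bar>G x\<bar>" if "2 * t \<le> \<bar>x\<bar>" for x
      unfolding G_def by (rule threshold_large) (use that t in \<open>simp add: field_simps\<close>)
    have GL: "\<bar>G x - G y\<bar> \<le> \<bar>x - y\<bar>" for x y using nondecreasing_Lipschitz[of G G'] G1 G3 by blast
    have [measurable]: "G \<in> borel_measurable borel"
      by (intro borel_measurable_continuous_onI continuous_at_imp_continuous_on ballI DERIV_isCont[OF G1])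
    let ?D = "{x \<in> ?\<Gamma>. t < \<bar>f x\<bar>}"
    define m where "m = (\<lambda>x. \<bar>G (u0 x)\<bar>)"
    have mm [measurable]: "m \<in> borel_measurable borel" unfolding m_def by measurable
    have m01: "0 \<le> m x \<and> m x \<le> 1" for x using G5 by (simp add: m_def)
    \<comment> \<open>Off \<open>?D\<close> the trace value is at most \<open>t\<close> in absolute
      value, where \<open>G\<close> vanishes.\<close>
    have ae: "AE x in hausdorff_measure s. x \<in> ?\<Gamma> - ?D \<longrightarrow> ((\<lambda>r. (LBINT y. indicator (ball x r) y * m y) / r ^ DIM('a)) \<longlongrightarrow> 0) (at_right 0)"
      using tr unfolding has_trace_def s_def[symmetric]
    proof eventually_elim
      case (elim x)
      show ?case
      proof
        assume x: "x \<in> ?\<Gamma> - ?D"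
        then have "G (f x) = 0" by (intro G6) auto
        then show "((\<lambda>r. (LBINT y. indicator (ball x r) y * m y) / r ^ DIM('a)) \<longlongrightarrow> 0) (at_right 0)"
          unfolding m_def using elim x by (intro trace_vanishing_average[OF \<Omega>(1,2) u0 GL G4 G5]) auto
      qed
    qed
    have D\<Gamma>: "?D \<subseteq> ?\<Gamma>" by blast
    obtain Q where Q: "finite Q" "Q \<subseteq> ?\<Gamma> \<times> {0<..}" "?\<Gamma> \<subseteq> (\<Union>(x, r)\<in>Q. ball x r)"
      "(\<Sum>(x, r)\<in>Q. (LBINT y. indicator (ball x (2 * r)) y * m y) / r) \<le> C0 * measure (hausdorff_measure s) ?D + \<epsilon>"
      "(\<Sum>(x, r)\<in>Q. r ^ DIM('a)) \<le> \<epsilon>"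
      by (rule boundary_cover[OF c\<Gamma> H\<Gamma>[unfolded s_def] D[unfolded s_def] D\<Gamma> mm m01 ae[unfolded s_def] \<epsilon>, folded s_def, folded C0_def]) (rule that)
    have Qpos: "0 < r" if "(a, r) \<in> Q" for a r using subsetD[OF Q(2) that] by simp
    obtain \<eta> \<eta>' where \<eta>: "has_C1_gradient \<eta> \<eta>'" "\<And>x. 0 \<le> \<eta> x \<and> \<eta> x \<le> 1"
      "\<And>x. x \<in> (\<Union>(a, r)\<in>Q. ball a r) \<Longrightarrow> \<eta> x = 0"
      "\<And>x. x \<notin> (\<Union>(a, r)\<in>Q. ball a (2 * r)) \<Longrightarrow> \<eta> x = 1"
      "\<And>x. norm (\<eta>' x) \<le> (\<Sum>(a, r)\<in>Q. 8 / r * indicator (ball a (2 * r)) x)"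
      by (rule ball_cutoff[OF Q(1) Qpos]) (assumption, rule that)
    note \<eta>D = has_C1_gradientD[OF \<eta>(1)]
    have ib: "integrable lborel (indicator (ball x r) :: 'a \<Rightarrow> real)" for x :: 'a and r
      using emeasure_lborel_ball_finite by (intro integrable_real_indicator) auto
    have im: "integrable lborel (\<lambda>y. indicator (ball x r) y * m y)" for x r
      by (rule integrable_mult_bounded[OF ib, where B = 1]) (use m01 in auto)
    have \<eta>bd: "norm (\<eta>' x) \<le> (\<Sum>(a, r)\<in>Q. 8 / r)" for x
      by (rule order_trans[OF \<eta>(5)], rule sum_mono) (use Qpos in \<open>auto simp: indicator_def less_imp_le\<close>)
    have layer: "(LBINT x. norm (\<eta>' x) * \<bar>G (u0 x)\<bar>) \<le> 8 * (C0 * measure (hausdorff_measure s) ?D + \<epsilon>)"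
    proof -
      have isum: "integrable lborel (\<lambda>x. \<Sum>p\<in>Q. 8 / snd p * (indicator (ball (fst p) (2 * snd p)) x * m x))"
        by (intro Bochner_Integration.integrable_sum integrable_mult_right im)
      have pt: "norm (\<eta>' x) * m x \<le> (\<Sum>p\<in>Q. 8 / snd p * (indicator (ball (fst p) (2 * snd p)) x * m x))" for x
      proof -
        have "norm (\<eta>' x) * m x \<le> (\<Sum>(a, r)\<in>Q. 8 / r * indicator (ball a (2 * r)) x) * m x"
          using m01[of x] by (intro mult_right_mono \<eta>(5)) auto
        then show ?thesis by (simp add: sum_distrib_right split_beta mult.assoc)
      qed
      have "(LBINT x. norm (\<eta>' x) * m x) \<le> (LBINT x. (\<Sum>p\<in>Q. 8 / snd p * (indicator (ball (fst p) (2 * snd p)) x * m x)))"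
      proof (rule integral_mono[OF _ isum pt])
        show "integrable lborel (\<lambda>x. norm (\<eta>' x) * m x)"
        proof (rule Bochner_Integration.integrable_bound[OF isum])
          show "(\<lambda>x. norm (\<eta>' x) * m x) \<in> borel_measurable lborel" using \<eta>D(5) by measurable
          show "AE x in lborel. norm (norm (\<eta>' x) * m x) \<le> norm (\<Sum>p\<in>Q. 8 / snd p * (indicator (ball (fst p) (2 * snd p)) x * m x))"
          proof (rule AE_I2)
            fix x
            have "0 \<le> norm (\<eta>' x) * m x" using m01[of x] by simp
            then show "norm (norm (\<eta>' x) * m x) \<le> norm (\<Sum>p\<in>Q. 8 / snd p * (indicator (ball (fst p) (2 * snd p)) x * m x))"
              using pt[of x] unfolding real_norm_def by linarith
          qed
        qed
      qed
      also have "\<dots> = (\<Sum>p\<in>Q. 8 / snd p * (LBINT x. indicator (ball (fst p) (2 * snd p)) x * m x))"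
        by (subst Bochner_Integration.integral_sum) (intro integrable_mult_right im, simp)
      also have "\<dots> = 8 * (\<Sum>(x, r)\<in>Q. (LBINT y. indicator (ball x (2 * r)) y * m y) / r)"
        by (simp add: sum_distrib_left split_beta)
      also have "\<dots> \<le> 8 * (C0 * measure (hausdorff_measure s) ?D + \<epsilon>)" using Q(4) by simp
      finally show ?thesis by (simp add: m_def)
    qed
    \<comment> \<open>Removing balls that cover the frontier from the closure leaves a compact
      subset of \<Omega>; on the removed part \<eta> vanishes.\<close>
    define K where "K = closure \<Omega> - (\<Union>(a, r)\<in>Q. ball a r)"
    have K: "compact K"
      unfolding K_def using \<Omega>(2) by (intro compact_diff open_UN) (auto simp: compact_closure)
    have K\<Omega>: "K \<subseteq> \<Omega>"
    proof
      fix x assume "x \<in> K"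
      then have "x \<in> closure \<Omega>" "x \<notin> ?\<Gamma>" using Q(3) unfolding K_def by blast+
      then show "x \<in> \<Omega>" using \<Omega>(1) by (simp add: frontier_def interior_open)
    qed
    have \<eta>K: "\<eta> x = 0" if "x \<in> \<Omega> - K" for x
      using that closure_subset[of \<Omega>] by (intro \<eta>(3)) (auto simp: K_def)
    define w where "w = (\<lambda>x. \<eta> x * G (u0 x))"
    define M where "M = 8 * C * (C0 * measure (hausdorff_measure s) ?D + \<epsilon>)"
    have Mb: "(LBINT x. w x * divergence z x) \<le> M" if "z \<in> C1c \<Omega>" "\<And>x. norm (z x) \<le> 1" for z
    proof -
      have "(LBINT x. w x * divergence z x) \<le> C * (LBINT x. norm (\<eta>' x) * \<bar>G (u0 x)\<bar>)"
        unfolding w_def by (rule C(2)[OF \<eta>(1,2) \<eta>bd G1 G2 G3 G4 K K\<Omega> \<eta>K that])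
      also have "\<dots> \<le> C * (8 * (C0 * measure (hausdorff_measure s) ?D + \<epsilon>))" using layer C(1) by (intro mult_left_mono) auto
      finally show ?thesis by (simp add: M_def mult_ac)
    qed
    have [measurable]: "\<eta> \<in> borel_measurable borel" by (rule \<eta>D(4))
    have wabs: "\<bar>w x\<bar> \<le> \<bar>G (u0 x)\<bar>" for x
      using \<eta>(2)[of x] mult_right_mono[of "\<eta> x" 1 "\<bar>G (u0 x)\<bar>"] by (simp add: w_def abs_mult)
    have iw: "integrable lborel w"
    proof (rule Bochner_Integration.integrable_bound[OF iu0])
      show "w \<in> borel_measurable lborel" unfolding w_def by measurable
      show "AE x in lborel. norm (w x) \<le> norm (u0 x)"
      proof (rule AE_I2)
        fix x show "norm (w x) \<le> norm (u0 x)" using wabs[of x] GL[of "u0 x" 0] G4 by simp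
      qed
    qed
    have wK: "w x = 0" if "x \<notin> K" for x
      using \<eta>K[of x] u00[of x] that G4 by (cases "x \<in> \<Omega>") (auto simp: w_def)
    define U where "U = (\<Union>(a, r)\<in>Q. ball a (2 * r))"
    \<comment> \<open>The doubled balls are removed, since \<eta> is known to be 1 only outside
      them; their total volume is of order \<epsilon>.\<close>
    define E where "E = {x. 2 * t \<le> \<bar>u0 x\<bar>} - U"
    have Uo: "open U" unfolding U_def by (intro open_UN) auto
    have Em: "{x. 2 * t \<le> \<bar>u0 x\<bar>} \<in> sets borel" by measurable
    have E\<Omega>: "x \<in> \<Omega>" if "2 * t \<le> \<bar>u0 x\<bar>" for x using u00[of x] that t by (cases "x \<in> \<Omega>") auto
    have EK: "E \<subseteq> K"
    proof
      fix x assume x: "x \<in> E"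
      then have "x \<in> \<Omega>" using E\<Omega> by (auto simp: E_def)
      moreover have "x \<notin> ball a r" if "(a, r) \<in> Q" for a r
        using x that Qpos[OF that] unfolding E_def U_def by force
      ultimately show "x \<in> K" using closure_subset[of \<Omega>] by (auto simp: K_def)
    qed
    have fin\<Omega>: "emeasure lborel \<Omega> < \<infinity>" using \<Omega>(2) by (rule emeasure_bounded_finite)
    have finS: "emeasure lborel S < \<infinity>" if "S \<subseteq> \<Omega>" for S
      using emeasure_mono[OF that, of lborel] \<Omega>(1) fin\<Omega> by (simp add: order_le_less_trans)
    have "measure lborel E \<le> 4 * \<rho> * M"
    proof (rule level_set_estimate[OF \<Omega>(1) iw K K\<Omega> wK Mb])
      show "E \<in> sets borel" unfolding E_def using Em Uo by auto
      show "E \<subseteq> K" by (rule EK)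
      show "1 / 2 \<le> \<bar>w x\<bar>" if "x \<in> E" for x
      proof -
        have "\<eta> x = 1" using that by (intro \<eta>(4)) (auto simp: E_def U_def)
        then show ?thesis using G7[of "u0 x"] that by (simp add: w_def E_def)
      qed
      show "{x. t < \<bar>u0 x\<bar>} \<in> sets borel" by measurable
      show "emeasure lborel {x. t < \<bar>u0 x\<bar>} < \<infinity>"
      proof (rule finS, rule subsetI)
        fix x assume "x \<in> {x. t < \<bar>u0 x\<bar>}"
        then show "x \<in> \<Omega>" using u00[of x] t by (cases "x \<in> \<Omega>") auto
      qed
      show "\<bar>w x\<bar> \<le> indicator {x. t < \<bar>u0 x\<bar>} x" for x
        using wabs[of x] G5[of "u0 x"] G6[of "u0 x"] by (auto simp: indicator_def)
    qed (use \<rho> in auto)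
    moreover have "measure lborel {x. 2 * t \<le> \<bar>u0 x\<bar>} \<le> measure lborel E + ?v * 2 ^ DIM('a) * \<epsilon>"
    proof -
      have Uf: "(\<lambda>(a, r). ball a (2 * r)) p \<in> fmeasurable lborel" for p :: "'a \<times> real"
        using emeasure_lborel_ball_finite by (auto simp: fmeasurable_def split_beta)
      have Ufm: "U \<in> fmeasurable lborel" unfolding U_def by (rule fmeasurable.finite_UN[OF Q(1)]) (rule Uf)
      have Efm: "E \<in> fmeasurable lborel"
        unfolding fmeasurable_def using finS[of E] EK K\<Omega> Em Uo by (auto simp: E_def)
      have "measure lborel {x. 2 * t \<le> \<bar>u0 x\<bar>} \<le> measure lborel (E \<union> U)"
        by (rule measure_mono_fmeasurable[OF _ _ fmeasurable.Un[OF Efm Ufm]]) (use Em in \<open>auto simp: E_def\<close>)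
      also have "\<dots> \<le> measure lborel E + measure lborel U"
        using Efm Ufm by (intro measure_Un_le) (auto simp: fmeasurable_def)
      also have "measure lborel U \<le> (\<Sum>p\<in>Q. measure lborel ((\<lambda>(a, r). ball a (2 * r)) p))"
        unfolding U_def by (rule measure_UNION_le[OF Q(1)]) (auto simp: split_beta)
      also have "\<dots> = (\<Sum>(a, r)\<in>Q. ?v * 2 ^ DIM('a) * r ^ DIM('a))"
        using Qpos by (intro sum.cong refl) (auto simp: content_ball less_imp_le power_mult_distrib)
      also have "\<dots> = ?v * 2 ^ DIM('a) * (\<Sum>(a, r)\<in>Q. r ^ DIM('a))" by (simp add: sum_distrib_left split_beta)
      also have "\<dots> \<le> ?v * 2 ^ DIM('a) * \<epsilon>" using Q(5) v by (intro mult_left_mono) auto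
      finally show ?thesis by simp
    qed
    ultimately show ?thesis unfolding M_def by linarith
  qed
  show ?thesis
  \<comment> \<open>32 is the 4 of \<open>level_set_estimate\<close> times the 8 of the cutoff
    gradient.\<close>
  proof (rule that[of "32 * C * C0"])
    show "32 * C * C0 > 0" using C(1) C0 by simp
    fix t \<rho> :: real
    assume *: "1 \<le> t" "{x \<in> ?\<Gamma>. t < \<bar>f x\<bar>} \<in> sets (hausdorff_measure s)" "\<rho> > 0"
      "4 * measure lborel {x. t < \<bar>u0 x\<bar>} \<le> measure lborel (ball (0::'a) \<rho>)"
    let ?b = "measure (hausdorff_measure s) {x \<in> ?\<Gamma>. t < \<bar>f x\<bar>}"
    \<comment> \<open>The coefficient of \<epsilon> in \<open>main\<close>.\<close>
    define W where "W = 32 * \<rho> * C + ?v * 2 ^ DIM('a)"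
    have W: "W > 0" using *(3) C(1) v by (auto simp: W_def intro!: add_pos_pos)
    show "measure lborel {x. 2 * t \<le> \<bar>u0 x\<bar>} \<le> 32 * C * C0 * \<rho> * ?b"
    proof (rule field_le_epsilon)
      fix e :: real assume e: "e > 0"
      have "measure lborel {x. 2 * t \<le> \<bar>u0 x\<bar>} \<le> 4 * \<rho> * (8 * C * (C0 * ?b + e / W)) + ?v * 2 ^ DIM('a) * (e / W)"
        by (rule main[OF *]) (use e W in simp)
      also have "\<dots> = 32 * C * C0 * \<rho> * ?b + W * (e / W)" unfolding W_def by (simp only: distrib_left distrib_right) simp
      also have "W * (e / W) = e" using W by simp
      finally show "measure lborel {x. 2 * t \<le> \<bar>u0 x\<bar>} \<le> 32 * C * C0 * \<rho> * ?b + e" .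
    qed
  qed
qed

section \<open>Dyadic summation\<close>

text \<open>The exponent \<open>1 / N\<close> is less than \<open>1\<close>, so the recursion first forces \<open>X\<close> to be bounded and then
  bounds its sum by a multiple of that of \<open>\<beta>\<close>.\<close>

lemma sublinear_recursion_summable:
  fixes X \<beta> :: "nat \<Rightarrow> real" and K B N :: real
  assumes X: "\<And>j. 0 \<le> X j" and \<beta>: "\<And>j. 0 \<le> \<beta> j" "\<And>n. (\<Sum>j<n. \<beta> j) \<le> B" and K: "0 \<le> K" and N: "2 \<le> N"
    and rec: "\<And>j. X (Suc j) \<le> K * X j powr (1 / N) * \<beta> j"
  shows "summable X"
proof -
  have B: "0 \<le> B" using \<beta>(2)[of 0] by simp
  have \<beta>B: "\<beta> j \<le> B" for j
  proof -
    have "\<beta> j \<le> (\<Sum>i<Suc j. \<beta> i)" using \<beta>(1) by (intro member_le_sum) auto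
    then show ?thesis using \<beta>(2)[of "Suc j"] by linarith
  qed
  \<comment> \<open>A bound preserved by the recursion: \<open>X j \<le> S\<close> gives
    \<open>X (Suc j) \<le> K * B * sqrt S \<le> S\<close>.\<close>
  define S where "S = max (max (X 0) 1) ((K * B)\<^sup>2)"
  have S: "1 \<le> S" "X 0 \<le> S" "(K * B)\<^sup>2 \<le> S" by (auto simp: S_def)
  have KB: "K * B \<le> sqrt S" using S(3) by (rule real_le_rsqrt)
  \<comment> \<open>Because \<open>1 / N \<le> 1 / 2\<close> and \<open>S \<ge> 1\<close>, a square
    root may stand for the root of order \<open>N\<close>.\<close>
  have root: "x powr (1 / N) \<le> sqrt S" if "0 \<le> x" "x \<le> S" for x
  proof -
    have "x powr (1 / N) \<le> S powr (1 / N)" using that N by (intro powr_mono2) auto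
    also have "\<dots> \<le> S powr (1 / 2)" using S(1) N by (intro powr_mono) auto
    also have "\<dots> = sqrt S" using S(1) by (simp add: powr_half_sqrt)
    finally show ?thesis .
  qed
  have bd: "X j \<le> S" for j
  proof (induction j)
    case (Suc j)
    have "X (Suc j) \<le> K * X j powr (1 / N) * \<beta> j" by (rule rec)
    also have "\<dots> \<le> K * sqrt S * B"
      using K B \<beta>(1) \<beta>B root[OF X Suc] S(1) by (intro mult_mono mult_left_mono) auto
    also have "\<dots> = (K * B) * sqrt S" by simp
    also have "\<dots> \<le> sqrt S * sqrt S" using KB S(1) by (intro mult_right_mono) auto
    finally show ?case using S(1) by simp
  qed (rule S)
  have "summable (\<lambda>j. X (Suc j))"
  proof (rule summableI_nonneg_bounded)
    fix n
    have "(\<Sum>j<n. X (Suc j)) \<le> (\<Sum>j<n. K * sqrt S * \<beta> j)"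
    proof (rule sum_mono)
      fix j
      have "X (Suc j) \<le> K * X j powr (1 / N) * \<beta> j" by (rule rec)
      also have "\<dots> \<le> K * sqrt S * \<beta> j"
        using K \<beta>(1) root[OF X bd] by (intro mult_right_mono mult_left_mono) auto
      finally show "X (Suc j) \<le> K * sqrt S * \<beta> j" .
    qed
    also have "\<dots> = K * sqrt S * (\<Sum>j<n. \<beta> j)" by (simp add: sum_distrib_left)
    also have "\<dots> \<le> K * sqrt S * B" using K S(1) \<beta>(2) by (intro mult_left_mono) auto
    finally show "(\<Sum>j<n. X (Suc j)) \<le> K * sqrt S * B" .
  qed (rule X)
  then show ?thesis by (simp add: summable_Suc_iff)
qed

text \<open>The nonzero terms form an initial segment of a geometric series with ratio
  \<open>2 powr p \<ge> 2\<close>, whose sum is at most twice its last term.\<close>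

lemma sum_dyadic_powr:
  fixes p s :: real
  assumes "1 \<le> p" "0 \<le> s"
  shows "(\<Sum>j<n. (2 ^ j) powr p * of_bool (2 ^ j < s)) \<le> 2 * s powr p"
proof (induction n)
  case (Suc n)
  have geo: "(\<Sum>j\<le>n. (2 ^ j) powr p) \<le> 2 * (2 ^ n) powr p"
  proof (induction n)
    case (Suc n)
    have "(2::real) \<le> 2 powr p" using powr_mono[of 1 p "2::real"] assms by simp
    then have "2 * (2 ^ n) powr p \<le> 2 powr p * (2 ^ n) powr p" by (intro mult_right_mono) auto
    also have "\<dots> = (2 ^ Suc n) powr p" by (simp add: powr_mult)
    finally show ?case using Suc by simp
  qed simp
  show ?case
  proof (cases "2 ^ n < s")
    case True
    have "(\<Sum>j<Suc n. (2 ^ j) powr p * of_bool (2 ^ j < s)) \<le> (\<Sum>j\<le>n. (2 ^ j) powr p)"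
      unfolding lessThan_Suc_atMost by (intro sum_mono) auto
    also note geo
    also have "2 * (2 ^ n) powr p \<le> 2 * s powr p" using True assms by (intro mult_left_mono powr_mono2) auto
    finally show ?thesis .
  next
    case False
    then show ?thesis using Suc by simp
  qed
qed simp

lemma dyadic_interval:
  fixes s :: real
  assumes "1 \<le> s"
  obtains j :: nat where "2 ^ j \<le> s" "s < 2 ^ Suc j"
proof -
  define n where "n = (LEAST n. s < 2 ^ n)"
  have n: "s < 2 ^ n" unfolding n_def using real_arch_pow[of 2 s] by (auto intro: LeastI)
  then have "n \<noteq> 0" using assms by (intro notI) simp
  then obtain j where j: "n = Suc j" by (cases n) auto
  have "\<not> s < 2 ^ j" using not_less_Least[of j "\<lambda>n. s < 2 ^ n"] j by (simp add: n_def)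
  then show ?thesis using that[of j] n j by simp
qed

theorem theorem3p2:
  fixes \<Omega> :: "'a::euclidean_space set"
    and \<phi> :: "'a \<Rightarrow> 'a \<Rightarrow> real"
    and u f :: "'a \<Rightarrow> real"
    and p :: real
  assumes "DIM('a) \<ge> 2"
    and "open \<Omega>" and "bounded \<Omega>" and "lipschitz_boundary \<Omega>"
    and "metric_integrand \<Omega> \<phi>"
    and "1 \<le> p"
    and "u \<in> BV \<Omega>"
    and "phi_least_gradient \<phi> \<Omega> u"
    and "has_trace \<Omega> u f"
    and "f \<in> Lp_on (hausdorff_measure (DIM('a) - 1)) (frontier \<Omega>) p"
  shows "u \<in> Lp_on lebesgue \<Omega> (real DIM('a) * p / (real DIM('a) - 1))"
proof -
  let ?N = "real DIM('a)" and ?H = "hausdorff_measure (DIM('a) - 1) :: 'a measure"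
  define q where "q = ?N * p / (?N - 1)"
  have N: "2 \<le> ?N" using assms(1) by simp
  have p: "1 \<le> p" by fact
  have q: "0 < q" using N p by (simp add: q_def)
  \<comment> \<open>This identity determines \<open>q\<close>: the weight
    \<open>(2 ^ j) powr q\<close> splits into its own power \<open>1 / N\<close> and the weight of
    the boundary levels.\<close>
  have qNp: "q / ?N + p = q" using N by (simp add: q_def field_simps)
  have iu: "set_integrable lebesgue \<Omega> u" using assms(7) by (simp add: BV_def)
  obtain u0 where u0: "zero_extension \<Omega> u u0" using zero_extension_exists[OF assms(2) iu] .
  have iu0: "integrable lborel u0" and u00: "\<And>x. x \<notin> \<Omega> \<Longrightarrow> u0 x = 0"
    and ae: "AE x in lebesgue. x \<in> \<Omega> \<longrightarrow> u x = u0 x"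
    using u0 by (auto simp: zero_extension_def)
  have u0m [measurable]: "u0 \<in> borel_measurable borel" by (rule integrable_lborel_borel[OF iu0])
  obtain A where A: "A > 0" "\<And>t \<rho>. 1 \<le> t \<Longrightarrow> {x \<in> frontier \<Omega>. t < \<bar>f x\<bar>} \<in> sets ?H \<Longrightarrow> \<rho> > 0 \<Longrightarrow>
      4 * measure lborel {x. t < \<bar>u0 x\<bar>} \<le> measure lborel (ball (0::'a) \<rho>) \<Longrightarrow>
      measure lborel {x. 2 * t \<le> \<bar>u0 x\<bar>} \<le> A * \<rho> * measure ?H {x \<in> frontier \<Omega>. t < \<bar>f x\<bar>}"
    by (rule level_set_decay[OF assms(2-5) assms(8,9) u0]) (rule that)
  let ?v = "unit_ball_vol ?N"
  have v: "?v > 0" by simp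
  then have v': "?v \<noteq> 0" by linarith

  have fm: "(\<lambda>x. indicator (frontier \<Omega>) x *\<^sub>R f x) \<in> borel_measurable ?H"
    and fi: "integrable ?H (\<lambda>x. indicator (frontier \<Omega>) x *\<^sub>R (\<bar>f x\<bar> powr p))"
    using assms(10) by (auto simp: Lp_on_def set_borel_measurable_def set_integrable_def)
  define D where "D = (\<lambda>j::nat. {x \<in> frontier \<Omega>. 2 ^ j < \<bar>f x\<bar>})"
  have Dm: "D j \<in> sets ?H" for j
  proof -
    \<comment> \<open>\<open>f\<close> is known to be measurable only on the frontier; its extension
      by 0 has the same level sets because \<open>2 ^ j > 0\<close>.\<close>
    have "{x \<in> space ?H. 2 ^ j < \<bar>indicator (frontier \<Omega>) x *\<^sub>R f x\<bar>} \<in> sets ?H"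
      using fm by measurable
    moreover have "{x \<in> space ?H. 2 ^ j < \<bar>indicator (frontier \<Omega>) x *\<^sub>R f x\<bar>} = D j"
      by (auto simp: D_def indicator_def not_less split: if_splits)
    ultimately show ?thesis by simp
  qed
  have Dfin: "emeasure ?H (D j) < \<infinity>" for j
  proof -
    have fr: "frontier \<Omega> \<in> sets ?H" by (rule closed_in_sets_hausdorff_measure) simp
    have "emeasure ?H (D j) \<le> emeasure ?H (frontier \<Omega>)" by (rule emeasure_mono[OF _ fr]) (auto simp: D_def)
    also have "\<dots> < \<infinity>"
      using hausdorff_outer_frontier_finite[OF assms(2-4)] emeasure_hausdorff_measure[OF fr] by simp
    finally show ?thesis .
  qed
  define \<beta> where "\<beta> = (\<lambda>j. (2 ^ j) powr p * measure ?H (D j))"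
  define B where "B = 2 * (\<integral>x. indicator (frontier \<Omega>) x *\<^sub>R (\<bar>f x\<bar> powr p) \<partial>?H)"
  \<comment> \<open>Summation by layers: the dyadic weights collected at a point \<open>x\<close> of
    the frontier add up to at most twice \<open>|f x| powr p\<close>.\<close>
  have \<beta>B: "(\<Sum>j<n. \<beta> j) \<le> B" for n
  proof -
    have iD: "integrable ?H (\<lambda>x. (2 ^ j) powr p * indicator (D j) x :: real)" for j
      using Dm Dfin by (intro integrable_mult_right integrable_real_indicator)
    have "(\<Sum>j<n. \<beta> j) = (\<Sum>j<n. (\<integral>x. (2 ^ j) powr p * indicator (D j) x \<partial>?H))"
      using Dm by (intro sum.cong refl) (simp add: \<beta>_def)
    also have "\<dots> = (\<integral>x. (\<Sum>j<n. (2 ^ j) powr p * indicator (D j) x) \<partial>?H)"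
      using iD by (intro Bochner_Integration.integral_sum[symmetric])
    also have "\<dots> \<le> (\<integral>x. 2 * (indicator (frontier \<Omega>) x *\<^sub>R (\<bar>f x\<bar> powr p)) \<partial>?H)"
    proof (rule integral_mono)
      show "integrable ?H (\<lambda>x. \<Sum>j<n. (2 ^ j) powr p * indicator (D j) x)" using iD by (intro Bochner_Integration.integrable_sum)
      show "integrable ?H (\<lambda>x. 2 * (indicator (frontier \<Omega>) x *\<^sub>R (\<bar>f x\<bar> powr p)))" using fi by simp
      fix x
      show "(\<Sum>j<n. (2 ^ j) powr p * indicator (D j) x) \<le> 2 * (indicator (frontier \<Omega>) x *\<^sub>R (\<bar>f x\<bar> powr p))"
      proof (cases "x \<in> frontier \<Omega>")
        case True
        then have "(\<Sum>j<n. (2 ^ j) powr p * indicator (D j) x) = (\<Sum>j<n. (2 ^ j) powr p * of_bool (2 ^ j < \<bar>f x\<bar>))"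
          by (intro sum.cong refl) (auto simp: D_def indicator_def)
        then show ?thesis using sum_dyadic_powr[OF p, of "\<bar>f x\<bar>" n] True by simp
      next
        case False
        then have "indicator (D j) x = (0::real)" for j by (auto simp: D_def)
        then show ?thesis using False by simp
      qed
    qed
    finally show ?thesis by (simp add: B_def)
  qed

  define E where "E = (\<lambda>j::nat. {x. 2 ^ j \<le> \<bar>u0 x\<bar>})"
  have Em: "E j \<in> sets borel" for j unfolding E_def by measurable
  have E\<Omega>: "E j \<subseteq> \<Omega>" for j
  proof
    fix x assume "x \<in> E j"
    then have "2 ^ j \<le> \<bar>u0 x\<bar>" by (simp add: E_def)
    moreover have "(0::real) < 2 ^ j" by simp
    ultimately have "u0 x \<noteq> 0" by (metis abs_zero not_le)
    then show "x \<in> \<Omega>" using u00 by blast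
  qed
  have fin\<Omega>: "emeasure lborel \<Omega> < \<infinity>" using assms(3) by (rule emeasure_bounded_finite)
  have Efm: "E j \<in> fmeasurable lborel" for j
    using emeasure_mono[OF E\<Omega>[of j], of lborel] assms(2) fin\<Omega> Em by (auto simp: fmeasurable_def intro: order_le_less_trans)
  define a where "a = (\<lambda>j. measure lborel (E j))"
  have a0: "0 \<le> a j" for j by (simp add: a_def)
  define K0 where "K0 = A * (4 / ?v) powr (1 / ?N)"
  have K0: "0 \<le> K0" using A(1) by (simp add: K0_def)
  have step: "a (Suc j) \<le> K0 * a j powr (1 / ?N) * measure ?H (D j)" for j
  \<comment> \<open>The radius below would be 0 in this case, which monotonicity of the level sets
    settles.\<close>
  proof (cases "a j = 0")
    case True
    have "a (Suc j) \<le> a j" unfolding a_def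
    proof (rule measure_mono_fmeasurable)
      have "(2::real) ^ j \<le> 2 ^ Suc j" by simp
      then show "E (Suc j) \<subseteq> E j" unfolding E_def using order_trans by blast
    qed (use Em Efm in auto)
    then show ?thesis using True by simp
  next
    case False
    then have aj: "a j > 0" using a0[of j] by linarith
    \<comment> \<open>Chosen so that the ball of radius \<rho> has measure \<open>4 * a j\<close>,
      which meets the volume condition of \<open>level_set_decay\<close> because the strict level
      set lies in \<open>E j\<close>.\<close>
    define \<rho> where "\<rho> = (4 / ?v * a j) powr (1 / ?N)"
    have \<rho>: "\<rho> > 0" using aj v v' by (simp add: \<rho>_def)
    have "\<rho> ^ DIM('a) = 4 / ?v * a j"
      using aj v v' \<rho> N by (simp add: powr_realpow[symmetric] \<rho>_def powr_powr)
    then have vol: "measure lborel (ball (0::'a) \<rho>) = 4 * a j"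
    proof -
      have "measure lborel (ball (0::'a) \<rho>) = ?v * (4 / ?v * a j)"
        using \<rho> \<open>\<rho> ^ DIM('a) = 4 / ?v * a j\<close> by (simp add: content_ball)
      then show ?thesis using v' by simp
    qed
    have "measure lborel {x. 2 ^ j < \<bar>u0 x\<bar>} \<le> a j" unfolding a_def
      by (rule measure_mono_fmeasurable) (use Efm in \<open>auto simp: E_def\<close>)
    then have "measure lborel {x. 2 * 2 ^ j \<le> \<bar>u0 x\<bar>} \<le> A * \<rho> * measure ?H {x \<in> frontier \<Omega>. 2 ^ j < \<bar>f x\<bar>}"
      using Dm[of j] \<rho> vol by (intro A(2)) (auto simp: D_def)
    moreover have "A * \<rho> = K0 * a j powr (1 / ?N)"
      using aj v v' by (simp add: \<rho>_def K0_def powr_mult[symmetric])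
    ultimately show ?thesis by (simp add: a_def E_def D_def)
  qed
  define X where "X = (\<lambda>j. (2 ^ j) powr q * a j)"
  have "summable X"
  proof (rule sublinear_recursion_summable[OF _ _ \<beta>B _ N])
    show "0 \<le> X j" "0 \<le> \<beta> j" for j using a0 by (simp_all add: X_def \<beta>_def)
    show "0 \<le> 2 powr q * K0" using K0 by simp
    fix j
    have e1: "(2 ^ Suc j) powr q = 2 powr q * (2 ^ j :: real) powr q" by (simp add: powr_mult)
    have e2: "(2 ^ j :: real) powr q = (2 ^ j) powr (q / ?N) * (2 ^ j) powr p"
      by (subst powr_add[symmetric]) (simp only: qNp)
    have e3: "X j powr (1 / ?N) = (2 ^ j) powr (q / ?N) * a j powr (1 / ?N)"
      using a0[of j] by (simp add: X_def powr_mult powr_powr)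
    have "X (Suc j) \<le> (2 ^ Suc j) powr q * (K0 * a j powr (1 / ?N) * measure ?H (D j))"
      unfolding X_def using step[of j] by (intro mult_left_mono) auto
    also have "\<dots> = 2 powr q * K0 * X j powr (1 / ?N) * \<beta> j"
      unfolding e1 e2 e3 \<beta>_def by (simp only: mult_ac)
    finally show "X (Suc j) \<le> 2 powr q * K0 * X j powr (1 / ?N) * \<beta> j" .
  qed
  \<comment> \<open>Values below 1 are charged to \<Omega>, which has finite measure; a value from
    \<open>2 ^ j\<close> up to \<open>2 ^ Suc j\<close> is charged to \<open>E j\<close>, whence the
    factor \<open>2 powr q\<close>.\<close>
  have pt: "ennreal (\<bar>u0 x\<bar> powr q) \<le> indicator \<Omega> x + (\<Sum>j. ennreal (2 powr q * (2 ^ j) powr q) * indicator (E j) x)" for x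
  proof (cases "\<bar>u0 x\<bar> < 1")
    case True
    show ?thesis
    proof (cases "x \<in> \<Omega>")
      case x: True
      have "\<bar>u0 x\<bar> powr q \<le> 1 powr q" using True q by (intro powr_mono2) auto
      then have "ennreal (\<bar>u0 x\<bar> powr q) \<le> indicator \<Omega> x" using x by (simp add: ennreal_le_1)
      then show ?thesis by (rule order_trans) simp
    next
      case False then show ?thesis using u00[OF False] by simp
    qed
  next
    case False
    then obtain j where j: "2 ^ j \<le> \<bar>u0 x\<bar>" "\<bar>u0 x\<bar> < 2 ^ Suc j" using dyadic_interval[of "\<bar>u0 x\<bar>"] by auto
    have "\<bar>u0 x\<bar> powr q \<le> (2 ^ Suc j) powr q" using j q by (intro powr_mono2) auto
    also have "(2 ^ Suc j) powr q = 2 powr q * (2 ^ j :: real) powr q" by (simp add: powr_mult)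
    finally have "ennreal (\<bar>u0 x\<bar> powr q) \<le> ennreal (2 powr q * (2 ^ j) powr q) * indicator (E j) x"
      using j(1) by (simp add: E_def ennreal_leI)
    also have "\<dots> \<le> (\<Sum>i. ennreal (2 powr q * (2 ^ i) powr q) * indicator (E i) x)"
    proof -
      have "h j \<le> suminf h" for h :: "nat \<Rightarrow> ennreal"
        using sum_le_suminf[of h "{j}"] by simp
      then show ?thesis .
    qed
    finally show ?thesis by (rule order_trans) simp
  qed
  have "(\<integral>\<^sup>+x. ennreal (\<bar>u0 x\<bar> powr q) \<partial>lborel)
      \<le> (\<integral>\<^sup>+x. indicator \<Omega> x + (\<Sum>j. ennreal (2 powr q * (2 ^ j) powr q) * indicator (E j) x) \<partial>lborel)"
    by (intro nn_integral_mono pt)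
  also have "\<dots> = (\<integral>\<^sup>+x. indicator \<Omega> x \<partial>lborel) + (\<integral>\<^sup>+x. (\<Sum>j. ennreal (2 powr q * (2 ^ j) powr q) * indicator (E j) x) \<partial>lborel)"
    using assms(2) Em by (intro nn_integral_add) auto
  also have "(\<integral>\<^sup>+x. indicator \<Omega> x \<partial>lborel) = emeasure lborel \<Omega>" using assms(2) by simp
  also have "(\<integral>\<^sup>+x. (\<Sum>j. ennreal (2 powr q * (2 ^ j) powr q) * indicator (E j) x) \<partial>lborel)
      = (\<Sum>j. (\<integral>\<^sup>+x. ennreal (2 powr q * (2 ^ j) powr q) * indicator (E j) x \<partial>lborel))"
    using Em by (intro nn_integral_suminf) auto
  also have "\<dots> = (\<Sum>j. ennreal (2 powr q * X j))"
  proof (rule suminf_cong)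
    fix j
    have "emeasure lborel (E j) = ennreal (a j)"
      unfolding a_def using Efm[of j] by (intro emeasure_eq_ennreal_measure) (auto simp: fmeasurable_def)
    then show "(\<integral>\<^sup>+x. ennreal (2 powr q * (2 ^ j) powr q) * indicator (E j) x \<partial>lborel) = ennreal (2 powr q * X j)"
      using Em[of j] a0[of j] by (subst nn_integral_cmult_indicator) (auto simp: X_def ennreal_mult[symmetric] mult.assoc)
  qed
  also have "emeasure lborel \<Omega> + (\<Sum>j. ennreal (2 powr q * X j)) < \<infinity>"
  proof -
    have "(\<Sum>j. ennreal (2 powr q * X j)) \<noteq> top"
      using \<open>summable X\<close> a0 by (intro ennreal_suminf_neq_top summable_mult) (auto simp: X_def)
    then show ?thesis using fin\<Omega> by (simp add: less_top)
  qed
  finally have fin: "(\<integral>\<^sup>+x. ennreal (\<bar>u0 x\<bar> powr q) \<partial>lborel) < \<infinity>" .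
  have um: "(\<lambda>x. \<bar>u0 x\<bar> powr q) \<in> borel_measurable lborel" by measurable
  have "integrable lborel (\<lambda>x. \<bar>u0 x\<bar> powr q)"
    by (rule integrableI_bounded[OF um]) (use fin in simp)
  then have iL: "integrable lebesgue (\<lambda>x. \<bar>u0 x\<bar> powr q)" using integrable_completion[OF um] by simp
  have ubm: "(\<lambda>x. indicator \<Omega> x *\<^sub>R u x) \<in> borel_measurable lebesgue"
    using iu unfolding set_integrable_def by (rule borel_measurable_integrable)
  \<comment> \<open>Outside \<Omega> both sides agree by the convention
    \<open>0 powr q = 0\<close>.\<close>
  have eq: "(\<lambda>x. indicator \<Omega> x *\<^sub>R (\<bar>u x\<bar> powr q)) = (\<lambda>x. \<bar>indicator \<Omega> x *\<^sub>R u x\<bar> powr q)"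
    by (auto simp: indicator_def)
  have m1: "(\<lambda>x. indicator \<Omega> x *\<^sub>R (\<bar>u x\<bar> powr q)) \<in> borel_measurable lebesgue"
    unfolding eq using ubm by measurable
  have "AE x in lebesgue. indicator \<Omega> x *\<^sub>R (\<bar>u x\<bar> powr q) = \<bar>u0 x\<bar> powr q"
    using ae
  proof eventually_elim
    case (elim x)
    then show ?case using u00[of x] by (cases "x \<in> \<Omega>") auto
  qed
  then have "integrable lebesgue (\<lambda>x. indicator \<Omega> x *\<^sub>R (\<bar>u x\<bar> powr q))"
    using integrable_cong_AE[OF m1 borel_measurable_integrable[OF iL]] iL by simp
  then show ?thesis
    using ubm by (simp add: Lp_on_def set_integrable_def set_borel_measurable_def q_def)
qed

end
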